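(* Given as input an $n\times m$ matrix $M$ over a finite alphabet $A$, and an integer $k$, there is a $2^{2^{O(k^2\log k)}}(n+m)^{O(1)}$ time algorithm which returns - either a $2k(k+1)$-rich division of $M$, certifying that $\mathrm{tww}(M)>k$ (that is, any matrix with a $2k(k+1)$-rich division has twin-width greater than $k$), - or an $(|A|^{O(k^4)},|A|^{O(k^4)})$-sequence of $M$, certifying that $\mathrm{tww}(M)=|A|^{O(k^4)}$.
   Context: A matrix $M:R\times C\to A$ has a finite totally ordered set $R$ of rows and a finite totally ordered set $C$ of columns. The size of the alphabet $A$ is treated as a constant in the running time. Twin-width. The span of a nonempty set $S$ of columns is the set of all columns between the smallest and the largest element of $S$ (inclusive); likewise for rows. Two sets of columns (or of rows) are in conflict if their spans intersect. A partition of $C$ (or $R$) is $p$-overlapping if every part is in conflict with at most $p$ other parts. A contraction sequence of $M$ is a sequence $\mathcal P_1,\dots,\mathcal P_{n+m-1}$ of partitions of $R\cup C$ such that $\mathcal P_1$ is the partition into singletons, each $\mathcal P_{i+1}$ arises from $\mathcal P_i$ by merging two row parts or two column parts, and $\mathcal P_{n+m-1}=\{R,C\}$. Let $\mathcal P_i^R,\mathcal P_i^C$ be the induced partitions of $R$ and $C$. The error value of a column part $Q\in\mathcal P_i^C$ is the number of row parts $P\in\mathcal P_i^R$ such that the submatrix with rows $P$ and columns $Q$ is not constant; symmetrically for row parts. A $(p,e)$-sequence is a contraction sequence in which all $\mathcal P_i^R,\mathcal P_i^C$ are $p$-overlapping and all error values are at most $e$. The twin-width $\mathrm{tww}(M)$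 is the minimum of $p+e$ over all $(p,e)$-sequences of $M$. Rich divisions. A division $\mathcal D=(\mathcal D^R,\mathcal D^C)$ of $M$ consists of a partition $\mathcal D^R$ of the rows into intervals and a partition $\mathcal D^C$ of the columns into intervals. It is $q$-rich if: for every part $R_a\in\mathcal D^R$ and every set $Y$ of at most $q$ parts of $\mathcal D^C$, the submatrix with rows $R_a$ and columns $C\setminus\bigcup Y$ has at least $q$ distinct row vectors; and for every part $C_b\in\mathcal D^C$ and every set $X$ of at most $q$ parts of $\mathcal D^R$, the submatrix with rows $R\setminus\bigcup X$ and columns $C_b$ has at least $q$ distinct column vectors. *)

theory Defs
  imports Complex_Main "HOL-Library.FuncSet" "HOL-Library.Disjoint_Sets"
    "HOL-Library.Landau_Symbols"
begin

section \<open>Twin-width of matrices\<close>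

text \<open>
  A matrix is a function \<open>M\<close> used only on the finite, nonempty, linearly ordered carriers \<open>R\<close> (rows)
  and \<open>C\<close> (columns). Statements about columns are obtained from those about rows via \<open>flip\<close>.
\<close>

definition flip :: "('r \<Rightarrow> 'c \<Rightarrow> 'a) \<Rightarrow> 'c \<Rightarrow> 'r \<Rightarrow> 'a" where
  "flip M c r = M r c"

text \<open>In the following, \<open>U\<close> is the ambient ordered set (\<open>R\<close> or \<open>C\<close>).\<close>

definition span_in :: "'a::linorder set \<Rightarrow> 'a set \<Rightarrow> 'a set" where
  "span_in U S = {x \<in> U. Min S \<le> x \<and> x \<le> Max S}"

definition conflict :: "'a::linorder set \<Rightarrow> 'a set \<Rightarrow> 'a set \<Rightarrow> bool" where
  "conflict U S T \<longleftrightarrow> span_in U S \<inter> span_in U T \<noteq> {}"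

definition overlapping :: "'a::linorder set \<Rightarrow> nat \<Rightarrow> 'a set set \<Rightarrow> bool" where
  "overlapping U p \<P> \<longleftrightarrow> (\<forall>S\<in>\<P>. card {T \<in> \<P>. T \<noteq> S \<and> conflict U S T} \<le> p)"

definition singletons :: "'a set \<Rightarrow> 'a set set" where
  "singletons U = (\<lambda>x. {x}) ` U"

definition merges :: "'a set set \<Rightarrow> 'a set set \<Rightarrow> bool" where
  "merges \<P> \<Q> \<longleftrightarrow> (\<exists>S\<in>\<P>. \<exists>T\<in>\<P>. S \<noteq> T \<and> \<Q> = insert (S \<union> T) (\<P> - {S, T}))"

text \<open>
  No part of a partition in a contraction sequence mixes rows and columns, so a partition of the
  disjoint union of \<open>R\<close> and \<open>C\<close> is represented by the pair of induced partitions of \<open>R\<close> and of \<open>C\<close>.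
\<close>

type_synonym ('r, 'c) bipartition = "'r set set \<times> 'c set set"

definition contraction_step :: "('r, 'c) bipartition \<Rightarrow> ('r, 'c) bipartition \<Rightarrow> bool" where
  "contraction_step P Q \<longleftrightarrow>
     merges (fst P) (fst Q) \<and> snd Q = snd P \<or> merges (snd P) (snd Q) \<and> fst Q = fst P"

definition contraction_sequence :: "'r set \<Rightarrow> 'c set \<Rightarrow> ('r, 'c) bipartition list \<Rightarrow> bool" where
  "contraction_sequence R C Ps \<longleftrightarrow>
     Ps \<noteq> [] \<and> length Ps = card R + card C - 1 \<and>
     hd Ps = (singletons R, singletons C) \<and>
     (\<forall>i. Suc i < length Ps \<longrightarrow> contraction_step (Ps ! i) (Ps ! Suc i)) \<and>
     last Ps = ({R}, {C})"

definition constant_on_zone :: "('r \<Rightarrow> 'c \<Rightarrow> 'a) \<Rightarrow> 'r set \<Rightarrow> 'c set \<Rightarrow> bool" where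
  "constant_on_zone M P Q \<longleftrightarrow> (\<exists>x. \<forall>r\<in>P. \<forall>c\<in>Q. M r c = x)"

text \<open>Error value of the row part \<open>P\<close> with respect to the column partition \<open>\<Q>\<close>.\<close>

definition error_value :: "('r \<Rightarrow> 'c \<Rightarrow> 'a) \<Rightarrow> 'c set set \<Rightarrow> 'r set \<Rightarrow> nat" where
  "error_value M \<Q> P = card {Q \<in> \<Q>. \<not> constant_on_zone M P Q}"

definition pe_sequence ::
  "'r::linorder set \<Rightarrow> 'c::linorder set \<Rightarrow> ('r \<Rightarrow> 'c \<Rightarrow> 'a) \<Rightarrow> nat \<Rightarrow> nat \<Rightarrow>
    ('r, 'c) bipartition list \<Rightarrow> bool" where
  "pe_sequence R C M p e Ps \<longleftrightarrow> contraction_sequence R C Ps \<and>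
     (\<forall>(\<P>, \<Q>) \<in> set Ps.
        overlapping R p \<P> \<and> overlapping C p \<Q> \<and>
        (\<forall>P\<in>\<P>. error_value M \<Q> P \<le> e) \<and>
        (\<forall>Q\<in>\<Q>. error_value (flip M) \<P> Q \<le> e))"

definition tww :: "'r::linorder set \<Rightarrow> 'c::linorder set \<Rightarrow> ('r \<Rightarrow> 'c \<Rightarrow> 'a) \<Rightarrow> nat" where
  "tww R C M = (LEAST t. \<exists>p e Ps. t = p + e \<and> pe_sequence R C M p e Ps)"


section \<open>Rich divisions\<close>

definition interval_partition :: "'a::linorder set \<Rightarrow> 'a set set \<Rightarrow> bool" where
  "interval_partition U \<D> \<longleftrightarrow> partition_on U \<D> \<and>
     (\<forall>S\<in>\<D>. \<forall>x\<in>S. \<forall>z\<in>S. \<forall>y\<in>U. x \<le> y \<and> y \<le> z \<longrightarrow> y \<in> S)"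

definition distinct_rows :: "('r \<Rightarrow> 'c \<Rightarrow> 'a) \<Rightarrow> 'r set \<Rightarrow> 'c set \<Rightarrow> nat" where
  "distinct_rows M I J = card ((\<lambda>r. restrict (M r) J) ` I)"

definition row_rich ::
  "'c set \<Rightarrow> ('r \<Rightarrow> 'c \<Rightarrow> 'a) \<Rightarrow> nat \<Rightarrow> 'r set set \<Rightarrow> 'c set set \<Rightarrow> bool" where
  "row_rich C M q \<D>R \<D>C \<longleftrightarrow>
     (\<forall>S\<in>\<D>R. \<forall>Y. Y \<subseteq> \<D>C \<and> card Y \<le> q \<longrightarrow> q \<le> distinct_rows M S (C - \<Union>Y))"

definition rich_division ::
  "'r::linorder set \<Rightarrow> 'c::linorder set \<Rightarrow> ('r \<Rightarrow> 'c \<Rightarrow> 'a) \<Rightarrow> nat \<Rightarrow>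
    'r set set \<times> 'c set set \<Rightarrow> bool" where
  "rich_division R C M q D \<longleftrightarrow>
     interval_partition R (fst D) \<and> interval_partition C (snd D) \<and>
     row_rich C M q (fst D) (snd D) \<and> row_rich R (flip M) q (snd D) (fst D)"


section \<open>Model of computation\<close>

text \<open>
  Algorithms are first-order, call-by-value recursive programs over binary trees (pure LISP with a
  single atom). Every elementary operation -- variable access, constant, constructing or taking
  apart a cell, test for \<open>Null\<close>, function call -- costs one unit of time; there is no built-in
  arithmetic and no built-in comparison of trees. Each operation allocates at most one cell, so
  with shared cells this time is polynomially related to that of Turing machines.
  A program is a list of function bodies; \<open>Var i\<close> is the \<open>i\<close>th argument of the current
  call, and the main function has number 0.
\<close>

datatype sexp = Null | Cell sexp sexp

primrec left :: "sexp \<Rightarrow> sexp" where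
  "left Null = Null"
| "left (Cell x y) = x"

primrec right :: "sexp \<Rightarrow> sexp" where
  "right Null = Null"
| "right (Cell x y) = y"

datatype expr =
    Var nat
  | Empty
  | Join expr expr
  | First expr
  | Rest expr
  | Cond expr expr expr
  | Call nat "expr list"

type_synonym program = "expr list"

text \<open>\<open>eval p env e v t\<close>: in environment \<open>env\<close>, expression \<open>e\<close> evaluates to \<open>v\<close> in time \<open>t\<close>.\<close>

inductive eval :: "program \<Rightarrow> sexp list \<Rightarrow> expr \<Rightarrow> sexp \<Rightarrow> nat \<Rightarrow> bool"
  and evals :: "program \<Rightarrow> sexp list \<Rightarrow> expr list \<Rightarrow> sexp list \<Rightarrow> nat \<Rightarrow> bool"
  for p :: program where
  eval_Var: "i < length env \<Longrightarrow> eval p env (Var i) (env ! i) 1"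
| eval_Empty: "eval p env Empty Null 1"
| eval_Join: "eval p env e1 v1 t1 \<Longrightarrow> eval p env e2 v2 t2 \<Longrightarrow>
    eval p env (Join e1 e2) (Cell v1 v2) (t1 + t2 + 1)"
| eval_First: "eval p env e v t \<Longrightarrow> eval p env (First e) (left v) (t + 1)"
| eval_Rest: "eval p env e v t \<Longrightarrow> eval p env (Rest e) (right v) (t + 1)"
| eval_Cond_then: "eval p env e v t \<Longrightarrow> v \<noteq> Null \<Longrightarrow> eval p env e1 w s \<Longrightarrow>
    eval p env (Cond e e1 e2) w (t + s + 1)"
| eval_Cond_else: "eval p env e Null t \<Longrightarrow> eval p env e2 w s \<Longrightarrow>
    eval p env (Cond e e1 e2) w (t + s + 1)"
| eval_Call: "evals p env es vs t \<Longrightarrow> f < length p \<Longrightarrow> eval p vs (p ! f) w s \<Longrightarrow>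
    eval p env (Call f es) w (t + s + 1)"
| evals_Nil: "evals p env [] [] 0"
| evals_Cons: "eval p env e v t \<Longrightarrow> evals p env es vs s \<Longrightarrow>
    evals p env (e # es) (v # vs) (t + s)"

definition run :: "program \<Rightarrow> sexp list \<Rightarrow> sexp \<Rightarrow> nat \<Rightarrow> bool" where
  "run p args v t \<longleftrightarrow> p \<noteq> [] \<and> eval p args (p ! 0) v t"

lemma eval_deterministic:
  "eval p env e v t \<Longrightarrow> eval p env e v' t' \<Longrightarrow> v' = v \<and> t' = t"
  "evals p env es vs s \<Longrightarrow> evals p env es vs' s' \<Longrightarrow> vs' = vs \<and> s' = s"
proof (induction arbitrary: v' t' and vs' s' rule: eval_evals.inducts)
  case eval_Var
  from eval_Var.prems show ?case by cases auto
next
  case eval_Empty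
  from eval_Empty.prems show ?case by cases auto
next
  case eval_Join
  from eval_Join.prems show ?case by cases (use eval_Join in blast)+
next
  case eval_First
  from eval_First.prems show ?case by cases (use eval_First in blast)+
next
  case eval_Rest
  from eval_Rest.prems show ?case by cases (use eval_Rest in blast)+
next
  case eval_Cond_then
  from eval_Cond_then.prems show ?case by cases (use eval_Cond_then in blast)+
next
  case eval_Cond_else
  from eval_Cond_else.prems show ?case by cases (use eval_Cond_else in blast)+
next
  case eval_Call
  from eval_Call.prems show ?case by cases (use eval_Call in blast)+
next
  case evals_Nil
  from evals_Nil.prems show ?case by cases auto
next
  case evals_Cons
  from evals_Cons.prems show ?case by cases (use evals_Cons in blast)+
qed


section \<open>Encoding of inputs and outputs\<close>

text \<open>
  Numbers are in unary. As running times are measured in \<open>n\<close>, \<open>m\<close> and \<open>k\<close> rather than in the length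
  of the input, this does not affect the bounds.
\<close>

primrec enc_nat :: "nat \<Rightarrow> sexp" where
  "enc_nat 0 = Null"
| "enc_nat (Suc n) = Cell Null (enc_nat n)"

definition enc_list :: "('a \<Rightarrow> sexp) \<Rightarrow> 'a list \<Rightarrow> sexp" where
  "enc_list enc xs = foldr (\<lambda>x y. Cell (enc x) y) xs Null"

definition enc_matrix :: "nat \<Rightarrow> nat \<Rightarrow> (nat \<Rightarrow> nat \<Rightarrow> nat) \<Rightarrow> sexp" where
  "enc_matrix n m M =
     enc_list (enc_list enc_nat) (map (\<lambda>i. map (\<lambda>j. M i j) [0..<m]) [0..<n])"

text \<open>A family of sets is given by a list of its members, each of them a list of its elements.\<close>

type_synonym parts = "nat list list"

definition family :: "parts \<Rightarrow> nat set set" where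
  "family xss = set (map set xss)"

definition family_pair :: "parts \<times> parts \<Rightarrow> (nat, nat) bipartition" where
  "family_pair = map_prod family family"

definition enc_parts_pair :: "parts \<times> parts \<Rightarrow> sexp" where
  "enc_parts_pair D = Cell (enc_list (enc_list enc_nat) (fst D)) (enc_list (enc_list enc_nat) (snd D))"

datatype answer = Division "parts \<times> parts" | Sequence "(parts \<times> parts) list"

primrec enc_answer :: "answer \<Rightarrow> sexp" where
  "enc_answer (Division D) = Cell Null (enc_parts_pair D)"
| "enc_answer (Sequence Ds) = Cell (Cell Null Null) (enc_list enc_parts_pair Ds)"

end

theory Submission
  imports Defs
begin

text \<open>
  \<^bold>\<open>Rich divisions.\<close> In a contraction sequence, consider the first part whose span covers an
  interval \<open>S\<close> of the division, say a row interval. Few row parts meet \<open>S\<close>, each of them is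
  non-constant against few column parts, and no column part covers an interval of the division
  yet, so each meets at most two of them. After deleting these few column intervals, \<open>S\<close> has few
  distinct rows. This is \<open>rich_division_tww\<close>.

  \<^bold>\<open>The algorithm.\<close> Let \<open>q = 6 k (k + 1)\<close>. Start with the division into singletons, and merge two
  adjacent row intervals (or column intervals) whenever their union \<open>S\<close> is tame: at most \<open>q\<close>
  column intervals can be deleted such that fewer than \<open>q\<close> distinct rows of \<open>S\<close> remain. Suppose
  that this gets stuck before only one row and one column interval are left. Then joining the
  intervals in pairs (and one triple) gives a rich division, since deleting \<open>2 k (k + 1)\<close> of the
  joined intervals deletes at most \<open>q\<close> old ones.

  \<^bold>\<open>The sequence.\<close> Otherwise, every division on the way is turned into a partition that does not
  depend on the choice of the deleted intervals. Two rows of \<open>S\<close> are close if they differ on at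
  most \<open>q\<close> column intervals, and a column interval is volatile for \<open>S\<close> if two close rows of \<open>S\<close>
  differ on it. Row and column intervals that are volatile for each other are entangled. Two rows
  of \<open>S\<close> are twins if they agree on all column intervals that are not entangled with \<open>S\<close>; columns
  are treated in the same way. Three facts make this work.

  \<^item> When intervals are merged, rows only get closer, so entanglement grows, and twins remain
    twins (\<open>twins_mono\<close>). Hence the partitions into twins become coarser, and it suffices to
    merge parts of twins one pair at a time.

  \<^item> A zone of a set of twin rows and a set of twin columns is constant unless their intervals are
    entangled, because otherwise the rows agree on the column interval and the columns agree on
    the row interval.

  \<^item> A tame interval has at most \<open>q\<^sup>3 + q + 1\<close> volatile counterparts (\<open>card_volatile\<close>) and at most
    \<open>q a\<^bsup>q q\<^esup>\<close> classes of twins (\<open>few_twin_classes\<close>). This bounds overlaps and errors. For the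
    second bound, rows that agree outside of the \<open>q\<close> deleted intervals are close. On a deleted
    interval that is not entangled with \<open>S\<close>, they are equal or determined by fewer than \<open>q\<close> of
    their entries.

  \<^bold>\<open>Running time.\<close> Only volatile intervals need to be deleted (\<open>tame_volatile\<close>). So tameness is
  decided by trying all subsets of a set of at most \<open>(q + 1)\<^sup>3\<close> intervals. Everything else is
  polynomial, and the total time is at most \<open>3\<close> to the power \<open>(q + 1)\<^sup>3\<close> times a polynomial in
  \<open>n\<close>, \<open>m\<close>, \<open>q\<close> and the size of the alphabet.
\<close>

section \<open>Contraction sequences\<close>

lemma merge_partition:
  assumes "partition_on U P" "S \<in> P" "T \<in> P" "S \<noteq> T"
  shows "partition_on U (insert (S \<union> T) (P - {S, T}))"
proof -
  have "disjoint P" "\<Union>P = U" "{} \<notin> P"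
    using assms(1) by (auto simp: partition_on_def)
  have "disjoint (insert (S \<union> T) (P - {S, T}))"
    using \<open>disjoint P\<close> assms(2-4) unfolding disjoint_def by blast
  moreover have "\<Union>(insert (S \<union> T) (P - {S, T})) = U"
    using \<open>\<Union>P = U\<close> assms(2,3) by blast
  ultimately show ?thesis
    using \<open>{} \<notin> P\<close> assms(2) by (auto simp: partition_on_def)
qed

lemma card_merge:
  assumes "partition_on U P" "finite P" "S \<in> P" "T \<in> P" "S \<noteq> T"
  shows "Suc (card (insert (S \<union> T) (P - {S, T}))) = card P"
proof -
  have "S \<union> T \<notin> P - {S, T}"
  proof
    assume U: "S \<union> T \<in> P - {S, T}"
    have "S \<noteq> {}" using assms(1,3) by (auto simp: partition_on_def)
    moreover have "S \<inter> (S \<union> T) = {}"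
      using U assms(1,3) by (metis DiffD1 DiffD2 disjointD insertI1 partition_onD2)
    ultimately show False by blast
  qed
  moreover have "card (P - {S, T}) = card P - 2"
    using assms by (subst card_Diff_subset) auto
  moreover have "card {S, T} \<le> card P"
    using assms by (intro card_mono) auto
  ultimately show ?thesis using assms by simp
qed

lemma merges_partition:
  assumes "merges P Q" "partition_on U P"
  shows "partition_on U Q"
  using assms merge_partition unfolding merges_def by metis

lemma partition_singletons: "partition_on U (singletons U)"
  by (auto simp: partition_on_def singletons_def disjoint_def)

lemma card_singletons: "card (singletons U) = card U"
  unfolding singletons_def by (simp add: card_image)

lemma partition_on_cards:
  assumes "finite U" "partition_on U P"
  shows "finite P" "S \<in> P \<Longrightarrow> finite S \<and> S \<noteq> {} \<and> S \<subseteq> U"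
  using assms finite_elements[OF assms] by (auto simp: partition_on_def intro: finite_subset)

lemma partition_card_1:
  assumes "partition_on U P" "card P = 1"
  shows "P = {U}"
  using assms by (auto simp: partition_on_def card_1_singleton_iff)

text \<open>Everything that a contraction sequence has to satisfy apart from where it starts.\<close>

definition contracts_fully :: "'r set \<Rightarrow> 'c set \<Rightarrow> ('r, 'c) bipartition list \<Rightarrow> bool" where
  "contracts_fully R C Ps \<longleftrightarrow> Ps \<noteq> [] \<and>
     (\<forall>i. Suc i < length Ps \<longrightarrow> contraction_step (Ps ! i) (Ps ! Suc i)) \<and> last Ps = ({R}, {C})"

lemma contracts_fully_Cons:
  assumes "contracts_fully R C Ps" "contraction_step P (hd Ps)"
  shows "contracts_fully R C (P # Ps)"
  unfolding contracts_fully_def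
proof (intro conjI allI impI)
  fix i assume "Suc i < length (P # Ps)"
  then show "contraction_step ((P # Ps) ! i) ((P # Ps) ! Suc i)"
    using assms by (cases i) (auto simp: contracts_fully_def hd_conv_nth)
qed (use assms in \<open>auto simp: contracts_fully_def\<close>)

lemma contraction_from_partitions:
  assumes "partition_on R P" "finite P" "P \<noteq> {}" "partition_on C Q" "finite Q" "Q \<noteq> {}"
  shows "\<exists>Ps. contracts_fully R C Ps \<and> hd Ps = (P, Q) \<and> length Ps = card P + card Q - 1"
  using assms
proof (induction "card P + card Q" arbitrary: P Q rule: less_induct)
  case less
  have two: "\<exists>S\<in>X. \<exists>T\<in>X. S \<noteq> T" if X: "card X \<noteq> 1" "X \<noteq> {}" for X :: "'x set"
  proof (rule ccontr)
    assume "\<not> ?thesis"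
    moreover obtain S where "S \<in> X" using X by blast
    ultimately have "X = {S}" by blast
    then show False using X by simp
  qed
  have pos: "card P > 0" "card Q > 0" using less.prems by (simp_all add: card_gt_0_iff)
  have goal: ?case
    if new: "partition_on R P'" "finite P'" "P' \<noteq> {}" "partition_on C Q'" "finite Q'" "Q' \<noteq> {}"
      and step: "contraction_step (P, Q) (P', Q')" and c:
        "Suc (card P' + card Q') = card P + card Q"
    for P' Q'
  proof -
    obtain Ps where "contracts_fully R C Ps \<and> hd Ps = (P', Q') \<and>
        length Ps = card P' + card Q' - 1"
      using less.hyps[of P' Q'] new c by auto
    moreover have "card P' > 0" using new by (simp add: card_gt_0_iff)
    ultimately show ?thesis using c step
      by (intro exI[of _ "(P, Q) # Ps"]) (auto intro: contracts_fully_Cons)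
  qed
  consider "card P \<noteq> 1" | "card Q \<noteq> 1" | "card P = 1" "card Q = 1" by blast
  then show ?case
  proof cases
    case 1
    then obtain S T where ST: "S \<in> P" "T \<in> P" "S \<noteq> T" using two less.prems by metis
    then show ?thesis
      using merge_partition[OF less.prems(1) ST] card_merge[OF less.prems(1,2) ST] less.prems
      by (intro goal[of "insert (S \<union> T) (P - {S, T})" Q])
        (simp_all add: contraction_step_def merges_def, blast?)
  next
    case 2
    then obtain S T where ST: "S \<in> Q" "T \<in> Q" "S \<noteq> T" using two less.prems by metis
    then show ?thesis
      using merge_partition[OF less.prems(4) ST] card_merge[OF less.prems(4,5) ST] less.prems
      by (intro goal[of P "insert (S \<union> T) (Q - {S, T})"])
        (simp_all add: contraction_step_def merges_def, blast?)
  next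
    case 3
    then have "P = {R}" "Q = {C}" using partition_card_1 less.prems(1,4) by metis+
    then show ?thesis by (intro exI[of _ "[(P, Q)]"]) (auto simp: contracts_fully_def)
  qed
qed

lemma contraction_sequence_partitions:
  assumes "contraction_sequence R C Ps" "i < length Ps"
  shows "partition_on R (fst (Ps ! i)) \<and> partition_on C (snd (Ps ! i))"
  using assms(2)
proof (induction i)
  case 0
  then show ?case using assms(1)
    by (auto simp: contraction_sequence_def hd_conv_nth partition_singletons)
next
  case (Suc i)
  then have "contraction_step (Ps ! i) (Ps ! Suc i)"
    using assms(1) by (auto simp: contraction_sequence_def)
  moreover have "partition_on R (fst (Ps ! i))" "partition_on C (snd (Ps ! i))" using Suc by auto
  ultimately show ?case unfolding contraction_step_def by (auto dest: merges_partition)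
qed

text \<open>
  The twin-width is a least number; it is the value for an actual sequence only because there is
  one.
\<close>

lemma pe_sequence_exists:
  fixes R :: "'r::linorder set" and C :: "'c::linorder set"
  assumes "finite R" "R \<noteq> {}" "finite C" "C \<noteq> {}"
  shows "\<exists>p e Ps. pe_sequence R C M p e Ps"
proof -
  obtain Ps where Ps: "contracts_fully R C Ps" "hd Ps = (singletons R, singletons C)"
    "length Ps = card (singletons R) + card (singletons C) - 1"
    using contraction_from_partitions[of R "singletons R" C "singletons C"] assms
    by (auto simp: partition_singletons) (auto simp: singletons_def)
  have cs: "contraction_sequence R C Ps"
    using Ps by (auto simp: contraction_sequence_def contracts_fully_def card_singletons)
  define b where "b = card (Pow R) + card (Pow C)"
  have bound: "card {X \<in> \<P>. h X} \<le> card (Pow U)"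
    if "partition_on U \<P>" "finite U" for U \<P> and h :: "'u set \<Rightarrow> bool"
    using that by (intro card_mono) (auto simp: partition_on_def)
  have "pe_sequence R C M b b Ps"
    unfolding pe_sequence_def
  proof (intro conjI cs, clarify)
    fix P Q assume "(P, Q) \<in> set Ps"
    then obtain i where "i < length Ps" "Ps ! i = (P, Q)" by (auto simp: in_set_conv_nth)
    then have "partition_on R P" "partition_on C Q"
      using contraction_sequence_partitions[OF cs, of i] by auto
    from bound[OF this(1) assms(1)] bound[OF this(2) assms(3)]
    have "card {X \<in> P. h X} \<le> b" "card {Y \<in> Q. g Y} \<le> b" for h g
      unfolding b_def by (meson trans_le_add1 trans_le_add2)+
    then show "overlapping R b P \<and> overlapping C b Q \<and>
        (\<forall>X\<in>P. error_value M Q X \<le> b) \<and> (\<forall>Y\<in>Q. error_value (flip M) P Y \<le> b)"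
      unfolding overlapping_def error_value_def by simp
  qed
  then show ?thesis by blast
qed


section \<open>Rich divisions force large twin-width\<close>

lemma interval_partition_part:
  assumes "interval_partition U D" "S \<in> D" "x \<in> S" "z \<in> S" "y \<in> U" "x \<le> y" "y \<le> z"
  shows "y \<in> S"
  using assms unfolding interval_partition_def by blast

lemma card_parts_containing:
  assumes "partition_on U D"
  shows "finite {B \<in> D. x \<in> B} \<and> card {B \<in> D. x \<in> B} \<le> 1"
proof (cases "\<exists>B\<in>D. x \<in> B")
  case True
  then obtain B where "B \<in> D" "x \<in> B" by blast
  then have "{B \<in> D. x \<in> B} = {B}"
    using assms by (auto simp: partition_on_def disjoint_def)
  then show ?thesis by simp
next
  case False
  then have "{B \<in> D. x \<in> B} = {}" by blast
  then show ?thesis by (simp only: finite.emptyI card.empty) simp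
qed

text \<open>
  An interval that meets \<open>Q\<close> and sticks out of its span contains the smallest or the largest
  element of \<open>Q\<close>.
\<close>

lemma few_intervals_meet:
  assumes "interval_partition C D" "finite C" "Q \<subseteq> C" "Q \<noteq> {}"
    and out: "\<And>B. B \<in> D \<Longrightarrow> \<not> B \<subseteq> span_in C Q"
  shows "card {B \<in> D. B \<inter> Q \<noteq> {}} \<le> 2"
proof -
  have part: "partition_on C D" using assms(1) by (simp add: interval_partition_def)
  have fQ: "finite Q" using assms finite_subset by blast
  have "{B \<in> D. B \<inter> Q \<noteq> {}} \<subseteq> {B \<in> D. Min Q \<in> B} \<union> {B \<in> D. Max Q \<in> B}"
  proof safe
    fix B y assume B: "B \<in> D" "y \<in> B" "y \<in> Q" "Max Q \<notin> B"
    obtain b where b: "b \<in> B" "b \<notin> span_in C Q" using out[OF B(1)] by blast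
    have "b \<in> C" using b B part by (auto simp: partition_on_def)
    then have "b < Min Q \<or> Max Q < b" using b by (auto simp: span_in_def)
    moreover have "Min Q \<le> y" "y \<le> Max Q" using B fQ by auto
    moreover have "Min Q \<in> C" "Max Q \<in> C" using assms(3,4) fQ Min_in Max_in by blast+
    ultimately show "Min Q \<in> B"
      using interval_partition_part[OF assms(1) B(1)] b(1) B(2,4) by (metis less_imp_le)
  qed
  then have "card {B \<in> D. B \<inter> Q \<noteq> {}} \<le> card ({B \<in> D. Min Q \<in> B} \<union> {B \<in> D. Max Q \<in> B})"
    using card_parts_containing[OF part] by (intro card_mono) auto
  also have "\<dots> \<le> card {B \<in> D. Min Q \<in> B} + card {B \<in> D. Max Q \<in> B}" by (rule card_Un_le)
  also have "\<dots> \<le> 2"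
    using card_parts_containing[OF part, of "Min Q"] card_parts_containing[OF part, of "Max Q"]
    by simp
  finally show ?thesis .
qed

text \<open>
  The row parts that meet \<open>S\<close> are in conflict with \<open>P\<close>, so there are at most \<open>p + 1\<close> of them.
  Each has at most \<open>e\<close> non-constant zones, and a column part meets at most two intervals of the
  column division. Outside of these \<open>2 (p + 1) e\<close> intervals, rows of \<open>S\<close> in the same part are
  equal.
\<close>

lemma covered_interval_not_rich:
  fixes R :: "'r::linorder set" and C :: "'c::linorder set"
  assumes fin: "finite R" "finite C"
    and PR: "partition_on R PR" and PC: "partition_on C PC"
    and ov: "overlapping R p PR" and err: "\<And>P. P \<in> PR \<Longrightarrow> error_value M PC P \<le> e"
    and S: "S \<subseteq> span_in R P" and P: "P \<in> PR"
    and D: "interval_partition C D"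
    and out: "\<And>B Q. B \<in> D \<Longrightarrow> Q \<in> PC \<Longrightarrow> \<not> B \<subseteq> span_in C Q"
  shows "\<exists>Y\<subseteq>D. card Y \<le> 2 * (p + 1) * e \<and> distinct_rows M S (C - \<Union>Y) \<le> p + 1"
proof -
  (* The row parts that meet S, the column parts in error with them, the intervals these meet. *)
  define G where "G = {T \<in> PR. T \<inter> S \<noteq> {}}"
  define E where "E = (\<Union>T\<in>G. {Q \<in> PC. \<not> constant_on_zone M T Q})"
  define Y where "Y = (\<Union>Q\<in>E. {B \<in> D. B \<inter> Q \<noteq> {}})"
  have fPR: "finite PR" and fPC: "finite PC"
    using partition_on_cards(1) fin PR PC by auto
  have SR: "S \<subseteq> R" using S by (auto simp: span_in_def)
  have "G \<subseteq> insert P {T \<in> PR. T \<noteq> P \<and> conflict R P T}"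
  proof
    fix T assume T: "T \<in> G"
    then obtain x where x: "x \<in> T" "x \<in> S" by (auto simp: G_def)
    have "finite T" "T \<subseteq> R" using partition_on_cards(2)[OF fin(1) PR] T by (auto simp: G_def)
    then have "x \<in> span_in R T" using x by (auto simp: span_in_def)
    moreover have "x \<in> span_in R P" using x S by blast
    ultimately have "conflict R P T" unfolding conflict_def by blast
    then show "T \<in> insert P {T \<in> PR. T \<noteq> P \<and> conflict R P T}" using T by (auto simp: G_def)
  qed
  then have "card G \<le> card (insert P {T \<in> PR. T \<noteq> P \<and> conflict R P T})"
    using fPR by (intro card_mono) auto
  also have "\<dots> \<le> Suc (card {T \<in> PR. T \<noteq> P \<and> conflict R P T})" by (rule card_insert_le_m1) auto
  also have "\<dots> \<le> p + 1" using ov P unfolding overlapping_def by auto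
  finally have G: "card G \<le> p + 1" .
  have fG: "finite G" using fPR by (simp add: G_def)
  have "card E \<le> (\<Sum>T\<in>G. card {Q \<in> PC. \<not> constant_on_zone M T Q})"
    unfolding E_def by (rule card_UN_le[OF fG])
  also have "\<dots> \<le> (\<Sum>T\<in>G. e)"
    using err by (intro sum_mono) (auto simp: error_value_def G_def)
  also have "\<dots> \<le> (p + 1) * e" using mult_le_mono1[OF G, of e] by simp
  finally have E: "card E \<le> (p + 1) * e" .
  have fE: "finite E" and EPC: "E \<subseteq> PC" using fG fPC by (auto simp: E_def)
  have "card Y \<le> (\<Sum>Q\<in>E. card {B \<in> D. B \<inter> Q \<noteq> {}})"
    unfolding Y_def by (rule card_UN_le[OF fE])
  also have "\<dots> \<le> (\<Sum>Q\<in>E. 2)"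
  proof (intro sum_mono few_intervals_meet[OF D fin(2)])
    fix Q assume "Q \<in> E"
    then have "Q \<in> PC" using EPC by blast
    then show "Q \<subseteq> C" "Q \<noteq> {}" using partition_on_cards(2)[OF fin(2) PC] by auto
    show "\<not> B \<subseteq> span_in C Q" if "B \<in> D" for B using out[OF that \<open>Q \<in> PC\<close>] .
  qed
  also have "\<dots> \<le> 2 * (p + 1) * e" using E by simp
  finally have cY: "card Y \<le> 2 * (p + 1) * e" .
  have UD: "\<Union>D = C" using D by (auto simp: interval_partition_def partition_on_def)
  let ?v = "\<lambda>r. restrict (M r) (C - \<Union>Y)"
  have same: "?v r = ?v s" if "T \<in> G" "r \<in> T" "s \<in> T" for T r s
  proof (rule restrict_ext)
    fix c assume c: "c \<in> C - \<Union>Y"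
    then obtain Q where Q: "Q \<in> PC" "c \<in> Q" using PC by (auto simp: partition_on_def)
    obtain B where "B \<in> D" "c \<in> B" using c UD by blast
    then have "Q \<notin> E" using c Q(2) unfolding Y_def by blast
    then have "constant_on_zone M T Q" using that Q by (auto simp: E_def)
    then show "M r c = M s c" using that Q unfolding constant_on_zone_def by metis
  qed
  define rep where "rep = (\<lambda>T. ?v (SOME r. r \<in> T))"
  have "?v ` S \<subseteq> rep ` G"
  proof
    fix w assume "w \<in> ?v ` S"
    then obtain r where r: "r \<in> S" "w = ?v r" by blast
    then obtain T where T: "T \<in> PR" "r \<in> T" using SR PR by (auto simp: partition_on_def)
    then have "T \<in> G" using r by (auto simp: G_def)
    moreover have "(SOME r. r \<in> T) \<in> T" using T(2) by (rule someI)
    ultimately show "w \<in> rep ` G" using same T(2) r(2) unfolding rep_def by blast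
  qed
  then have "distinct_rows M S (C - \<Union>Y) \<le> card G"
    unfolding distinct_rows_def using fG by (meson surj_card_le)
  then have "distinct_rows M S (C - \<Union>Y) \<le> p + 1" using G by simp
  moreover have "Y \<subseteq> D" by (auto simp: Y_def)
  ultimately show ?thesis using cY by blast
qed

lemma covered_interval_contradicts_rich:
  fixes R :: "'r::linorder set" and C :: "'c::linorder set"
  assumes "finite R" "finite C" "partition_on R PR" "partition_on C PC"
    and "overlapping R p PR" "\<And>P. P \<in> PR \<Longrightarrow> error_value M PC P \<le> e"
    and "S \<in> DR" "S \<subseteq> span_in R P" "P \<in> PR" "interval_partition C DC"
    and "\<And>B Q. B \<in> DC \<Longrightarrow> Q \<in> PC \<Longrightarrow> \<not> B \<subseteq> span_in C Q"
    and rich: "row_rich C M (2 * k * (k + 1)) DR DC" and k: "p + e \<le> k" "k \<ge> 1"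
  shows False
proof -
  obtain Y where Y: "Y \<subseteq> DC" "card Y \<le> 2 * (p + 1) * e" "distinct_rows M S (C - \<Union>Y) \<le> p + 1"
    using covered_interval_not_rich[of R C PR PC p M e S P DC] assms by metis
  have "(p + 1) * e \<le> (k + 1) * k" using k by (intro mult_mono) auto
  then have "card Y \<le> 2 * k * (k + 1)" using Y(2) by (simp add: algebra_simps)
  then have "2 * k * (k + 1) \<le> p + 1"
    using rich Y assms(7) unfolding row_rich_def by (meson le_trans)
  moreover have "2 * 1 * (k + 1) \<le> 2 * k * (k + 1)" using k by (intro mult_mono) auto
  ultimately have "2 * 1 * (k + 1) \<le> p + 1" by (rule le_trans[rotated])
  then show False using k by simp
qed

lemma span_in_singleton: "span_in U {x} \<subseteq> {x}"
  by (auto simp: span_in_def)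

lemma singleton_not_rich:
  assumes "row_rich C M q DR DC" "S \<in> DR" "S \<subseteq> span_in U {x}" "q \<ge> 2"
  shows False
proof -
  have sub: "S \<subseteq> {x}" using assms(3) span_in_singleton by (rule subset_trans)
  have "q \<le> distinct_rows M S (C - \<Union>{})"
    using assms(1,2) unfolding row_rich_def by (metis card.empty empty_subsetI zero_le)
  also have "\<dots> \<le> card S"
    unfolding distinct_rows_def using sub finite_subset card_image_le by blast
  also have "\<dots> \<le> 1" using card_mono[OF _ sub] by simp
  finally show False using assms(4) by simp
qed

text \<open>
  Consider the first bipartition of a sequence with a part whose span covers an interval of the
  division. The last step created this part, so on the other side nothing is covered yet. In the
  initial bipartition, the covered interval would be a singleton, which is not rich.
\<close>

theorem rich_division_tww:
  fixes R :: "'r::linorder set" and C :: "'c::linorder set" and M :: "'r \<Rightarrow> 'c \<Rightarrow> 'a"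
  assumes fin: "finite R" "R \<noteq> {}" "finite C" "C \<noteq> {}" and k: "k \<ge> 1"
    and rich: "rich_division R C M (2 * k * (k + 1)) D"
  shows "tww R C M > k"
proof (rule ccontr)
  assume "\<not> tww R C M > k"
  then have "tww R C M \<le> k" by simp
  moreover have "\<exists>t p e Ps. t = p + e \<and> pe_sequence R C M p e Ps"
    using pe_sequence_exists[OF fin] by blast
  then have "\<exists>p e Ps. tww R C M = p + e \<and> pe_sequence R C M p e Ps"
    unfolding tww_def by (rule LeastI_ex)
  then obtain p e Ps where t: "tww R C M = p + e" and seq: "pe_sequence R C M p e Ps"
    by blast
  ultimately have pe: "p + e \<le> k" by simp
  have cs: "contraction_sequence R C Ps" using seq by (simp add: pe_sequence_def)
  define cov where "cov = (\<lambda>i. (\<exists>S\<in>fst D. \<exists>P\<in>fst (Ps ! i). S \<subseteq> span_in R P) \<or>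
      (\<exists>S\<in>snd D. \<exists>P\<in>snd (Ps ! i). S \<subseteq> span_in C P))"
  have DR: "interval_partition R (fst D)" and DC: "interval_partition C (snd D)"
    and rR: "row_rich C M (2 * k * (k + 1)) (fst D) (snd D)"
    and rC: "row_rich R (flip M) (2 * k * (k + 1)) (snd D) (fst D)"
    using rich by (auto simp: rich_division_def)
  have len: "Ps \<noteq> []" using cs by (simp add: contraction_sequence_def)
  have "last Ps = ({R}, {C})" using cs by (simp add: contraction_sequence_def)
  then have "Ps ! (length Ps - 1) = ({R}, {C})" using last_conv_nth[OF len] by metis
  moreover obtain S where "S \<in> fst D" "S \<subseteq> R"
    using DR fin(2) by (auto simp: interval_partition_def partition_on_def)
  moreover have "R \<subseteq> span_in R R" using fin(1) by (auto simp: span_in_def)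
  ultimately have last: "cov (length Ps - 1)" unfolding cov_def by auto
  define i where "i = (LEAST i. cov i)"
  have cov_i: "cov i" unfolding i_def using last by (rule LeastI)
  have "i \<le> length Ps - 1" unfolding i_def using last by (rule Least_le)
  then have i: "i < length Ps" using len by (cases Ps) auto
  have before: "\<not> cov j" if "j < i" for j using that unfolding i_def by (rule not_less_Least)
  have parts: "partition_on R (fst (Ps ! j))" "partition_on C (snd (Ps ! j))" if
    "j < length Ps" for j
    using contraction_sequence_partitions[OF cs that] by auto
  have bounds: "overlapping R p (fst (Ps ! i))" "overlapping C p (snd (Ps ! i))"
    "\<And>P. P \<in> fst (Ps ! i) \<Longrightarrow> error_value M (snd (Ps ! i)) P \<le> e"
    "\<And>Q. Q \<in> snd (Ps ! i) \<Longrightarrow> error_value (flip M) (fst (Ps ! i)) Q \<le> e"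
    using seq nth_mem[OF i] unfolding pe_sequence_def by (auto simp: case_prod_beta)
  have "2 * 1 * (1 + 1) \<le> 2 * k * (k + 1)" using k by (intro mult_mono) auto
  then have q: "2 * k * (k + 1) \<ge> 2" by simp
  show False
  proof (cases i)
    case 0
    then have Pi: "Ps ! i = (singletons R, singletons C)"
      using cs len by (simp add: contraction_sequence_def hd_conv_nth)
    from cov_i consider S x where "S \<in> fst D" "S \<subseteq> span_in R {x}"
      | S x where "S \<in> snd D" "S \<subseteq> span_in C {x}"
      unfolding cov_def Pi by (auto simp: singletons_def)
    then show False
      by cases (rule singleton_not_rich[OF rR _ _ q] singleton_not_rich[OF rC _ _ q],
        assumption+)+
  next
    case (Suc j)
    then have step: "contraction_step (Ps ! j) (Ps ! i)"
      using cs i by (auto simp: contraction_sequence_def)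
    have not_j: "\<not> cov j" using before Suc by simp
    from step consider (row) "snd (Ps ! i) = snd (Ps ! j)" | (col) "fst (Ps ! i) = fst (Ps ! j)"
      unfolding contraction_step_def by blast
    then show False
    proof cases
      case row
      then have out: "\<not> B \<subseteq> span_in C Q" if "B \<in> snd D" "Q \<in> snd (Ps ! i)" for B Q
        using not_j that unfolding cov_def by auto
      then obtain S P where "S \<in> fst D" "P \<in> fst (Ps ! i)" "S \<subseteq> span_in R P"
        using cov_i unfolding cov_def by blast
      then show False
        using covered_interval_contradicts_rich[OF fin(1,3) parts(1)[OF i] parts(2)[OF i]
          bounds(1,3) _ _ _ DC out rR pe k]
        by blast
    next
      case col
      then have out: "\<not> B \<subseteq> span_in R Q" if "B \<in> fst D" "Q \<in> fst (Ps ! i)" for B Q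
        using not_j that unfolding cov_def by auto
      then obtain S P where "S \<in> snd D" "P \<in> snd (Ps ! i)" "S \<subseteq> span_in C P"
        using cov_i unfolding cov_def by blast
      then show False
        using covered_interval_contradicts_rich[OF fin(3,1) parts(2)[OF i] parts(1)[OF i]
          bounds(2,4) _ _ _ DR out rC pe k]
        by blast
    qed
  qed
qed

section \<open>Counting distinct rows\<close>

lemma restrict_eq_iff: "restrict f J = restrict g J \<longleftrightarrow> (\<forall>c\<in>J. f c = g c)"
proof
  assume eq: "restrict f J = restrict g J"
  have "f c = g c" if "c \<in> J" for c using fun_cong[OF eq, of c] that by simp
  then show "\<forall>c\<in>J. f c = g c" by blast
qed (auto intro: restrict_ext)

text \<open>
  All upper bounds on numbers of distinct rows come from this: if the entries in \<open>J\<close> determine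
  those in \<open>K\<close>, then \<open>K\<close> distinguishes at most as many rows as \<open>J\<close>.
\<close>

lemma distinct_rows_determined:
  assumes "finite I"
    and det: "\<And>r s. r \<in> I \<Longrightarrow> s \<in> I \<Longrightarrow> \<forall>c\<in>J. M r c = M s c \<Longrightarrow> \<forall>c\<in>K. M r c = M s c"
  shows "distinct_rows M I K \<le> distinct_rows M I J"
proof -
  define h where "h = (\<lambda>w. restrict (M (SOME r. r \<in> I \<and> restrict (M r) J = w)) K)"
  have "(\<lambda>r. restrict (M r) K) ` I \<subseteq> h ` (\<lambda>r. restrict (M r) J) ` I"
  proof safe
    fix r assume r: "r \<in> I"
    let ?s = "SOME s. s \<in> I \<and> restrict (M s) J = restrict (M r) J"
    have s: "?s \<in> I \<and> restrict (M ?s) J = restrict (M r) J" by (rule someI[of _ r]) (simp add: r)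
    then have "\<forall>c\<in>J. M ?s c = M r c" by (simp add: restrict_eq_iff)
    then have "\<forall>c\<in>K. M ?s c = M r c" using det r s by blast
    then have "h (restrict (M r) J) = restrict (M r) K" unfolding h_def
      by (intro restrict_ext) auto
    then show "restrict (M r) K \<in> h ` (\<lambda>r. restrict (M r) J) ` I" using r by (metis image_eqI)
  qed
  then show ?thesis unfolding distinct_rows_def using assms(1) by (intro surj_card_le) auto
qed

lemma distinct_rows_mono:
  assumes "finite I'" "I \<subseteq> I'" "J \<subseteq> J'"
  shows "distinct_rows M I J \<le> distinct_rows M I' J'"
proof -
  have "distinct_rows M I J \<le> distinct_rows M I J'"
    using assms finite_subset by (intro distinct_rows_determined) blast+
  also have "\<dots> \<le> distinct_rows M I' J'"
    unfolding distinct_rows_def using assms by (intro card_mono) auto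
  finally show ?thesis .
qed

lemma distinct_rows_Un:
  assumes "finite I"
  shows "distinct_rows M I (J \<union> K) \<le> distinct_rows M I J * distinct_rows M I K"
proof -
  let ?v = "\<lambda>J r. restrict (M r) J"
  let ?h = "\<lambda>w. (restrict w J, restrict w K)"
  have "inj_on ?h (?v (J \<union> K) ` I)"
  proof (intro inj_onI, clarify)
    fix r s
    assume "restrict (?v (J \<union> K) r) J = restrict (?v (J \<union> K) s) J"
      "restrict (?v (J \<union> K) r) K = restrict (?v (J \<union> K) s) K"
    then have "M r c = M s c" if "c \<in> J \<union> K" for c
      using that by (auto simp: restrict_eq_iff)
    then show "?v (J \<union> K) r = ?v (J \<union> K) s" by (intro restrict_ext)
  qed
  then have "card (?v (J \<union> K) ` I) = card (?h ` ?v (J \<union> K) ` I)" by (simp add: card_image)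
  also have "?h ` ?v (J \<union> K) ` I \<subseteq> ?v J ` I \<times> ?v K ` I"
    by (auto simp: Int_absorb1 Int_absorb2 Int_commute)
  then have "card (?h ` ?v (J \<union> K) ` I) \<le> card (?v J ` I \<times> ?v K ` I)"
    using assms by (intro card_mono) auto
  finally show ?thesis by (simp add: distinct_rows_def card_cartesian_product)
qed

lemma distinct_rows_Union:
  assumes "finite I" "finite G" "\<And>T. T \<in> G \<Longrightarrow> distinct_rows M I T \<le> b"
  shows "distinct_rows M I (\<Union>G) \<le> b ^ card G"
  using assms(2,3)
proof (induction G rule: finite_induct)
  case empty
  have "(\<lambda>r. restrict (M r) {}) ` I \<subseteq> {\<lambda>_. undefined}" by auto
  then have "card ((\<lambda>r. restrict (M r) {}) ` I) \<le> card {\<lambda>_ :: 'b. undefined :: 'c}"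
    by (intro card_mono) auto
  then show ?case by (simp add: distinct_rows_def)
next
  case (insert T G)
  have "distinct_rows M I (T \<union> \<Union>G) \<le> distinct_rows M I T * distinct_rows M I (\<Union>G)"
    by (rule distinct_rows_Un[OF assms(1)])
  also have "\<dots> \<le> b * b ^ card G" using insert by (intro mult_mono) auto
  finally show ?case using insert by simp
qed

text \<open>A row is determined by its entries in one column of each kind.\<close>

lemma distinct_rows_transpose:
  fixes M :: "'r \<Rightarrow> 'c \<Rightarrow> nat"
  assumes "finite S" "finite T" "\<And>r c. r \<in> S \<Longrightarrow> c \<in> T \<Longrightarrow> M r c < a" "a \<ge> 1"
    and q: "distinct_rows (flip M) T S \<le> q"
  shows "distinct_rows M S T \<le> a ^ q"
proof -
  let ?v = "\<lambda>c. restrict (flip M c) S"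
  obtain K where K: "K \<subseteq> T" "inj_on ?v K" "?v ` T = ?v ` K"
    using subset_image_inj[of "?v ` T" ?v T] by auto
  have fK: "finite K" using K(1) assms(2) finite_subset by blast
  have cK: "card K \<le> q"
    using q card_image[OF K(2)] K(3) by (simp add: distinct_rows_def)
  have "distinct_rows M S T \<le> distinct_rows M S K"
  proof (rule distinct_rows_determined[OF assms(1)], rule ballI)
    fix r s c assume rs: "r \<in> S" "s \<in> S" "\<forall>c\<in>K. M r c = M s c" and c: "c \<in> T"
    then obtain d where d: "d \<in> K" "?v c = ?v d" using K(3) by blast
    then have "M x c = M x d" if "x \<in> S" for x
      using that by (simp add: restrict_eq_iff flip_def)
    then show "M r c = M s c" using rs d by simp
  qed
  also have "\<dots> \<le> card (K \<rightarrow>\<^sub>E {..<a})"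
    unfolding distinct_rows_def using assms(3) K(1) fK
    by (intro card_mono finite_PiE) (auto simp: PiE_iff subset_iff)
  also have "\<dots> = a ^ card K" using fK by (simp add: card_PiE)
  also have "\<dots> \<le> a ^ q" using cK assms(4) by (intro power_increasing) auto
  finally show ?thesis .
qed


section \<open>Twins in a division\<close>

definition agree :: "('r \<Rightarrow> 'c \<Rightarrow> 'a) \<Rightarrow> 'r \<Rightarrow> 'r \<Rightarrow> 'c set \<Rightarrow> bool" where
  "agree M r s T \<longleftrightarrow> (\<forall>c\<in>T. M r c = M s c)"

text \<open>
  In the following, \<open>D\<close> and \<open>E\<close> are the families of row and column intervals of a division, \<open>S \<in>
  D\<close> and \<open>T \<in> E\<close>. None of the notions mentions a choice of deleted intervals, and this is what
  makes them monotone when the division becomes coarser.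
\<close>

definition close :: "('r \<Rightarrow> 'c \<Rightarrow> 'a) \<Rightarrow> nat \<Rightarrow> 'c set set \<Rightarrow> 'r \<Rightarrow> 'r \<Rightarrow> bool" where
  "close M q E r s \<longleftrightarrow> card {T \<in> E. \<not> agree M r s T} \<le> q"

text \<open>
  A single interval counts as volatile. When only one row interval and one column interval are
  left, they are therefore entangled and all rows are twins, so the sequence can run to its end.
\<close>

definition volatile :: "('r \<Rightarrow> 'c \<Rightarrow> 'a) \<Rightarrow> nat \<Rightarrow> 'c set set \<Rightarrow> 'r set \<Rightarrow> 'c set set" where
  "volatile M q E S =
     {T \<in> E. card E = 1 \<or> (\<exists>r\<in>S. \<exists>s\<in>S. close M q E r s \<and> \<not> agree M r s T)}"

definition entangled ::
  "('r \<Rightarrow> 'c \<Rightarrow> 'a) \<Rightarrow> nat \<Rightarrow> 'r set set \<Rightarrow> 'c set set \<Rightarrow> 'r set \<Rightarrow> 'c set \<Rightarrow> bool" where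
  "entangled M q D E S T \<longleftrightarrow> T \<in> volatile M q E S \<and> S \<in> volatile (flip M) q D T"

definition twins ::
  "('r \<Rightarrow> 'c \<Rightarrow> 'a) \<Rightarrow> nat \<Rightarrow> 'r set set \<Rightarrow> 'c set set \<Rightarrow> 'r \<Rightarrow> 'r \<Rightarrow> bool" where
  "twins M q D E r s \<longleftrightarrow>
     (\<exists>S\<in>D. r \<in> S \<and> s \<in> S \<and> (\<forall>T\<in>E. \<not> entangled M q D E S T \<longrightarrow> agree M r s T))"

definition tame :: "('r \<Rightarrow> 'c \<Rightarrow> 'a) \<Rightarrow> nat \<Rightarrow> 'c set set \<Rightarrow> 'r set \<Rightarrow> bool" where
  "tame M q E S \<longleftrightarrow> (\<exists>Y\<subseteq>E. card Y \<le> q \<and> distinct_rows M S (\<Union>(E - Y)) < q)"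

lemma flip_flip [simp]: "flip (flip M) = M"
  by (simp add: flip_def fun_eq_iff)

lemma entangled_flip: "entangled (flip M) q E D T S \<longleftrightarrow> entangled M q D E S T"
  by (auto simp: entangled_def)

lemma agree_sym: "agree M r s T \<longleftrightarrow> agree M s r T"
  by (auto simp: agree_def)

lemma twins_sym: "twins M q D E r s \<Longrightarrow> twins M q D E s r"
  by (auto simp: twins_def agree_sym)

lemma twins_trans:
  assumes "disjoint D" "twins M q D E r s" "twins M q D E s t"
  shows "twins M q D E r t"
proof -
  obtain S where S: "S \<in> D" "r \<in> S" "s \<in> S" "\<forall>T\<in>E. \<not> entangled M q D E S T \<longrightarrow> agree M r s T"
    using assms(2) by (auto simp: twins_def)
  obtain S' where S': "S' \<in> D" "s \<in> S'" "t \<in> S'"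
      "\<forall>T\<in>E. \<not> entangled M q D E S' T \<longrightarrow> agree M s t T"
    using assms(3) by (auto simp: twins_def)
  have "S = S'" using S S' assms(1) by (metis disjointD IntI empty_iff)
  then show ?thesis using S S' unfolding twins_def agree_def by (metis (no_types))
qed

subsection \<open>Coarsening the division\<close>

text \<open>
  The function \<open>f\<close> maps an interval of the finer division to the interval of the coarser one that
  contains it.
\<close>

lemma refines_map:
  assumes "refines U E E'"
  obtains f where "\<forall>T\<in>E. f T \<in> E' \<and> T \<subseteq> f T"
    "\<forall>T\<in>E. \<forall>T'\<in>E'. \<forall>c. c \<in> T \<longrightarrow> c \<in> T' \<longrightarrow> f T = T'"
    "E' = f ` E"
proof -
  have E: "partition_on U E" "partition_on U E'" "\<forall>T\<in>E. \<exists>T'\<in>E'. T \<subseteq> T'"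
    using assms by (auto simp: refines_def)
  obtain f where f: "\<forall>T\<in>E. f T \<in> E' \<and> T \<subseteq> f T" using bchoice[OF E(3)[unfolded Bex_def]] by blast
  have u: "f T = T'" if "T \<in> E" "T' \<in> E'" "c \<in> T" "c \<in> T'" for T T' c
  proof -
    have "c \<in> f T" "f T \<in> E'" using f that by auto
    then show ?thesis using that partition_onD2[OF E(2)] by (metis disjointD IntI empty_iff)
  qed
  have "T' \<in> f ` E" if T': "T' \<in> E'" for T'
  proof -
    obtain c where c: "c \<in> T'" using T' E(2) by (metis all_not_in_conv partition_onD3)
    then obtain T where "T \<in> E" "c \<in> T" using T' E(1,2) by (metis Union_iff partition_onD1)
    then show ?thesis using u T' c by blast
  qed
  then have "E' = f ` E" using f by auto
  then show ?thesis using that[of f] f u by metis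
qed

lemma refines_cover:
  assumes "refines U E E'" "c \<in> T'" "T' \<in> E'"
  obtains T where "T \<in> E" "c \<in> T" "T \<subseteq> T'"
proof -
  obtain f where f: "\<forall>T\<in>E. f T \<in> E' \<and> T \<subseteq> f T"
    "\<forall>T\<in>E. \<forall>T'\<in>E'. \<forall>c. c \<in> T \<longrightarrow> c \<in> T' \<longrightarrow> f T = T'"
    "E' = f ` E"
    by (rule refines_map[OF assms(1)])
  have "\<Union>E = U" "\<Union>E' = U" using assms(1) by (auto simp: refines_def partition_on_def)
  then obtain T where T: "T \<in> E" "c \<in> T" using assms(2,3) by blast
  then have "f T = T'" using f(2) assms(2,3) by blast
  then show ?thesis using f(1) T that by blast
qed

text \<open>
  Every coarse interval on which two rows differ contains a fine interval on which they differ.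
\<close>

lemma close_mono:
  assumes "refines U E E'" "finite E" "close M q E r s"
  shows "close M q E' r s"
proof -
  obtain f where f: "\<forall>T\<in>E. f T \<in> E' \<and> T \<subseteq> f T"
    "\<forall>T\<in>E. \<forall>T'\<in>E'. \<forall>c. c \<in> T \<longrightarrow> c \<in> T' \<longrightarrow> f T = T'"
    "E' = f ` E"
    by (rule refines_map[OF assms(1)])
  have "{T' \<in> E'. \<not> agree M r s T'} \<subseteq> f ` {T \<in> E. \<not> agree M r s T}"
  proof clarify
    fix T' assume T': "T' \<in> E'" "\<not> agree M r s T'"
    then obtain c where c: "c \<in> T'" "M r c \<noteq> M s c" by (auto simp: agree_def)
    obtain T where "T \<in> E" "c \<in> T" using refines_cover[OF assms(1) c(1) T'(1)] by blast
    moreover from this have "f T = T'" using f T'(1) c(1) by blast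
    ultimately show "T' \<in> f ` {T \<in> E. \<not> agree M r s T}" using c(2) by (auto simp: agree_def)
  qed
  then have "card {T' \<in> E'. \<not> agree M r s T'} \<le> card {T \<in> E. \<not> agree M r s T}"
    using assms(2) by (intro surj_card_le) auto
  then show ?thesis using assms(3) by (simp add: close_def)
qed

lemma volatile_mono:
  assumes "refines U E E'" "finite E" "T \<in> volatile M q E S"
    and "T \<subseteq> T'" "T' \<in> E'" "S \<subseteq> S'"
  shows "T' \<in> volatile M q E' S'"
proof (cases "card E = 1")
  case True
  obtain f where f: "\<forall>T\<in>E. f T \<in> E' \<and> T \<subseteq> f T"
    "\<forall>T\<in>E. \<forall>T'\<in>E'. \<forall>c. c \<in> T \<longrightarrow> c \<in> T' \<longrightarrow> f T = T'"
    "E' = f ` E"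
    by (rule refines_map[OF assms(1)])
  obtain X where "E = {X}" using True card_1_singletonE by blast
  then have "card E' = 1" using f(3) by simp
  then show ?thesis using assms(5) by (simp add: volatile_def)
next
  case False
  then obtain r s where rs: "r \<in> S" "s \<in> S" "close M q E r s" "\<not> agree M r s T"
    using assms(3) by (auto simp: volatile_def)
  have "close M q E' r s" by (rule close_mono[OF assms(1,2) rs(3)])
  moreover have "\<not> agree M r s T'" using rs(4) assms(4) by (auto simp: agree_def)
  moreover have "r \<in> S'" "s \<in> S'" using rs(1,2) assms(6) by auto
  ultimately show ?thesis using assms(5) unfolding volatile_def by blast
qed

text \<open>
  The intervals entangled with \<open>S\<close> become more, so twins have to agree on fewer columns.
\<close>

lemma twins_mono:
  assumes D: "refines R D D'" "finite D" and E: "refines C E E'" "finite E"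
    and "twins M q D E r s"
  shows "twins M q D' E' r s"
proof -
  obtain S where S: "S \<in> D" "r \<in> S" "s \<in> S"
      and ag: "\<And>T. T \<in> E \<Longrightarrow> \<not> entangled M q D E S T \<Longrightarrow> agree M r s T"
    using assms(5) by (auto simp: twins_def)
  obtain S' where S': "S' \<in> D'" "S \<subseteq> S'" using D(1) S(1) by (auto simp: refines_def)
  have "agree M r s T'" if T': "T' \<in> E'" "\<not> entangled M q D' E' S' T'" for T'
    unfolding agree_def
  proof
    fix c assume "c \<in> T'"
    then obtain T where T: "T \<in> E" "c \<in> T" "T \<subseteq> T'" using refines_cover[OF E(1) _ T'(1)] by blast
    have "\<not> entangled M q D E S T"
    proof
      assume "entangled M q D E S T"
      then have "entangled M q D' E' S' T'"
        unfolding entangled_def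
        using volatile_mono[OF E _ T(3) T'(1) S'(2)] volatile_mono[OF D _ S'(2,1) T(3)] by blast
      then show False using T'(2) by blast
    qed
    then show "M r c = M s c" using ag T(1,2) by (auto simp: agree_def)
  qed
  then show ?thesis using S S' unfolding twins_def by blast
qed

lemma tame_mono:
  assumes "refines U E E'" "finite E" "finite S" "tame M q E S"
  shows "tame M q E' S"
proof -
  obtain f where f: "\<forall>T\<in>E. f T \<in> E' \<and> T \<subseteq> f T"
    "\<forall>T\<in>E. \<forall>T'\<in>E'. \<forall>c. c \<in> T \<longrightarrow> c \<in> T' \<longrightarrow> f T = T'"
    "E' = f ` E"
    by (rule refines_map[OF assms(1)])
  obtain Y where Y: "Y \<subseteq> E" "card Y \<le> q" "distinct_rows M S (\<Union>(E - Y)) < q"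
    using assms(4) by (auto simp: tame_def)
  have "\<Union>(E' - f ` Y) \<subseteq> \<Union>(E - Y)"
  proof
    fix c assume "c \<in> \<Union>(E' - f ` Y)"
    then obtain T' where T': "T' \<in> E'" "T' \<notin> f ` Y" "c \<in> T'" by blast
    obtain T where T: "T \<in> E" "c \<in> T" using refines_cover[OF assms(1) T'(3,1)] by blast
    then have "f T = T'" using f(2) T' by blast
    then show "c \<in> \<Union>(E - Y)" using T T' by blast
  qed
  then have "distinct_rows M S (\<Union>(E' - f ` Y)) < q"
    using Y(3) distinct_rows_mono[OF assms(3) subset_refl] by (meson le_less_trans)
  moreover have "card (f ` Y) \<le> q"
    using Y assms(2) by (meson card_image_le finite_subset le_trans)
  moreover have "f ` Y \<subseteq> E'" using f(1) Y(1) by blast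
  ultimately show ?thesis unfolding tame_def by blast
qed

subsection \<open>Bounds for tame parts\<close>

text \<open>
  Rows that are equal outside of at most \<open>q\<close> intervals are close, so they can only differ on
  volatile ones.
\<close>

lemma agree_outside_volatile:
  assumes "finite E" "Y \<subseteq> E" "card Y \<le> q" "r \<in> S" "s \<in> S"
    and eq: "\<forall>c\<in>\<Union>(E - Y). M r c = M s c" and T: "T \<in> E" "T \<notin> volatile M q E S"
  shows "agree M r s T"
proof -
  have "{T \<in> E. \<not> agree M r s T} \<subseteq> Y" using eq by (auto simp: agree_def)
  then have "card {T \<in> E. \<not> agree M r s T} \<le> card Y"
    using assms(1,2) finite_subset by (intro card_mono) blast+
  then have "close M q E r s" using assms(3) by (simp add: close_def)
  then show ?thesis using T assms(4,5) by (auto simp: volatile_def)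
qed

text \<open>
  Let \<open>Y\<close> witness that \<open>S\<close> is tame. On an interval outside of \<open>Y\<close>, whether two rows differ
  depends only on their entries outside of \<open>Y\<close>. There are fewer than \<open>q\<^sup>2\<close> pairs of such vectors,
  and a pair that belongs to close rows differs on at most \<open>q\<close> intervals. The summand 1 is for
  the case of a single interval.
\<close>

lemma card_volatile:
  fixes M :: "'r \<Rightarrow> 'c \<Rightarrow> 'a"
  assumes "finite E" "finite S" "tame M q E S"
  shows "card (volatile M q E S) \<le> q ^ 3 + q + 1"
proof (cases "card E = 1")
  case True
  have "card (volatile M q E S) \<le> card E"
    using assms(1) by (intro card_mono) (auto simp: volatile_def)
  then show ?thesis using True by simp
next
  case False
  obtain Y where Y: "Y \<subseteq> E" "card Y \<le> q" "distinct_rows M S (\<Union>(E - Y)) < q"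
    using assms(3) by (auto simp: tame_def)
  have fY: "finite Y" using Y(1) assms(1) finite_subset by blast
  define v where "v = (\<lambda>r. restrict (M r) (\<Union>(E - Y)))"
  define V where "V = v ` S"
  define W where "W = (\<lambda>(u :: 'c \<Rightarrow> 'a, w). {T \<in> E - Y. \<exists>c\<in>T. u c \<noteq> w c})"
  define F where "F = {p \<in> V \<times> V. card (W p) \<le> q}"
  have fF: "finite F" and cF: "card F \<le> q * q"
  proof -
    have fV: "finite V" using assms(2) by (simp add: V_def)
    then show "finite F" by (simp add: F_def)
    have "card F \<le> card (V \<times> V)" using fV by (intro card_mono) (auto simp: F_def)
    also have "\<dots> \<le> q * q"
      using Y(3) by (simp add: V_def v_def card_cartesian_product distinct_rows_def mult_le_mono)
    finally show "card F \<le> q * q" .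
  qed
  have "volatile M q E S \<subseteq> Y \<union> (\<Union>p\<in>F. W p)"
  proof
    fix T assume T: "T \<in> volatile M q E S"
    then obtain r s where rs: "r \<in> S" "s \<in> S" "close M q E r s" "\<not> agree M r s T"
      using False by (auto simp: volatile_def)
    have v: "v x c = M x c" if "U \<in> E - Y" "c \<in> U" for x U c using that by (auto simp: v_def)
    have "W (v r, v s) \<subseteq> {T \<in> E. \<not> agree M r s T}" using v by (auto simp: W_def agree_def)
    then have "card (W (v r, v s)) \<le> card {T \<in> E. \<not> agree M r s T}"
      using assms(1) by (intro card_mono) auto
    then have "(v r, v s) \<in> F" using rs by (simp add: F_def V_def close_def)
    moreover have "T \<in> W (v r, v s)" if "T \<notin> Y"
      using that T rs(4) v[of T] by (auto simp: W_def agree_def volatile_def)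
    ultimately show "T \<in> Y \<union> (\<Union>p\<in>F. W p)" by blast
  qed
  moreover have "finite (\<Union>p\<in>F. W p)" using fF assms(1) by (auto simp: W_def)
  ultimately have "card (volatile M q E S) \<le> card (Y \<union> (\<Union>p\<in>F. W p))"
    using fY by (intro card_mono) auto
  also have "\<dots> \<le> card Y + card (\<Union>p\<in>F. W p)" by (rule card_Un_le)
  also have "card (\<Union>p\<in>F. W p) \<le> (\<Sum>p\<in>F. card (W p))" by (rule card_UN_le[OF fF])
  also have "\<dots> \<le> (\<Sum>p\<in>F. q)" by (intro sum_mono) (simp add: F_def)
  also have "\<dots> \<le> q * q * q" using mult_le_mono1[OF cF, of q] by simp
  finally show ?thesis using Y(2) by (simp add: power3_eq_cube)
qed

text \<open>
  Let \<open>Y\<close> witness that \<open>S\<close> is tame. Rows of \<open>S\<close> that are equal outside of \<open>Y\<close> are close, hence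
  equal on every part that is not volatile. On a volatile part \<open>T\<close> that is not entangled with
  \<open>S\<close>, the same argument for the columns of \<open>T\<close> shows that fewer than \<open>q\<close> different columns
  occur. At most \<open>q\<close> such parts are in \<open>Y\<close>.
\<close>

lemma few_twin_classes:
  fixes M :: "'r \<Rightarrow> 'c \<Rightarrow> nat"
  assumes fin: "finite D" "finite E" "\<And>S. S \<in> D \<Longrightarrow> finite S" "\<And>T. T \<in> E \<Longrightarrow> finite T"
    and S: "S \<in> D" "tame M q E S" and cols: "\<And>T. T \<in> E \<Longrightarrow> tame (flip M) q D T"
    and a: "\<And>r c. r \<in> S \<Longrightarrow> c \<in> \<Union>E \<Longrightarrow> M r c < a" "a \<ge> 1"
  shows "distinct_rows M S (\<Union>{T \<in> E. \<not> entangled M q D E S T}) \<le> q * (a ^ q) ^ q"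
proof -
  have fS: "finite S" using fin S by blast
  obtain Y where Y: "Y \<subseteq> E" "card Y \<le> q" "distinct_rows M S (\<Union>(E - Y)) < q"
    using S(2) by (auto simp: tame_def)
  have fY: "finite Y" using Y(1) fin(2) finite_subset by blast
  (* J distinguishes no more rows than the columns outside of Y. The intervals in G are the
     remaining ones that may not be entangled with S. *)
  define J where "J = \<Union>(E - Y) \<union> \<Union>(E - volatile M q E S)"
  define G where "G = {T \<in> Y. S \<notin> volatile (flip M) q D T}"
  have "distinct_rows M S J \<le> distinct_rows M S (\<Union>(E - Y))"
  proof (rule distinct_rows_determined[OF fS], rule ballI)
    fix r s c assume rs: "r \<in> S" "s \<in> S" and eq: "\<forall>c\<in>\<Union>(E - Y). M r c = M s c" and c: "c \<in> J"
    show "M r c = M s c"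
    proof (cases "c \<in> \<Union>(E - Y)")
      case False
      then obtain T where T: "T \<in> E" "T \<notin> volatile M q E S" "c \<in> T" using c by (auto simp: J_def)
      then show ?thesis
        using agree_outside_volatile[OF fin(2) Y(1,2) rs eq T(1,2)] by (auto simp: agree_def)
    qed (use eq in blast)
  qed
  then have J: "distinct_rows M S J \<le> q" using Y(3) by simp
  have "distinct_rows M S T \<le> a ^ q" if T: "T \<in> G" for T
  proof -
    have TE: "T \<in> E" "S \<notin> volatile (flip M) q D T" using T Y(1) by (auto simp: G_def)
    obtain X where X: "X \<subseteq> D" "card X \<le> q" "distinct_rows (flip M) T (\<Union>(D - X)) < q"
      using cols[OF TE(1)] by (auto simp: tame_def)
    have "distinct_rows (flip M) T S \<le> distinct_rows (flip M) T (\<Union>(D - X))"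
    proof (rule distinct_rows_determined[OF fin(4)[OF TE(1)]])
      fix c d assume "c \<in> T" "d \<in> T" "\<forall>r\<in>\<Union>(D - X). flip M c r = flip M d r"
      then have "agree (flip M) c d S"
        using agree_outside_volatile[OF fin(1) X(1,2) _ _ _ S(1) TE(2)] by blast
      then show "\<forall>r\<in>S. flip M c r = flip M d r" by (auto simp: agree_def)
    qed
    then have "distinct_rows (flip M) T S \<le> q" using X(3) by simp
    then show ?thesis
      using distinct_rows_transpose[OF fS fin(4)[OF TE(1)] _ a(2)] a(1) TE(1) by blast
  qed
  then have "distinct_rows M S (\<Union>G) \<le> (a ^ q) ^ card G"
    using fY by (intro distinct_rows_Union[OF fS]) (auto simp: G_def)
  also have "card G \<le> q" using Y(2) card_mono[OF fY, of G] by (auto simp: G_def)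
  then have "(a ^ q) ^ card G \<le> (a ^ q) ^ q" using a(2) by (intro power_increasing) auto
  finally have G: "distinct_rows M S (\<Union>G) \<le> (a ^ q) ^ q" .
  have "{T \<in> E. \<not> entangled M q D E S T} \<subseteq> (E - Y) \<union> (E - volatile M q E S) \<union> G"
    using Y(1) by (auto simp: entangled_def G_def)
  then have "\<Union>{T \<in> E. \<not> entangled M q D E S T} \<subseteq> J \<union> \<Union>G" unfolding J_def by blast
  then have "distinct_rows M S (\<Union>{T \<in> E. \<not> entangled M q D E S T}) \<le> distinct_rows M S (J \<union> \<Union>G)"
    by (intro distinct_rows_mono[OF fS]) auto
  also have "\<dots> \<le> distinct_rows M S J * distinct_rows M S (\<Union>G)" by (rule distinct_rows_Un[OF fS])
  also have "\<dots> \<le> q * (a ^ q) ^ q" using J G by (intro mult_mono) auto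
  finally show ?thesis .
qed

subsection \<open>Overlap and error of partitions into twins\<close>

lemma span_in_interval:
  assumes "interval_partition U D" "S \<in> D" "P \<subseteq> S" "finite P" "P \<noteq> {}"
  shows "span_in U P \<subseteq> S"
proof
  fix x assume "x \<in> span_in U P"
  then have "x \<in> U" "Min P \<le> x" "x \<le> Max P" by (auto simp: span_in_def)
  moreover have "Min P \<in> S" "Max P \<in> S" using assms(3-5) Min_in Max_in by blast+
  ultimately show "x \<in> S" using interval_partition_part[OF assms(1,2)] by blast
qed

definition twin_parts ::
  "('r \<Rightarrow> 'c \<Rightarrow> 'a) \<Rightarrow> nat \<Rightarrow> 'r set set \<Rightarrow> 'c set set \<Rightarrow> 'r set set \<Rightarrow> bool" where
  "twin_parts M q D E PR \<longleftrightarrow> (\<forall>P\<in>PR. \<forall>r\<in>P. \<forall>s\<in>P. twins M q D E r s)"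

text \<open>
  The relation \<open>twins\<close> allows a different interval for every pair of rows; as intervals are
  disjoint, one interval serves the whole part.
\<close>

lemma twin_part_in_division:
  assumes "twin_parts M q D E PR" "P \<in> PR" "P \<noteq> {}" "disjoint D"
  obtains S where "S \<in> D" "P \<subseteq> S"
    "\<forall>r\<in>P. \<forall>s\<in>P. \<forall>T\<in>E. \<not> entangled M q D E S T \<longrightarrow> agree M r s T"
proof -
  have tw: "twins M q D E s t" if "s \<in> P" "t \<in> P" for s t
    using assms(1,2) that by (simp add: twin_parts_def)
  obtain r where r: "r \<in> P" using assms(3) by blast
  obtain S where S: "S \<in> D" "r \<in> S" using tw[OF r r] by (auto simp: twins_def)
  have u: "S' = S" if "S' \<in> D" "x \<in> S'" "x \<in> S" for S' x
    using that S(1) disjointD[OF assms(4), of S' S] by blast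
  have "s \<in> S" if "s \<in> P" for s
    using tw[OF r that] u S by (auto simp: twins_def)
  then have sub: "P \<subseteq> S" by blast
  have "agree M s t T" if st: "s \<in> P" "t \<in> P" "T \<in> E" "\<not> entangled M q D E S T" for s t T
  proof -
    obtain S' where "S' \<in> D" "s \<in> S'" "\<forall>T\<in>E. \<not> entangled M q D E S' T \<longrightarrow> agree M s t T"
      using tw[OF st(1,2)] by (auto simp: twins_def)
    then show ?thesis using u[of S' s] sub st by auto
  qed
  then show ?thesis using that[OF S(1) sub] by simp
qed

text \<open>
  Parts that are in conflict lie in the same interval, because the intervals separate the spans.
\<close>

lemma twin_parts_overlapping:
  assumes "finite R" "partition_on R PR" "interval_partition R D" "twin_parts M q D E PR"
    and few: "\<And>S. S \<in> D \<Longrightarrow> card {P \<in> PR. P \<subseteq> S} \<le> b"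
  shows "overlapping R (b - 1) PR"
  unfolding overlapping_def
proof
  fix P assume P: "P \<in> PR"
  have dis: "disjoint D" using assms(3) by (simp add: interval_partition_def partition_on_def)
  have fPR: "finite PR" using partition_on_cards(1) assms(1,2) by blast
  note part = partition_on_cards(2)[OF assms(1,2)]
  have "P \<noteq> {}" using part P by blast
  then obtain S where S: "S \<in> D" "P \<subseteq> S" by (rule twin_part_in_division[OF assms(4) P _ dis])
  have "{T \<in> PR. T \<noteq> P \<and> conflict R P T} \<subseteq> {T \<in> PR. T \<subseteq> S} - {P}"
  proof clarify
    fix T assume T: "T \<in> PR" "conflict R P T" "T \<noteq> P"
    have "T \<noteq> {}" using part T(1) by blast
    then obtain S' where S': "S' \<in> D" "T \<subseteq> S'"
      by (rule twin_part_in_division[OF assms(4) T(1) _ dis])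
    have "span_in R P \<subseteq> S" "span_in R T \<subseteq> S'"
      using span_in_interval[OF assms(3)] S S' part P T(1) by auto
    then have "S \<inter> S' \<noteq> {}" using T(2) unfolding conflict_def by blast
    then have "S = S'" using S S' dis by (metis disjointD)
    then show "T \<in> {T \<in> PR. T \<subseteq> S} - {P}" using T S' by blast
  qed
  then have "card {T \<in> PR. T \<noteq> P \<and> conflict R P T} \<le> card ({T \<in> PR. T \<subseteq> S} - {P})"
    using fPR by (intro card_mono) auto
  also have "\<dots> = card {T \<in> PR. T \<subseteq> S} - 1" using fPR P S by simp
  also have "\<dots> \<le> b - 1" using few[OF S(1)] by simp
  finally show "card {T \<in> PR. T \<noteq> P \<and> conflict R P T} \<le> b - 1" .
qed

text \<open>
  If \<open>S\<close> and \<open>T\<close> are not entangled, then twins in \<open>S\<close> agree on \<open>T\<close> and twins in \<open>T\<close> agree on \<open>S\<close>,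
  so their zone is constant. Only the few volatile intervals contribute to the error value.
\<close>

lemma twin_parts_error:
  assumes "finite R" "finite C" "partition_on R PR" "partition_on C PC"
    and D: "partition_on R D" and E: "partition_on C E"
    and tw: "twin_parts M q D E PR" "twin_parts (flip M) q E D PC"
    and few: "\<And>T. T \<in> E \<Longrightarrow> card {Q \<in> PC. Q \<subseteq> T} \<le> b"
    and tame: "\<And>S. S \<in> D \<Longrightarrow> tame M q E S" and P: "P \<in> PR"
  shows "error_value M PC P \<le> (q ^ 3 + q + 1) * b"
proof -
  have dis: "disjoint D" "disjoint E" using D E by (simp_all add: partition_on_def)
  have fPC: "finite PC" and fE: "finite E" using partition_on_cards(1) assms(2,4) E by blast+
  note part = partition_on_cards(2)[OF assms(1,3)] partition_on_cards(2)[OF assms(2,4)]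
  have "P \<noteq> {}" using part P by blast
  then obtain S where S: "S \<in> D" "P \<subseteq> S"
      and ag: "\<forall>r\<in>P. \<forall>s\<in>P. \<forall>T\<in>E. \<not> entangled M q D E S T \<longrightarrow> agree M r s T"
    by (rule twin_part_in_division[OF tw(1) P _ dis(1)])
  define V where "V = volatile M q E S"
  have fV: "finite V" using fE by (simp add: V_def volatile_def)
  have "{Q \<in> PC. \<not> constant_on_zone M P Q} \<subseteq> (\<Union>T\<in>V. {Q \<in> PC. Q \<subseteq> T})"
  proof clarify
    fix Q assume Q: "Q \<in> PC" "\<not> constant_on_zone M P Q"
    have "Q \<noteq> {}" using part Q(1) by blast
    then obtain T where T: "T \<in> E" "Q \<subseteq> T"
      and ag': "\<forall>c\<in>Q. \<forall>d\<in>Q. \<forall>S\<in>D. \<not> entangled (flip M) q E D T S \<longrightarrow> agree (flip M) c d S"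
      by (rule twin_part_in_division[OF tw(2) Q(1) _ dis(2)])
    have "entangled M q D E S T"
    proof (rule ccontr)
      assume ne: "\<not> entangled M q D E S T"
      obtain r0 c0 where 0: "r0 \<in> P" "c0 \<in> Q" using part P Q(1) by (meson ex_in_conv)
      have "M r c = M r0 c0" if rc: "r \<in> P" "c \<in> Q" for r c
      proof -
        have "agree M r r0 T" using ag rc(1) 0(1) T(1) ne by blast
        then have "M r c = M r0 c" using T(2) rc(2) by (auto simp: agree_def)
        moreover have "agree (flip M) c c0 S"
          using ag' rc(2) 0(2) S(1) ne by (simp only: entangled_flip) blast
        then have "M r0 c = M r0 c0" using S(2) 0(1) by (auto simp: agree_def flip_def)
        ultimately show ?thesis by simp
      qed
      then show False using Q(2) unfolding constant_on_zone_def by blast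
    qed
    then show "Q \<in> (\<Union>T\<in>V. {Q \<in> PC. Q \<subseteq> T})" using T Q(1) by (auto simp: V_def entangled_def)
  qed
  then have "error_value M PC P \<le> card (\<Union>T\<in>V. {Q \<in> PC. Q \<subseteq> T})"
    unfolding error_value_def using fV fPC by (intro card_mono) auto
  also have "\<dots> \<le> (\<Sum>T\<in>V. card {Q \<in> PC. Q \<subseteq> T})" by (rule card_UN_le[OF fV])
  also have "\<dots> \<le> (\<Sum>T\<in>V. b)" using few by (intro sum_mono) (auto simp: V_def volatile_def)
  also have "\<dots> = card V * b" by simp
  also have "\<dots> \<le> (q ^ 3 + q + 1) * b"
    unfolding V_def
    using card_volatile[OF fE _ tame[OF S(1)]] partition_on_cards(2)[OF assms(1) D S(1)]
    by (intro mult_le_mono1) blast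
  finally show ?thesis .
qed

text \<open>
  Deleting only volatile parts suffices: rows that become equal when few parts are deleted are
  close.
\<close>

lemma tame_volatile:
  assumes "finite E" "finite S" "tame M q E S"
  shows "\<exists>Y\<subseteq>volatile M q E S. card Y \<le> q \<and> distinct_rows M S (\<Union>(E - Y)) < q"
proof -
  obtain Y where Y: "Y \<subseteq> E" "card Y \<le> q" "distinct_rows M S (\<Union>(E - Y)) < q"
    using assms(3) by (auto simp: tame_def)
  let ?Y = "Y \<inter> volatile M q E S"
  have "distinct_rows M S (\<Union>(E - ?Y)) \<le> distinct_rows M S (\<Union>(E - Y))"
  proof (rule distinct_rows_determined[OF assms(2)], rule ballI)
    fix r s c assume rs: "r \<in> S" "s \<in> S" and eq: "\<forall>c\<in>\<Union>(E - Y). M r c = M s c"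
      and c: "c \<in> \<Union>(E - ?Y)"
    show "M r c = M s c"
    proof (cases "c \<in> \<Union>(E - Y)")
      case False
      then obtain T where T: "T \<in> E" "T \<notin> volatile M q E S" "c \<in> T" using c by auto
      then show ?thesis
        using agree_outside_volatile[OF assms(1) Y(1,2) rs eq T(1,2)] by (auto simp: agree_def)
    qed (use eq in blast)
  qed
  moreover have "finite Y" using Y(1) assms(1) finite_subset by blast
  then have "card ?Y \<le> q" using Y(2) card_mono[of Y ?Y] by simp
  ultimately show ?thesis using Y(3) by (intro exI[of _ ?Y]) auto
qed

section \<open>The steps of the algorithm\<close>

subsection \<open>Lists of parts\<close>

definition parts_list :: "nat \<Rightarrow> parts \<Rightarrow> bool" where
  "parts_list n Ps \<longleftrightarrow> distinct (concat Ps) \<and> set (concat Ps) = {..<n} \<and> [] \<notin> set Ps"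

text \<open>
  The concatenation says at once that the members are consecutive intervals, listed in increasing
  order; merging neighbours in the list keeps it.
\<close>

definition division_list :: "nat \<Rightarrow> parts \<Rightarrow> bool" where
  "division_list n Ds \<longleftrightarrow> concat Ds = [0..<n] \<and> [] \<notin> set Ds"

lemma division_parts_list: "division_list n Ds \<Longrightarrow> parts_list n Ds"
  by (auto simp: division_list_def parts_list_def simp del: set_concat)

lemma family_simps [simp]:
  "family [] = {}" "family (x # xs) = insert (set x) (family xs)"
  "family (xs @ ys) = family xs \<union> family ys"
  by (auto simp: family_def)

lemma Union_family: "\<Union>(family Ps) = set (concat Ps)"
  by (auto simp: family_def)

lemma finite_family [simp]: "finite (family Ps)" "S \<in> family Ps \<Longrightarrow> finite S"
  by (auto simp: family_def)

lemma in_familyI: "T \<in> set Ps \<Longrightarrow> set T \<in> family Ps"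
  by (simp add: family_def)

lemma distinct_concat_sets:
  assumes "distinct (concat Ps)" "[] \<notin> set Ps"
  shows "distinct (map set Ps) \<and> disjoint (family Ps)"
  using assms
proof (induction Ps)
  case (Cons x Ps)
  have new: "set x \<inter> T = {}" if "T \<in> family Ps" for T
    using that Cons.prems by (auto simp: family_def)
  moreover have "set x \<noteq> {}" using Cons.prems by auto
  ultimately have "set x \<notin> family Ps" by (metis Int_absorb)
  then have "set x \<notin> set (map set Ps)" by (simp add: family_def)
  moreover have IH: "disjoint (family Ps)" "distinct (map set Ps)" using Cons by auto
  moreover have "disjoint (insert (set x) (family Ps))"
    using new IH(1) by (auto simp: pairwise_insert disjnt_def Int_commute)
  ultimately show ?case by simp
qed (simp add: disjoint_def)

lemma parts_list_partition:
  assumes "parts_list n Ps"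
  shows "partition_on {..<n} (family Ps)" "distinct (map set Ps)" "card (family Ps) = length Ps"
proof -
  have d: "distinct (map set Ps)" "disjoint (family Ps)"
    using distinct_concat_sets assms by (auto simp: parts_list_def)
  have "{} \<notin> family Ps" using assms by (auto simp: parts_list_def family_def)
  then show "partition_on {..<n} (family Ps)"
    using d assms by (auto simp: partition_on_def parts_list_def Union_family
      simp del: set_concat)
  show "distinct (map set Ps)" by (rule d)
  then show "card (family Ps) = length Ps"
    unfolding family_def by (metis distinct_card length_map)
qed

lemma parts_list_length:
  assumes "parts_list n Ps"
  shows "length Ps \<le> n"
proof -
  have "[] \<notin> set Ps" using assms by (simp add: parts_list_def)
  then have "length Ps \<le> length (concat Ps)"
  proof (induction Ps)
    case (Cons x Ps)
    then show ?case by (cases x) auto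
  qed simp
  also have "\<dots> = n" using assms distinct_card[of "concat Ps"] by (simp add: parts_list_def)
  finally show ?thesis .
qed

lemma parts_list_elem:
  assumes "parts_list n Ps" "S \<in> set Ps"
  shows "set S \<subseteq> {..<n}" "length S \<le> n" "S \<noteq> []" "distinct S"
proof -
  show sub: "set S \<subseteq> {..<n}" using assms unfolding parts_list_def by fastforce
  show d: "distinct S" using assms by (auto simp: parts_list_def distinct_concat_iff)
  show "length S \<le> n" using card_mono[OF _ sub] distinct_card[OF d] by simp
  show "S \<noteq> []" using assms by (auto simp: parts_list_def)
qed

lemma division_list_interval:
  assumes "division_list n Ds"
  shows "interval_partition {..<n} (family Ds)"
  unfolding interval_partition_def
proof (intro conjI ballI impI)
  show "partition_on {..<n} (family Ds)"
    using parts_list_partition division_parts_list assms by blast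
  fix S x z y assume S: "S \<in> family Ds" "x \<in> S" "z \<in> S" "y \<in> {..<n}" "x \<le> y \<and> y \<le> z"
  then obtain T where T: "T \<in> set Ds" "S = set T" by (auto simp: family_def)
  then obtain us vs where "Ds = us @ T # vs" by (metis split_list)
  then have eq: "concat us @ T @ concat vs = [0..<n]" using assms by (simp add: division_list_def)
  define l where "l = length (concat us)"
  have len: "l + length T \<le> n" using arg_cong[OF eq, of length] by (simp add: l_def)
  have "T = take (length T) (drop l [0..<n])" unfolding eq[symmetric] l_def by simp
  also have "\<dots> = [l..<l + length T]" using len by simp
  finally have "set T = {l..<l + length T}" by (metis set_upt)
  then show "y \<in> S" using S T by auto
qed

text \<open>
  The functions that merge two members of a list return the empty list if there is nothing to
  merge; \<open>consn\<close> puts a skipped member back in front of a successful result only.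
\<close>

definition consn :: "'a \<Rightarrow> 'a list \<Rightarrow> 'a list" where
  "consn x ys = (if ys = [] then [] else x # ys)"

lemma consn_simps [simp]: "consn x ys = [] \<longleftrightarrow> ys = []" "ys \<noteq> [] \<Longrightarrow> consn x ys = x # ys"
  by (simp_all add: consn_def)

subsection \<open>Deciding tameness\<close>

text \<open>
  The list \<open>T # Ts\<close> holds the intervals that are still undecided, \<open>Z\<close> those that are kept, and
  \<open>b\<close> bounds the number of those that may still be deleted.
\<close>

fun search :: "(nat \<Rightarrow> nat \<Rightarrow> nat) \<Rightarrow> nat \<Rightarrow> nat list \<Rightarrow> parts \<Rightarrow> parts \<Rightarrow> nat \<Rightarrow> bool" where
  "search M q S [] Z b \<longleftrightarrow> distinct_rows M (set S) (\<Union>(family Z)) < q"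
| "search M q S (T # Ts) Z b \<longleftrightarrow>
     search M q S Ts (T # Z) b \<or> b > 0 \<and> search M q S Ts Z (b - 1)"

lemma search_iff:
  assumes "distinct (map set Ts)"
  shows "search M q S Ts Z b \<longleftrightarrow>
    (\<exists>Y\<subseteq>family Ts. card Y \<le> b \<and> distinct_rows M (set S) (\<Union>(family Z \<union> (family Ts - Y))) < q)"
  using assms
proof (induction Ts arbitrary: Z b)
  case Nil
  then show ?case by auto
next
  case (Cons T Ts)
  have T: "set T \<notin> family Ts" using Cons.prems by (auto simp: family_def)
  let ?ok = "\<lambda>Z. distinct_rows M (set S) (\<Union>Z) < q"
  have keep: "search M q S Ts (T # Z) b \<longleftrightarrow>
      (\<exists>Y\<subseteq>family Ts. card Y \<le> b \<and> ?ok (family Z \<union> (family (T # Ts) - Y)))"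
  proof -
    have "family (T # Z) \<union> (family Ts - Y) = family Z \<union> (family (T # Ts) - Y)"
      if "Y \<subseteq> family Ts" for Y using that T by auto
    then show ?thesis using Cons by (metis (no_types, lifting) distinct.simps(2) list.simps(9))
  qed
  have drop: "b > 0 \<and> search M q S Ts Z (b - 1) \<longleftrightarrow>
      (\<exists>Y\<subseteq>family Ts. card (insert (set T) Y) \<le> b \<and>
         ?ok (family Z \<union> (family (T # Ts) - insert (set T) Y)))"
  proof -
    have "family Ts - Y = family (T # Ts) - insert (set T) Y" if "Y \<subseteq> family Ts" for Y
      using that T by auto
    moreover have "b > 0 \<and> card Y \<le> b - 1 \<longleftrightarrow> card (insert (set T) Y) \<le> b" if "Y \<subseteq> family Ts" for Y
    proof -
      have "finite Y" using that finite_family(1) by (rule finite_subset)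
      moreover have "set T \<notin> Y" using that T by blast
      ultimately show ?thesis by auto
    qed
    moreover have "search M q S Ts Z (b - 1) \<longleftrightarrow>
      (\<exists>Y\<subseteq>family Ts. card Y \<le> b - 1 \<and> ?ok (family Z \<union> (family Ts - Y)))"
      using Cons by simp
    ultimately show ?thesis by (metis (no_types, lifting))
  qed
  have sub: "Y \<subseteq> family (T # Ts) \<longleftrightarrow> Y \<subseteq> family Ts \<or> (\<exists>Y'\<subseteq>family Ts. Y = insert (set T) Y')" for Y
  proof (cases "set T \<in> Y")
    case True
    then have "Y = insert (set T) (Y - {set T})" by blast
    then show ?thesis by (auto simp: subset_insert_iff)
  next
    case False
    then show ?thesis by auto
  qed
  show ?case unfolding search.simps keep drop sub by blast
qed

definition volatile_filter ::
  "bool \<Rightarrow> (nat \<Rightarrow> nat \<Rightarrow> nat) \<Rightarrow> nat \<Rightarrow> parts \<Rightarrow> nat list \<Rightarrow> parts" where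
  "volatile_filter b M q Es S = filter (\<lambda>T. (set T \<in> volatile M q (family Es) (set S)) = b) Es"

text \<open>
  The length test keeps the exponential search independent of the size of the matrix. It does not
  reject tame sets, by \<open>card_volatile\<close>.
\<close>

definition tame_test :: "(nat \<Rightarrow> nat \<Rightarrow> nat) \<Rightarrow> nat \<Rightarrow> parts \<Rightarrow> nat list \<Rightarrow> bool" where
  "tame_test M q Es S \<longleftrightarrow> length (volatile_filter True M q Es S) \<le> (q + 1) ^ 3 \<and>
     search M q S (volatile_filter True M q Es S) (volatile_filter False M q Es S) q"

lemma family_volatile_filter:
  "family (volatile_filter True M q Es S) = volatile M q (family Es) (set S)"
  "family (volatile_filter False M q Es S) = family Es - volatile M q (family Es) (set S)"
  by (auto simp: volatile_filter_def family_def volatile_def)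

lemma distinct_volatile_filter:
  "distinct (map set Es) \<Longrightarrow> distinct (map set (volatile_filter b M q Es S))"
  unfolding volatile_filter_def by (simp add: distinct_map_filter)

lemma tame_test_iff:
  assumes "distinct (map set Es)"
  shows "tame_test M q Es S \<longleftrightarrow> tame M q (family Es) (set S)"
proof -
  let ?V = "volatile M q (family Es) (set S)"
  have V: "?V \<subseteq> family Es" by (auto simp: volatile_def)
  have "search M q S (volatile_filter True M q Es S) (volatile_filter False M q Es S) q \<longleftrightarrow>
      (\<exists>Y\<subseteq>?V. card Y \<le> q \<and> distinct_rows M (set S) (\<Union>(family Es - ?V \<union> (?V - Y))) < q)"
    using search_iff[OF distinct_volatile_filter[OF assms]] by (simp only: family_volatile_filter)
  moreover have "family Es - ?V \<union> (?V - Y) = family Es - Y" if "Y \<subseteq> ?V" for Y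
    using that V by blast
  ultimately have s: "search M q S (volatile_filter True M q Es S)
    (volatile_filter False M q Es S) q \<longleftrightarrow>
      (\<exists>Y\<subseteq>?V. card Y \<le> q \<and> distinct_rows M (set S) (\<Union>(family Es - Y)) < q)"
    by (metis (no_types, lifting))
  have len: "length (volatile_filter True M q Es S) \<le> (q + 1) ^ 3" if
    "tame M q (family Es) (set S)"
  proof -
    have "length (volatile_filter True M q Es S) = card (family (volatile_filter True M q Es S))"
      using distinct_card[OF distinct_volatile_filter[OF assms, of True M q S]] by
        (simp add: family_def)
    also have "\<dots> \<le> q ^ 3 + q + 1"
      unfolding family_volatile_filter using card_volatile[OF _ _ that] by simp
    also have "\<dots> \<le> (q + 1) ^ 3" by (simp add: power3_eq_cube algebra_simps)
    finally show ?thesis .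
  qed
  show ?thesis
  proof
    assume "tame_test M q Es S"
    then show "tame M q (family Es) (set S)"
      unfolding tame_test_def s tame_def using V by blast
  next
    assume t: "tame M q (family Es) (set S)"
    then show "tame_test M q Es S"
      unfolding tame_test_def s using len tame_volatile[OF _ _ t] by simp
  qed
qed

subsection \<open>Merging parts and intervals\<close>

text \<open>
  Parts consist of twins, so testing their first elements with \<open>f\<close> decides whether two parts can
  be merged.
\<close>

fun absorb :: "(nat \<Rightarrow> nat \<Rightarrow> bool) \<Rightarrow> nat list \<Rightarrow> parts \<Rightarrow> parts" where
  "absorb f x [] = []"
| "absorb f x (y # ys) = (if f (hd x) (hd y) then (x @ y) # ys else consn y (absorb f x ys))"

fun merge_parts :: "(nat \<Rightarrow> nat \<Rightarrow> bool) \<Rightarrow> parts \<Rightarrow> parts" where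
  "merge_parts f [] = []"
| "merge_parts f (x # xs) =
     (if absorb f x xs \<noteq> [] then absorb f x xs else consn x (merge_parts f xs))"

fun merge_adjacent :: "(nat list \<Rightarrow> bool) \<Rightarrow> parts \<Rightarrow> parts" where
  "merge_adjacent f (x # y # zs) =
     (if f (x @ y) then (x @ y) # zs else consn x (merge_adjacent f (y # zs)))"
| "merge_adjacent f xs = []"

text \<open>
  If the number of members is odd, then the last three are joined.
\<close>

fun pair_up :: "parts \<Rightarrow> parts" where
  "pair_up (x # y # z # w # zs) = (x @ y) # pair_up (z # w # zs)"
| "pair_up xs = [concat xs]"

lemma absorb_nonempty:
  assumes "absorb f x ys \<noteq> []"
  shows "\<exists>us y vs. ys = us @ y # vs \<and> f (hd x) (hd y) \<and> absorb f x ys = us @ (x @ y) # vs"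
  using assms
proof (induction ys)
  case (Cons y ys)
  show ?case
  proof (cases "f (hd x) (hd y)")
    case True
    then show ?thesis by (intro exI[of _ "[]"] exI[of _ y] exI[of _ ys]) auto
  next
    case False
    then obtain us z vs where "ys = us @ z # vs" "f (hd x) (hd z)"
      "absorb f x ys = us @ (x @ z) # vs"
      using Cons by auto
    then show ?thesis using False by (intro exI[of _ "y # us"] exI[of _ z] exI[of _ vs]) auto
  qed
qed simp

lemma absorb_empty: "absorb f x ys = [] \<Longrightarrow> y \<in> set ys \<Longrightarrow> \<not> f (hd x) (hd y)"
  by (induction ys) (auto split: if_splits)

lemma merge_parts_nonempty:
  assumes "merge_parts f xs \<noteq> []"
  shows "\<exists>us x vs y ws. xs = us @ x # vs @ y # ws \<and> f (hd x) (hd y) \<and>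
    merge_parts f xs = us @ vs @ (x @ y) # ws"
  using assms
proof (induction xs)
  case (Cons x xs)
  show ?case
  proof (cases "absorb f x xs = []")
    case False
    then obtain us y vs where "xs = us @ y # vs" "f (hd x) (hd y)"
      "absorb f x xs = us @ (x @ y) # vs"
      using absorb_nonempty by blast
    then show ?thesis using False
      by (intro exI[of _ "[]"] exI[of _ x] exI[of _ us] exI[of _ y] exI[of _ vs]) auto
  next
    case True
    then obtain us z vs y ws where "xs = us @ z # vs @ y # ws" "f (hd z) (hd y)"
        "merge_parts f xs = us @ vs @ (z @ y) # ws"
      using Cons by auto
    then show ?thesis using True
      by (intro exI[of _ "x # us"] exI[of _ z] exI[of _ vs] exI[of _ y] exI[of _ ws]) auto
  qed
qed simp

lemma merge_parts_empty:
  assumes "merge_parts f xs = []" "xs = us @ x # vs" "y \<in> set vs"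
  shows "\<not> f (hd x) (hd y)"
  using assms
proof (induction xs arbitrary: us)
  case (Cons z zs)
  have e: "absorb f z zs = []" "merge_parts f zs = []"
    using Cons.prems(1) by (simp_all split: if_splits)
  show ?case
  proof (cases us)
    case Nil
    then show ?thesis using absorb_empty[OF e(1)] Cons.prems by auto
  next
    case (Cons u us')
    then show ?thesis using Cons.IH[OF e(2), of us'] \<open>z # zs = us @ x # vs\<close> assms(3) by auto
  qed
qed simp

lemma merge_adjacent_nonempty:
  assumes "merge_adjacent f xs \<noteq> []"
  shows "\<exists>us x y vs. xs = us @ x # y # vs \<and> f (x @ y) \<and> merge_adjacent f xs = us @ (x @ y) # vs"
  using assms
proof (induction f xs rule: merge_adjacent.induct)
  case (1 f x y zs)
  show ?case
  proof (cases "f (x @ y)")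
    case True
    then show ?thesis by (intro exI[of _ "[]"] exI[of _ x] exI[of _ y] exI[of _ zs]) auto
  next
    case False
    then obtain us z w vs where "y # zs = us @ z # w # vs" "f (z @ w)"
        "merge_adjacent f (y # zs) = us @ (z @ w) # vs"
      using 1 by auto
    moreover have "merge_adjacent f (x # y # zs) = consn x (merge_adjacent f (y # zs))"
      using False by simp
    ultimately have "x # y # zs = (x # us) @ z # w # vs \<and> f (z @ w) \<and>
        merge_adjacent f (x # y # zs) = (x # us) @ (z @ w) # vs" by simp
    then show ?thesis by blast
  qed
qed auto

lemma merge_adjacent_empty:
  "merge_adjacent f (us @ x # y # vs) = [] \<Longrightarrow> \<not> f (x @ y)"
proof (induction us)
  case Nil
  then show ?case by (auto split: if_splits)
next
  case (Cons u us)
  obtain v ws where "us @ x # y # vs = v # ws" by (cases us) auto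
  then show ?case using Cons by (auto split: if_splits)
qed

lemma pair_up_concat: "concat (pair_up Ds) = concat Ds"
  by (induction Ds rule: pair_up.induct) auto

lemma pair_up_no_Nil: "[] \<notin> set Ds \<Longrightarrow> Ds \<noteq> [] \<Longrightarrow> [] \<notin> set (pair_up Ds)"
  by (induction Ds rule: pair_up.induct) auto

lemma pair_up_contains_pair:
  assumes "T \<in> set (pair_up Ds)" "length Ds \<ge> 2"
  shows "\<exists>us x y vs. Ds = us @ x # y # vs \<and> set (x @ y) \<subseteq> set T"
  using assms
proof (induction Ds rule: pair_up.induct)
  case (1 x y z w zs)
  show ?case
  proof (cases "T = x @ y")
    case True
    then show ?thesis by (metis append_Nil subset_refl)
  next
    case False
    then obtain us u v vs where "z # w # zs = us @ u # v # vs" "set (u @ v) \<subseteq> set T"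
      using 1 by auto
    then have "x # y # z # w # zs = (x # y # us) @ u # v # vs \<and> set (u @ v) \<subseteq> set T" by simp
    then show ?thesis by blast
  qed
next
  case ("2_3" x y)
  then have "[x, y] = [] @ x # y # [] \<and> set (x @ y) \<subseteq> set T" by simp
  then show ?case by blast
next
  case ("2_4" x y z)
  then have "[x, y, z] = [] @ x # y # [z] \<and> set (x @ y) \<subseteq> set T" by auto
  then show ?case by blast
qed auto

lemma pair_up_small:
  assumes "T \<in> set (pair_up Ds)"
  shows "\<exists>Ts. set Ts \<subseteq> set Ds \<and> length Ts \<le> 3 \<and> set T = \<Union>(family Ts)"
  using assms
proof (induction Ds rule: pair_up.induct)
  case (1 x y z w zs)
  show ?case
  proof (cases "T = x @ y")
    case True
    then show ?thesis by (intro exI[of _ "[x, y]"]) auto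
  next
    case False
    then have "T \<in> set (pair_up (z # w # zs))" using 1(2) by simp
    from 1(1)[OF this] obtain Ts where "set Ts \<subseteq> set (z # w # zs)" "length Ts \<le> 3"
        "set T = \<Union>(family Ts)" by blast
    then show ?thesis by (intro exI[of _ Ts]) auto
  qed
next
  case "2_1"
  then show ?case by (intro exI[of _ "[]"]) auto
next
  case ("2_2" x)
  then show ?case by (intro exI[of _ "[x]"]) auto
next
  case ("2_3" x y)
  then show ?case by (intro exI[of _ "[x, y]"]) auto
next
  case ("2_4" x y z)
  then show ?case by (intro exI[of _ "[x, y, z]"]) auto
qed

section \<open>The invariant of the algorithm\<close>

text \<open>
  Parts are merged before intervals are: each interval then has at most \<open>N\<close> parts, where \<open>N\<close>
  bounds the number of classes of twins. The factor 2 leaves room for the union of two such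
  intervals.
\<close>

definition side_ok ::
  "(nat \<Rightarrow> nat \<Rightarrow> nat) \<Rightarrow> nat \<Rightarrow> nat \<Rightarrow> parts \<Rightarrow> parts \<Rightarrow> parts \<Rightarrow> bool" where
  "side_ok M q N Ds Es Ps \<longleftrightarrow>
     twin_parts M q (family Ds) (family Es) (family Ps) \<and>
     (\<forall>S\<in>family Ds. card {P \<in> family Ps. P \<subseteq> S} \<le> 2 * N) \<and>
     (\<forall>S\<in>family Ds. tame M q (family Es) S)"

definition state_ok ::
  "(nat \<Rightarrow> nat \<Rightarrow> nat) \<Rightarrow> nat \<Rightarrow> nat \<Rightarrow> nat \<Rightarrow> nat \<Rightarrow> parts \<Rightarrow> parts \<Rightarrow> parts \<Rightarrow> parts \<Rightarrow> bool" where
  "state_ok M q N n m PR PC DR DC \<longleftrightarrow>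
     parts_list n PR \<and> parts_list m PC \<and> division_list n DR \<and> division_list m DC \<and>
     side_ok M q N DR DC PR \<and> side_ok (flip M) q N DC DR PC"

text \<open>
  Over an alphabet with one letter, all powers of \<open>a\<close> are 1, so the bound on the overlap must be
  1 as well. Constant matrices therefore get the exact number of classes.
\<close>

definition twin_bound :: "nat \<Rightarrow> nat \<Rightarrow> nat" where
  "twin_bound a q = (if a = 1 then 1 else q * (a ^ q) ^ q)"

definition entries_below :: "(nat \<Rightarrow> nat \<Rightarrow> nat) \<Rightarrow> nat \<Rightarrow> nat \<Rightarrow> nat \<Rightarrow> bool" where
  "entries_below M n m a \<longleftrightarrow> (\<forall>i<n. \<forall>j<m. M i j < a)"

lemma entries_below_flip: "entries_below (flip M) m n a \<longleftrightarrow> entries_below M n m a"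
  by (auto simp: entries_below_def flip_def)

lemma state_ok_flip: "state_ok (flip M) q N m n PC PR DC DR \<longleftrightarrow> state_ok M q N n m PR PC DR DC"
  by (auto simp: state_ok_def)

lemma state_ok_partitions:
  assumes "state_ok M q N n m PR PC DR DC"
  shows "partition_on {..<n} (family PR)" "partition_on {..<m} (family PC)"
    "interval_partition {..<n} (family DR)" "interval_partition {..<m} (family DC)"
    "partition_on {..<n} (family DR)" "partition_on {..<m} (family DC)"
    "disjoint (family DR)" "disjoint (family DC)"
proof -
  have l: "parts_list n PR" "parts_list m PC" "division_list n DR" "division_list m DC"
    using assms by (simp_all add: state_ok_def)
  show "partition_on {..<n} (family PR)" "partition_on {..<m} (family PC)"
    "partition_on {..<n} (family DR)" "partition_on {..<m} (family DC)"
    "interval_partition {..<n} (family DR)" "interval_partition {..<m} (family DC)"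
    using l by (simp_all add: parts_list_partition(1) division_parts_list division_list_interval)
  then show "disjoint (family DR)" "disjoint (family DC)" using partition_onD2 by blast+
qed

text \<open>
  A single row is tame without any deletion, as \<open>q \<ge> 2\<close>.
\<close>

lemma initial_state_ok:
  assumes "q \<ge> 2" "N \<ge> 1"
  shows "state_ok M q N n m (map (\<lambda>i. [i]) [0..<n]) (map (\<lambda>i. [i]) [0..<m])
    (map (\<lambda>i. [i]) [0..<n]) (map (\<lambda>i. [i]) [0..<m])"
proof -
  have c: "concat (map (\<lambda>i. [i]) xs) = xs" for xs :: "nat list" by (induction xs) auto
  have d: "division_list n (map (\<lambda>i. [i]) [0..<n])" for n by (auto simp: division_list_def c)
  have fam: "family (map (\<lambda>i. [i]) [0..<n]) = (\<lambda>i. {i}) ` {..<n}" for n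
    by (auto simp: family_def image_image lessThan_atLeast0)
  have tame: "tame X q E {i}" for X :: "nat \<Rightarrow> nat \<Rightarrow> nat" and E i
  proof -
    have "distinct_rows X {i} (\<Union>(E - {})) < q" using assms(1) by (simp add: distinct_rows_def)
    then show ?thesis unfolding tame_def by (intro exI[of _ "{}"]) auto
  qed
  have "side_ok X q N (map (\<lambda>i. [i]) [0..<n]) Es (map (\<lambda>i. [i]) [0..<n])" for X n Es
  proof -
    have "{P \<in> (\<lambda>i. {i}) ` {..<n}. P \<subseteq> {i}} \<subseteq> {{i}}" for i by auto
    then have c: "card {P \<in> (\<lambda>i. {i}) ` {..<n}. P \<subseteq> {i}} \<le> card {{i}}" for i
      by (intro card_mono) auto
    have "card {P \<in> (\<lambda>i. {i}) ` {..<n}. P \<subseteq> {i}} \<le> 2 * N" for i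
      using c[of i] assms(2) by simp
    moreover have "twin_parts X q (family (map (\<lambda>i. [i]) [0..<n])) (family Es)
      ((\<lambda>i. {i}) ` {..<n})"
      unfolding twin_parts_def twins_def fam by (auto simp: agree_def)
    ultimately show ?thesis unfolding side_ok_def fam using tame by simp
  qed
  then show ?thesis unfolding state_ok_def using d division_parts_list by blast
qed

lemma few_twin_parts:
  assumes ok: "state_ok M q N n m PR PC DR DC" and a: "entries_below M n m a" "a \<ge> 1"
    and S: "S \<in> family DR"
  shows "distinct_rows M S (\<Union>{T \<in> family DC. \<not> entangled M q (family DR) (family DC) S T})
    \<le> twin_bound a q"
proof -
  note part = state_ok_partitions[OF ok]
  have sub: "S \<subseteq> {..<n}" "\<Union>(family DC) = {..<m}"
    using S part(5,6) by (auto simp: partition_on_def)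
  then have b: "M r c < a" if "r \<in> S" "c \<in> \<Union>(family DC)" for r c
    using that a(1) by (auto simp: entries_below_def)
  show ?thesis
  proof (cases "a = 1")
    case True
    let ?J = "\<Union>{T \<in> family DC. \<not> entangled M q (family DR) (family DC) S T}"
    have "(\<lambda>r. restrict (M r) ?J) ` S \<subseteq> {restrict (\<lambda>_. 0) ?J}"
    proof clarify
      fix r assume "r \<in> S"
      then show "restrict (M r) ?J = restrict (\<lambda>_. 0) ?J"
        using b[of r] True unfolding restrict_eq_iff by fastforce
    qed
    then have "distinct_rows M S ?J \<le> card {restrict (\<lambda>_ :: nat. 0 :: nat) ?J}"
      unfolding distinct_rows_def by (intro card_mono) auto
    then show ?thesis using True by (simp add: twin_bound_def)
  next
    case False
    have "distinct_rows M S (\<Union>{T \<in> family DC. \<not> entangled M q (family DR) (family DC) S T})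
        \<le> q * (a ^ q) ^ q"
      using ok S a(2) b by (intro few_twin_classes) (auto simp: state_ok_def side_ok_def)
    then show ?thesis using False by (simp add: twin_bound_def)
  qed
qed

subsection \<open>Merging twins\<close>

text \<open>
  Sending \<open>A\<close> to \<open>A \<union> B\<close> and fixing every other part maps the old parts inside \<open>S\<close> onto the new
  ones.
\<close>

lemma merges_count:
  assumes "finite P" "A \<in> P" "B \<in> P" "P' = insert (A \<union> B) (P - {A, B})"
  shows "card {X \<in> P'. X \<subseteq> S} \<le> card {X \<in> P. X \<subseteq> S}"
proof -
  have "{X \<in> P'. X \<subseteq> S} \<subseteq> (\<lambda>X. if X = A then A \<union> B else X) ` {X \<in> P. X \<subseteq> S}"
  proof clarify
    fix X assume X: "X \<in> P'" "X \<subseteq> S"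
    show "X \<in> (\<lambda>X. if X = A then A \<union> B else X) ` {X \<in> P. X \<subseteq> S}"
    proof (cases "X = A \<union> B")
      case True
      then show ?thesis using X(2) assms(2) by (intro image_eqI[of _ _ A]) auto
    next
      case False
      then show ?thesis using X assms(4) by (intro image_eqI[of _ _ X]) auto
    qed
  qed
  then show ?thesis by (rule surj_card_le[rotated]) (use assms(1) in simp)
qed

lemma merge_parts_step:
  assumes ok: "state_ok M q N n m PR PC DR DC"
    and PR': "PR' = merge_parts (twins M q (family DR) (family DC)) PR" "PR' \<noteq> []"
  shows "state_ok M q N n m PR' PC DR DC" "length PR = Suc (length PR')"
    "merges (family PR) (family PR')"
proof -
  let ?tw = "twins M q (family DR) (family DC)"
  have "merge_parts ?tw PR \<noteq> []" using PR' by simp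
  from merge_parts_nonempty[OF this] obtain us x vs y ws where
      eq: "PR = us @ x # vs @ y # ws" "?tw (hd x) (hd y)" "PR' = us @ vs @ (x @ y) # ws"
    using PR'(1) by blast
  show "length PR = Suc (length PR')" by (simp add: eq)
  have pl: "parts_list n PR" and tp: "twin_parts M q (family DR) (family DC) (family PR)"
    and cnt: "\<forall>S\<in>family DR. card {P \<in> family PR. P \<subseteq> S} \<le> 2 * N"
    using ok by (auto simp: state_ok_def side_ok_def)
  have pl': "parts_list n PR'" using pl unfolding parts_list_def eq by auto
  have dist: "distinct (map set PR)" using parts_list_partition(2)[OF pl] .
  have ne: "x \<noteq> []" "y \<noteq> []" using pl by (auto simp: parts_list_def eq)
  have xy: "set x \<in> family PR" "set y \<in> family PR" "set x \<noteq> set y"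
    using dist by (auto simp: eq)
  have fam: "family PR' = insert (set x \<union> set y) (family PR - {set x, set y})"
  proof -
    have "set x \<notin> family (us @ vs @ ws)" "set y \<notin> family (us @ vs @ ws)"
      using dist by (auto simp: eq family_def)
    then show ?thesis unfolding eq by auto
  qed
  then show "merges (family PR) (family PR')" using xy unfolding merges_def by blast
  have "card {P \<in> family PR'. P \<subseteq> S} \<le> 2 * N" if "S \<in> family DR" for S
    using merges_count[OF finite_family(1) xy(1,2) fam, of S] cnt that by (meson le_trans)
  moreover have "twin_parts M q (family DR) (family DC) (family PR')"
  proof -
    have dis: "disjoint (family DR)" using state_ok_partitions[OF ok] by blast
    have tw: "?tw r s" if "P \<in> family PR" "r \<in> P" "s \<in> P" for P r s
      using tp that unfolding twin_parts_def by blast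
    have "?tw r (hd x)" if "r \<in> set x \<union> set y" for r
    proof (cases "r \<in> set x")
      case True
      then show ?thesis using tw[OF xy(1)] ne by simp
    next
      case False
      then have "?tw r (hd y)" using that tw[OF xy(2)] ne by simp
      then show ?thesis using twins_trans[OF dis] twins_sym[OF eq(2)] by blast
    qed
    then have "?tw r s" if "r \<in> set x \<union> set y" "s \<in> set x \<union> set y" for r s
      using that twins_trans[OF dis] twins_sym by metis
    then show ?thesis using tw unfolding twin_parts_def fam by blast
  qed
  ultimately show "state_ok M q N n m PR' PC DR DC"
    using ok pl' unfolding state_ok_def side_ok_def by blast
qed

text \<open>
  If nothing can be merged any more, then rows from different parts of \<open>S\<close> are not twins, so they
  differ on some column interval that is not entangled with \<open>S\<close>. Hence the parts are no more than
  the distinct rows on these intervals.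
\<close>

lemma exhausted_few_parts:
  assumes ok: "state_ok M q N n m PR PC DR DC" and a: "entries_below M n m a" "a \<ge> 1"
    and ex: "merge_parts (twins M q (family DR) (family DC)) PR = []" and S: "S \<in> family DR"
  shows "card {P \<in> family PR. P \<subseteq> S} \<le> twin_bound a q"
proof -
  let ?tw = "twins M q (family DR) (family DC)"
  define J where "J = \<Union>{T \<in> family DC. \<not> entangled M q (family DR) (family DC) S T}"
  define rep where "rep = (\<lambda>P :: nat set. SOME r. r \<in> P)"
  have pl: "parts_list n PR" and tp: "twin_parts M q (family DR) (family DC) (family PR)"
    using ok by (auto simp: state_ok_def side_ok_def)
  have dis: "disjoint (family DR)" using state_ok_partitions[OF ok] by blast
  have rep: "rep P \<in> P" if "P \<in> family PR" for P
  proof -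
    have "P \<noteq> {}" using that parts_list_partition(1)[OF pl] by (auto simp: partition_on_def)
    then show ?thesis unfolding rep_def by (simp add: some_in_eq)
  qed
  have hd: "?tw r (hd x)" "?tw (hd x) r" if "x \<in> set PR" "r \<in> set x" for x r
  proof -
    have "hd x \<in> set x" using that(2) by (cases x) auto
    then show "?tw r (hd x)" "?tw (hd x) r"
      using tp that in_familyI[OF that(1)] unfolding twin_parts_def by blast+
  qed
  have not_tw: "\<not> ?tw r s" if PQ: "P \<in> family PR" "Q \<in> family PR" "P \<noteq> Q" "r \<in> P" "s \<in> Q"
    for P Q r s
  proof
    assume tw: "?tw r s"
    obtain x y where xy: "x \<in> set PR" "P = set x" "y \<in> set PR" "Q = set y"
      using PQ(1,2) unfolding family_def by auto
    have h: "?tw (hd x) (hd y)"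
      using hd(2)[OF xy(1), of r] hd(1)[OF xy(3), of s] xy(2,4) PQ(4,5) tw twins_trans[OF dis] by
        blast
    obtain us vs where eq: "PR = us @ x # vs" using xy(1) by (metis split_list)
    show False
    proof (cases "y \<in> set vs")
      case True
      then show False using merge_parts_empty[OF ex eq] h by blast
    next
      case False
      then have "y \<in> set us" using eq xy PQ(3) by auto
      then obtain us' vs' where "us = us' @ y # vs'" by (metis split_list)
      then have "PR = us' @ y # (vs' @ x # vs)" using eq by simp
      from merge_parts_empty[OF ex this, of x] show False using twins_sym[OF h] by simp
    qed
  qed
  have "inj_on (\<lambda>P. restrict (M (rep P)) J) {P \<in> family PR. P \<subseteq> S}"
  proof (rule inj_onI, rule ccontr)
    fix P Q assume PQ: "P \<in> {P \<in> family PR. P \<subseteq> S}" "Q \<in> {P \<in> family PR. P \<subseteq> S}" "P \<noteq> Q"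
      and eq: "restrict (M (rep P)) J = restrict (M (rep Q)) J"
    have in_S: "rep P \<in> S" "rep Q \<in> S" using rep PQ by auto
    have "agree M (rep P) (rep Q) T"
      if "T \<in> family DC" "\<not> entangled M q (family DR) (family DC) S T" for T
      using eq that unfolding restrict_eq_iff J_def agree_def by blast
    then have "?tw (rep P) (rep Q)" unfolding twins_def using in_S S by blast
    then show False using not_tw rep PQ by blast
  qed
  then have "card {P \<in> family PR. P \<subseteq> S}
      = card ((\<lambda>P. restrict (M (rep P)) J) ` {P \<in> family PR. P \<subseteq> S})"
    by (simp add: card_image)
  also have "\<dots> \<le> distinct_rows M S J"
    unfolding distinct_rows_def using rep S by (intro card_mono) auto
  also have "\<dots> \<le> twin_bound a q" unfolding J_def by (rule few_twin_parts[OF ok a S])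
  finally show ?thesis .
qed

subsection \<open>Merging intervals\<close>

text \<open>
  Every part lies inside of one of the two merged intervals, each of which has at most
  \<open>twin_bound a q\<close> parts. All other conditions are monotone.
\<close>

lemma merge_adjacent_step:
  assumes ok: "state_ok M q (twin_bound a q) n m PR PC DR DC"
    and a: "entries_below M n m a" "a \<ge> 1"
    and ex: "merge_parts (twins M q (family DR) (family DC)) PR = []"
    and DR': "DR' = merge_adjacent (tame_test M q DC) DR" "DR' \<noteq> []"
  shows "state_ok M q (twin_bound a q) n m PR PC DR' DC" "length DR = Suc (length DR')"
proof -
  note part = state_ok_partitions[OF ok]
  have "merge_adjacent (tame_test M q DC) DR \<noteq> []" using DR' by simp
  from merge_adjacent_nonempty[OF this] obtain us x y vs where
      eq: "DR = us @ x # y # vs" "tame_test M q DC (x @ y)" "DR' = us @ (x @ y) # vs"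
    using DR'(1) by blast
  show "length DR = Suc (length DR')" by (simp add: eq)
  have dl: "division_list n DR" "division_list m DC" using ok by (auto simp: state_ok_def)
  have dl': "division_list n DR'" using dl(1) by (auto simp: division_list_def eq)
  have ref: "refines {..<n} (family DR) (family DR')"
    unfolding refines_def
  proof (intro conjI ballI)
    show "partition_on {..<n} (family DR)" "partition_on {..<n} (family DR')"
      using parts_list_partition(1)[OF division_parts_list] dl(1) dl' by blast+
    show "\<exists>Y\<in>family DR'. X \<subseteq> Y" if "X \<in> family DR" for X
      using that by (auto simp: eq)
  qed
  have refE: "refines {..<m} (family DC) (family DC)"
    using part(6) by (auto simp: refines_def)
  have new: "tame M q (family DC) (set (x @ y))"
    using eq(2) tame_test_iff parts_list_partition(2)[OF division_parts_list[OF dl(2)]] by blast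
  have side: "side_ok M q (twin_bound a q) DR DC PR"
    "side_ok (flip M) q (twin_bound a q) DC DR PC"
    using ok by (auto simp: state_ok_def)
  have tp: "twin_parts M q (family DR) (family DC) (family PR)"
    using side by (simp add: side_ok_def)
  have "side_ok M q (twin_bound a q) DR' DC PR"
    unfolding side_ok_def
  proof (intro conjI ballI)
    show "twin_parts M q (family DR') (family DC) (family PR)"
      unfolding twin_parts_def
    proof (intro ballI)
      fix P r s assume "P \<in> family PR" "r \<in> P" "s \<in> P"
      then have "twins M q (family DR) (family DC) r s" using tp by (simp add: twin_parts_def)
      then show "twins M q (family DR') (family DC) r s"
        by (rule twins_mono[OF ref finite_family(1) refE finite_family(1)])
    qed
    fix S assume "S \<in> family DR'"
    then consider "S \<in> family DR" | "S = set x \<union> set y" by (auto simp: eq)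
    note cases = this
    from cases show "tame M q (family DC) S"
      using side(1) new by cases (auto simp: side_ok_def)
    from cases show "card {P \<in> family PR. P \<subseteq> S} \<le> 2 * twin_bound a q"
    proof cases
      case 1
      then show ?thesis using side(1) unfolding side_ok_def by blast
    next
      case 2
      have xy: "set x \<in> family DR" "set y \<in> family DR" by (auto simp: eq)
      have "{P \<in> family PR. P \<subseteq> S} \<subseteq> {P \<in> family PR. P \<subseteq> set x} \<union> {P \<in> family PR. P \<subseteq> set y}"
      proof
        fix P assume "P \<in> {P \<in> family PR. P \<subseteq> S}"
        then have P: "P \<in> family PR" "P \<subseteq> S" by auto
        then obtain r where r: "r \<in> P" using part(1) by (metis all_not_in_conv partition_onD3)
        then have "P \<noteq> {}" by blast
        then obtain S' where S': "S' \<in> family DR" "P \<subseteq> S'"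
          by (rule twin_part_in_division[OF tp P(1) _ part(7)])
        have "S' = set x \<or> S' = set y"
          using r P(2) S' xy 2 disjointD[OF part(7)] by blast
        then show "P \<in> {P \<in> family PR. P \<subseteq> set x} \<union> {P \<in> family PR. P \<subseteq> set y}"
          using S' P(1) by blast
      qed
      then have "card {P \<in> family PR. P \<subseteq> S}
          \<le> card ({P \<in> family PR. P \<subseteq> set x} \<union> {P \<in> family PR. P \<subseteq> set y})"
        by (intro card_mono) auto
      also have "\<dots> \<le> card {P \<in> family PR. P \<subseteq> set x} + card {P \<in> family PR. P \<subseteq> set y}"
        by (rule card_Un_le)
      also have "\<dots> \<le> 2 * twin_bound a q"
        using exhausted_few_parts[OF ok a ex xy(1)] exhausted_few_parts[OF ok a ex xy(2)] by simp
      finally show ?thesis .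
    qed
  qed
  moreover have "side_ok (flip M) q (twin_bound a q) DC DR' PC"
    unfolding side_ok_def
  proof (intro conjI ballI)
    show "twin_parts (flip M) q (family DC) (family DR') (family PC)"
      unfolding twin_parts_def
    proof (intro ballI)
      fix P r s assume "P \<in> family PC" "r \<in> P" "s \<in> P"
      then have "twins (flip M) q (family DC) (family DR) r s"
        using side(2) by (simp add: side_ok_def twin_parts_def)
      then show "twins (flip M) q (family DC) (family DR') r s"
        by (rule twins_mono[OF refE finite_family(1) ref finite_family(1)])
    qed
    fix T assume T: "T \<in> family DC"
    then show "card {P \<in> family PC. P \<subseteq> T} \<le> 2 * twin_bound a q"
      using side(2) by (simp add: side_ok_def)
    have "tame (flip M) q (family DR) T" using side(2) T by (simp add: side_ok_def)
    then show "tame (flip M) q (family DR') T"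
      by (rule tame_mono[OF ref finite_family(1) finite_family(2)[OF T]])
  qed
  ultimately show "state_ok M q (twin_bound a q) n m PR PC DR' DC"
    using ok dl' by (simp add: state_ok_def)
qed

subsection \<open>When no interval can be merged\<close>

lemma not_tame_rich:
  assumes "\<not> tame M q E S" "Y \<subseteq> E" "card Y \<le> q"
  shows "q \<le> distinct_rows M S (\<Union>(E - Y))"
  using assms unfolding tame_def by (meson not_le)

lemma pair_up_division:
  assumes "division_list n Ds" "Ds \<noteq> []"
  shows "division_list n (pair_up Ds)"
  using assms pair_up_no_Nil by (auto simp: division_list_def pair_up_concat)

text \<open>
  A joined interval contains two adjacent intervals whose union is not tame. Deleting \<open>k\<close> joined
  column intervals amounts to deleting at most \<open>3 k \<le> q\<close> intervals of the division itself, which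
  leaves at least \<open>q\<close> distinct rows.
\<close>

lemma pair_up_row_rich:
  assumes DR: "division_list n DR" "length DR \<ge> 2" and DC: "division_list m DC" "length DC \<ge> 2"
    and ex: "merge_adjacent (tame_test M q DC) DR = []" and k: "3 * k \<le> q"
  shows "row_rich {..<m} M k (family (pair_up DR)) (family (pair_up DC))"
  unfolding row_rich_def
proof (intro ballI allI impI, elim conjE)
  fix S Y assume S: "S \<in> family (pair_up DR)" and Y: "Y \<subseteq> family (pair_up DC)" "card Y \<le> k"
  obtain T where T: "T \<in> set (pair_up DR)" "S = set T" using S by (auto simp: family_def)
  from pair_up_contains_pair[OF T(1) DR(2)] obtain us x y vs
    where eq: "DR = us @ x # y # vs" and xy: "set (x @ y) \<subseteq> S" using T(2) by blast
  have "\<not> tame_test M q DC (x @ y)" using merge_adjacent_empty ex eq by blast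
  then have nt: "\<not> tame M q (family DC) (set (x @ y))"
    using tame_test_iff parts_list_partition(2)[OF division_parts_list[OF DC(1)]] by blast
  have pDC: "partition_on {..<m} (family DC)"
    using parts_list_partition(1) division_parts_list DC(1) by blast
  have "DC \<noteq> []" using DC(2) by auto
  then have pPC: "partition_on {..<m} (family (pair_up DC))"
    using parts_list_partition(1) division_parts_list pair_up_division DC(1) by blast
  have fY: "finite Y" using Y(1) finite_family(1) by (rule finite_subset)
  define Z where "Z = (\<Union>Q\<in>Y. {T \<in> family DC. T \<subseteq> Q})"
  have 3: "card {T \<in> family DC. T \<subseteq> Q} \<le> 3" "\<exists>F. F \<subseteq> family DC \<and> Q = \<Union>F"
    if Q: "Q \<in> family (pair_up DC)" for Q
  proof -
    obtain T where T: "T \<in> set (pair_up DC)" "Q = set T" using Q by (auto simp: family_def)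
    from pair_up_small[OF T(1)] obtain Ts
      where Ts: "set Ts \<subseteq> set DC" "length Ts \<le> 3" "Q = \<Union>(family Ts)" using T(2) by blast
    have sub: "family Ts \<subseteq> family DC" using Ts(1) by (auto simp: family_def)
    then show "\<exists>F. F \<subseteq> family DC \<and> Q = \<Union>F" using Ts(3) by blast
    have "{T \<in> family DC. T \<subseteq> Q} \<subseteq> family Ts"
    proof clarify
      fix T assume T: "T \<in> family DC" "T \<subseteq> Q"
      then obtain c where c: "c \<in> T" using pDC by (metis all_not_in_conv partition_onD3)
      then obtain T' where T': "T' \<in> family Ts" "c \<in> T'" using T(2) Ts(3) by blast
      then have "T = T'" using c T(1) sub disjointD[OF partition_onD2[OF pDC], of T T'] by blast
      then show "T \<in> family Ts" using T' by simp
    qed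
    then have "card {T \<in> family DC. T \<subseteq> Q} \<le> card (family Ts)" by (intro card_mono) auto
    also have "\<dots> \<le> length Ts" unfolding family_def using card_length[of "map set Ts"] by simp
    finally show "card {T \<in> family DC. T \<subseteq> Q} \<le> 3" using Ts(2) by simp
  qed
  have "card Z \<le> (\<Sum>Q\<in>Y. card {T \<in> family DC. T \<subseteq> Q})" unfolding Z_def by (rule card_UN_le[OF fY])
  also have "\<dots> \<le> (\<Sum>Q\<in>Y. 3)" using 3(1) Y(1) by (intro sum_mono) auto
  also have "\<dots> \<le> q" using Y(2) k by simp
  finally have "q \<le> distinct_rows M (set (x @ y)) (\<Union>(family DC - Z))"
    by (intro not_tame_rich[OF nt]) (auto simp: Z_def)
  also have "\<Union>(family DC - Z) \<subseteq> {..<m} - \<Union>Y"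
  proof
    fix c assume "c \<in> \<Union>(family DC - Z)"
    then obtain T where T: "T \<in> family DC" "T \<notin> Z" "c \<in> T" by blast
    have "c \<notin> \<Union>Y"
    proof
      assume "c \<in> \<Union>Y"
      then obtain Q where Q: "Q \<in> Y" "c \<in> Q" by blast
      then obtain F where F: "F \<subseteq> family DC" "Q = \<Union>F" using 3(2) Y(1) by blast
      then obtain T' where T': "T' \<in> F" "c \<in> T'" using Q(2) by blast
      then have "T' = T" using T F(1) disjointD[OF partition_onD2[OF pDC], of T' T] by blast
      then have "T \<subseteq> Q" using T' F(2) by blast
      then show False using T Q(1) by (auto simp: Z_def)
    qed
    then show "c \<in> {..<m} - \<Union>Y" using T pDC by (auto simp: partition_on_def)
  qed
  then have "distinct_rows M (set (x @ y)) (\<Union>(family DC - Z)) \<le> distinct_rows M S ({..<m} - \<Union>Y)"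
    using xy S by (intro distinct_rows_mono) auto
  finally show "k \<le> distinct_rows M S ({..<m} - \<Union>Y)" using k by simp
qed

lemma stuck_rich_division:
  assumes ok: "state_ok M q N n m PR PC DR DC"
    and "length DR \<ge> 2" "length DC \<ge> 2" "3 * k \<le> q"
    and "merge_adjacent (tame_test M q DC) DR = []"
      "merge_adjacent (tame_test (flip M) q DR) DC = []"
  shows "rich_division {..<n} {..<m} M k (family_pair (pair_up DR, pair_up DC))"
proof -
  have dl: "division_list n DR" "division_list m DC" using ok by (auto simp: state_ok_def)
  have "DR \<noteq> []" "DC \<noteq> []" using assms(2,3) by auto
  then have "interval_partition {..<n} (family (pair_up DR))"
      "interval_partition {..<m} (family (pair_up DC))"
    using dl pair_up_division division_list_interval by blast+
  then show ?thesis
    using pair_up_row_rich[OF dl(1) assms(2) dl(2) assms(3,5,4)]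
      pair_up_row_rich[OF dl(2) assms(3) dl(1) assms(2,6,4)]
    by (simp add: rich_division_def family_pair_def)
qed

text \<open>Against a single interval everything is tame, since it can be deleted.\<close>

lemma stuck_single:
  assumes ok: "state_ok M q N n m PR PC DR DC" and "length DR \<le> 1" "q \<ge> 2" "n \<ge> 1"
    and ex: "merge_adjacent (tame_test (flip M) q DR) DC = []"
  shows "length DC \<le> 1"
proof (rule ccontr)
  assume "\<not> length DC \<le> 1"
  then obtain x y vs where eq: "DC = [] @ x # y # vs"
    by (metis One_nat_def append_Nil length_Cons list.size(3) not_less_eq_eq list.exhaust zero_le)
  have dl: "division_list n DR" using ok by (auto simp: state_ok_def)
  have dist: "distinct (map set DR)"
    using parts_list_partition(2)[OF division_parts_list[OF dl]] .
  have "\<not> tame_test (flip M) q DR (x @ y)" using merge_adjacent_empty ex eq by metis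
  then have nt: "\<not> tame (flip M) q (family DR) (set (x @ y))" using tame_test_iff dist by blast
  have "card (family DR) \<le> 1"
    using assms(2) card_length[of "map set DR"] by (simp add: family_def)
  then have "q \<le> distinct_rows (flip M) (set (x @ y)) (\<Union>(family DR - family DR))"
    using assms(3) by (intro not_tame_rich[OF nt]) auto
  also have "\<dots> \<le> 1"
    using distinct_rows_Union[of "set (x @ y)" "{}" "flip M" 1] by simp
  finally show False using assms(3) by simp
qed

text \<open>
  The single row interval and the single column interval are entangled, so all rows are twins.
\<close>

lemma finished_single:
  assumes ok: "state_ok M q N n m PR PC DR DC"
    and len: "length DR = 1" "length DC = 1" and "n \<ge> 1"
    and ex: "merge_parts (twins M q (family DR) (family DC)) PR = []"
  shows "family PR = {{..<n}} \<and> length PR = 1"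
proof -
  note part = state_ok_partitions[OF ok]
  have pl: "parts_list n PR" "division_list n DR" "division_list m DC" using ok by (auto
    simp: state_ok_def)
  have c: "card (family DR) = 1" "card (family DC) = 1"
    using parts_list_partition(3) division_parts_list pl(2,3) len by metis+
  then have fam: "family DR = {{..<n}}" "family DC = {{..<m}}"
    using partition_card_1 part(5,6) by blast+
  have tw: "twins M q (family DR) (family DC) r s" if "r < n" "s < n" for r s
    using that unfolding twins_def fam entangled_def volatile_def by simp
  have "0 \<in> set (concat PR)" using pl(1) assms(4) by (auto simp: parts_list_def
    simp del: set_concat)
  then have "PR \<noteq> []" by auto
  then obtain x xs where PR: "PR = x # xs" by (cases PR) auto
  have "xs = []"
  proof (rule ccontr)
    assume "xs \<noteq> []"
    then obtain y where y: "y \<in> set xs" by (meson hd_in_set)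
    have "\<not> twins M q (family DR) (family DC) (hd x) (hd y)"
      using merge_parts_empty[OF ex, of "[]" x xs y] y PR by simp
    moreover have "hd z < n" if "z \<in> set PR" for z
    proof -
      have "z \<noteq> []" "set z \<subseteq> {..<n}" using parts_list_elem[OF pl(1) that] by auto
      then show ?thesis by (cases z) auto
    qed
    ultimately show False using tw y PR by simp
  qed
  then have "length PR = 1" using PR by simp
  then have "card (family PR) = 1" using parts_list_partition(3)[OF pl(1)] by simp
  then show ?thesis using partition_card_1 part(1) \<open>length PR = 1\<close> by blast
qed

subsection \<open>Answers\<close>

definition bounded_pair ::
  "(nat \<Rightarrow> nat \<Rightarrow> nat) \<Rightarrow> nat \<Rightarrow> nat \<Rightarrow> nat \<Rightarrow> nat \<Rightarrow> (nat, nat) bipartition \<Rightarrow> bool" where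
  "bounded_pair M n m p e PQ \<longleftrightarrow>
     overlapping {..<n} p (fst PQ) \<and> overlapping {..<m} p (snd PQ) \<and>
     (\<forall>P\<in>fst PQ. error_value M (snd PQ) P \<le> e) \<and>
     (\<forall>Q\<in>snd PQ. error_value (flip M) (fst PQ) Q \<le> e)"

lemma state_bounded:
  assumes ok: "state_ok M q N n m PR PC DR DC"
  shows "bounded_pair M n m (2 * N - 1) ((q ^ 3 + q + 1) * (2 * N)) (family PR, family PC)"
proof -
  note part = state_ok_partitions[OF ok]
  have side: "twin_parts M q (family DR) (family DC) (family PR)"
    "twin_parts (flip M) q (family DC) (family DR) (family PC)"
    "\<And>S. S \<in> family DR \<Longrightarrow> card {P \<in> family PR. P \<subseteq> S} \<le> 2 * N"
    "\<And>S. S \<in> family DC \<Longrightarrow> card {P \<in> family PC. P \<subseteq> S} \<le> 2 * N"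
    "\<And>S. S \<in> family DR \<Longrightarrow> tame M q (family DC) S"
    "\<And>S. S \<in> family DC \<Longrightarrow> tame (flip M) q (family DR) S"
    using ok by (auto simp: state_ok_def side_ok_def)
  note fin = finite_lessThan[of n] finite_lessThan[of m]
  show ?thesis
    unfolding bounded_pair_def fst_conv snd_conv
  proof (intro conjI ballI)
    show "overlapping {..<n} (2 * N - 1) (family PR)"
      by (rule twin_parts_overlapping[OF fin(1) part(1,3) side(1,3)])
    show "overlapping {..<m} (2 * N - 1) (family PC)"
      by (rule twin_parts_overlapping[OF fin(2) part(2,4) side(2,4)])
    show "error_value M (family PC) P \<le> (q ^ 3 + q + 1) * (2 * N)" if "P \<in> family PR" for P
      by (rule twin_parts_error[OF fin part(1,2,5,6) side(1,2,4,5) that])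
    have side1: "twin_parts (flip (flip M)) q (family DR) (family DC) (family PR)"
      using side(1) by simp
    show "error_value (flip M) (family PR) Q \<le> (q ^ 3 + q + 1) * (2 * N)" if "Q \<in> family PC" for Q
      by (rule twin_parts_error[OF fin(2,1) part(2,1,6,5) side(2) side1 side(3,6) that])
  qed
qed

text \<open>
  What the algorithm has to return when its current bipartition is \<open>(PR, PC)\<close>: a sequence starts
  there.
\<close>

definition good_answer ::
  "(nat \<Rightarrow> nat \<Rightarrow> nat) \<Rightarrow> nat \<Rightarrow> nat \<Rightarrow> nat \<Rightarrow> nat \<Rightarrow> nat \<Rightarrow> parts \<Rightarrow> parts \<Rightarrow> answer \<Rightarrow> bool" where
  "good_answer M n m k p e PR PC ans \<longleftrightarrow> (case ans of
     Division D \<Rightarrow> rich_division {..<n} {..<m} M k (family_pair D)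
   | Sequence Ds \<Rightarrow> contracts_fully {..<n} {..<m} (map family_pair Ds) \<and>
       hd (map family_pair Ds) = (family PR, family PC) \<and>
       length Ds = length PR + length PC - 1 \<and>
       (\<forall>PQ\<in>set (map family_pair Ds). bounded_pair M n m p e PQ))"

fun emit :: "parts \<times> parts \<Rightarrow> answer \<Rightarrow> answer" where
  "emit P (Division D) = Division D"
| "emit P (Sequence Ds) = Sequence (P # Ds)"

lemma good_answer_emit:
  assumes "good_answer M n m k p e PR' PC' ans"
    and "contraction_step (family PR, family PC) (family PR', family PC')"
    and "bounded_pair M n m p e (family PR, family PC)"
    and "length PR + length PC = Suc (length PR' + length PC')" "PR' \<noteq> []"
  shows "good_answer M n m k p e PR PC (emit (PR, PC) ans)"
proof (cases ans)
  case (Division D)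
  then show ?thesis using assms(1) by (simp add: good_answer_def)
next
  case (Sequence Ds)
  have "length PR' > 0" using assms(5) by simp
  then show ?thesis
    using assms Sequence contracts_fully_Cons[of "{..<n}" "{..<m}" "map family_pair Ds"]
    by (auto simp: good_answer_def family_pair_def)
qed

lemma good_answer_final:
  assumes "family PR = {{..<n}}" "length PR = 1" "family PC = {{..<m}}" "length PC = 1"
    and "bounded_pair M n m p e (family PR, family PC)"
  shows "good_answer M n m k p e PR PC (Sequence [(PR, PC)])"
  using assms by (simp add: good_answer_def family_pair_def contracts_fully_def)

section \<open>The program\<close>

text \<open>
  The numbers of the functions. Most functions take an orientation \<open>f\<close>, the matrix, and \<open>q\<close> as
  their first arguments; \<open>f\<close> is true if the function deals with rows of the matrix and false if
  it deals with its columns, so that every function is written for rows only. As there are no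
  local variables, a value that is needed twice is passed to an auxiliary function, such as
  \<open>MERGE_PARTS_TEST\<close> or \<open>LOOP_ROWS\<close>.
\<close>

definition MAIN :: nat where "MAIN = 0"
definition APPEND :: nat where "APPEND = 1"
definition MUL :: nat where "MUL = 2"
definition LEQ :: nat where "LEQ = 3"
definition EQ :: nat where "EQ = 4"
definition NTH :: nat where "NTH = 5"
definition ENTRY :: nat where "ENTRY = 6"
definition AGREE :: nat where "AGREE = 7"
definition AGREE_ALL :: nat where "AGREE_ALL = 8"
definition DIFFS :: nat where "DIFFS = 9"
definition CLOSE_DIFF :: nat where "CLOSE_DIFF = 10"
definition VOLATILE_ROW :: nat where "VOLATILE_ROW = 11"
definition VOLATILE_ROWS :: nat where "VOLATILE_ROWS = 12"
definition VOLATILE :: nat where "VOLATILE = 13"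
definition ENTANGLED :: nat where "ENTANGLED = 14"
definition COMPATIBLE :: nat where "COMPATIBLE = 15"
definition MEMBER :: nat where "MEMBER = 16"
definition TWINS :: nat where "TWINS = 17"
definition VOLATILE_FILTER :: nat where "VOLATILE_FILTER = 18"
definition AGREE_SOME :: nat where "AGREE_SOME = 19"
definition REPS :: nat where "REPS = 20"
definition SEARCH :: nat where "SEARCH = 21"
definition TAME :: nat where "TAME = 22"
definition TAME_SEARCH :: nat where "TAME_SEARCH = 23"
definition CONSN :: nat where "CONSN = 24"
definition MERGE_ADJACENT :: nat where "MERGE_ADJACENT = 25"
definition MERGE_ADJACENT_TEST :: nat where "MERGE_ADJACENT_TEST = 26"
definition ABSORB :: nat where "ABSORB = 27"
definition MERGE_PARTS :: nat where "MERGE_PARTS = 28"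
definition MERGE_PARTS_TEST :: nat where "MERGE_PARTS_TEST = 29"
definition PAIR_UP :: nat where "PAIR_UP = 30"
definition EMIT :: nat where "EMIT = 31"
definition SINGLES :: nat where "SINGLES = 32"
definition LOOP :: nat where "LOOP = 33"
definition LOOP_ROWS :: nat where "LOOP_ROWS = 34"
definition LOOP_COLS :: nat where "LOOP_COLS = 35"
definition LOOP_DIV_ROWS :: nat where "LOOP_DIV_ROWS = 36"
definition LOOP_DIV_COLS :: nat where "LOOP_DIV_COLS = 37"

lemmas index_defs =
  MAIN_def APPEND_def MUL_def LEQ_def EQ_def NTH_def ENTRY_def AGREE_def AGREE_ALL_def
  DIFFS_def CLOSE_DIFF_def VOLATILE_ROW_def VOLATILE_ROWS_def VOLATILE_def ENTANGLED_def
  COMPATIBLE_def MEMBER_def TWINS_def VOLATILE_FILTER_def AGREE_SOME_def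
  REPS_def SEARCH_def TAME_def TAME_SEARCH_def CONSN_def MERGE_ADJACENT_def
  MERGE_ADJACENT_TEST_def ABSORB_def MERGE_PARTS_def MERGE_PARTS_TEST_def PAIR_UP_def
  EMIT_def SINGLES_def LOOP_def LOOP_ROWS_def LOOP_COLS_def LOOP_DIV_ROWS_def
  LOOP_DIV_COLS_def

abbreviation (input) Yes :: expr where "Yes \<equiv> Join Empty Empty"

definition append_body :: expr where
  "append_body = Cond (Var 0)
     (Join (First (Var 0)) (Call APPEND [Rest (Var 0), Var 1]))
     (Var 1)"

definition mul_body :: expr where
  "mul_body = Cond (Var 0)
     (Call APPEND [Var 1, Call MUL [Rest (Var 0), Var 1]])
     Empty"

definition leq_body :: expr where
  "leq_body = Cond (Var 0)
     (Cond (Var 1) (Call LEQ [Rest (Var 0), Rest (Var 1)]) Empty)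
     Yes"

definition eq_body :: expr where
  "eq_body = Cond (Var 0)
     (Cond (Var 1) (Call EQ [Rest (Var 0), Rest (Var 1)]) Empty)
     (Cond (Var 1) Empty Yes)"

definition nth_body :: expr where
  "nth_body = Cond (Var 1) (Call NTH [Rest (Var 0), Rest (Var 1)]) (First (Var 0))"

definition entry_body :: expr where
  "entry_body = Cond (Var 0)
     (Call NTH [Call NTH [Var 1, Var 2], Var 3])
     (Call NTH [Call NTH [Var 1, Var 3], Var 2])"

definition agree_body :: expr where
  "agree_body = Cond (Var 4)
     (Cond (Call EQ [Call ENTRY [Var 0, Var 1, Var 2, First (Var 4)],
                     Call ENTRY [Var 0, Var 1, Var 3, First (Var 4)]])
       (Call AGREE [Var 0, Var 1, Var 2, Var 3, Rest (Var 4)])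
       Empty)
     Yes"

definition agree_all_body :: expr where
  "agree_all_body = Cond (Var 4)
     (Cond (Call AGREE [Var 0, Var 1, Var 2, Var 3, First (Var 4)])
       (Call AGREE_ALL [Var 0, Var 1, Var 2, Var 3, Rest (Var 4)])
       Empty)
     Yes"

definition diffs_body :: expr where
  "diffs_body = Cond (Var 4)
     (Cond (Call AGREE [Var 0, Var 1, Var 2, Var 3, First (Var 4)])
       (Call DIFFS [Var 0, Var 1, Var 2, Var 3, Rest (Var 4)])
       (Join (First (Var 4)) (Call DIFFS [Var 0, Var 1, Var 2, Var 3, Rest (Var 4)])))
     Empty"

definition close_diff_body :: expr where
  "close_diff_body = Cond (Call LEQ [Call DIFFS [Var 0, Var 1, Var 3, Var 4, Var 5], Var 2])
     (Cond (Call AGREE [Var 0, Var 1, Var 3, Var 4, Var 6]) Empty Yes)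
     Empty"

definition volatile_row_body :: expr where
  "volatile_row_body = Cond (Var 4)
     (Cond (Call CLOSE_DIFF [Var 0, Var 1, Var 2, Var 3, First (Var 4), Var 5, Var 6])
       Yes
       (Call VOLATILE_ROW [Var 0, Var 1, Var 2, Var 3, Rest (Var 4), Var 5, Var 6]))
     Empty"

definition volatile_rows_body :: expr where
  "volatile_rows_body = Cond (Var 3)
     (Cond (Call VOLATILE_ROW [Var 0, Var 1, Var 2, First (Var 3), Var 4, Var 5, Var 6])
       Yes
       (Call VOLATILE_ROWS [Var 0, Var 1, Var 2, Rest (Var 3), Var 4, Var 5, Var 6]))
     Empty"

definition volatile_body :: expr where
  "volatile_body = Cond (Rest (Var 4))
     (Call VOLATILE_ROWS [Var 0, Var 1, Var 2, Var 3, Var 3, Var 4, Var 5])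
     Yes"

definition entangled_body :: expr where
  "entangled_body = Cond (Call VOLATILE [Var 0, Var 1, Var 2, Var 5, Var 4, Var 6])
     (Call VOLATILE [Cond (Var 0) Empty Yes, Var 1, Var 2, Var 6, Var 3, Var 5])
     Empty"

definition compatible_body :: expr where
  "compatible_body = Cond (Var 8)
     (Cond (Cond (Call ENTANGLED [Var 0, Var 1, Var 2, Var 3, Var 4, Var 5, First (Var 8)])
              Yes
              (Call AGREE [Var 0, Var 1, Var 6, Var 7, First (Var 8)]))
       (Call COMPATIBLE [Var 0, Var 1, Var 2, Var 3, Var 4, Var 5, Var 6, Var 7, Rest (Var 8)])
       Empty)
     Yes"

definition member_body :: expr where
  "member_body = Cond (Var 1)
     (Cond (Call EQ [Var 0, First (Var 1)]) Yes (Call MEMBER [Var 0, Rest (Var 1)]))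
     Empty"

definition twins_body :: expr where
  "twins_body = Cond (Var 7)
     (Cond (Cond (Call MEMBER [Var 5, First (Var 7)])
              (Cond (Call MEMBER [Var 6, First (Var 7)])
                (Call COMPATIBLE
                  [Var 0, Var 1, Var 2, Var 3, Var 4, First (Var 7), Var 5, Var 6, Var 4])
                Empty)
              Empty)
       Yes
       (Call TWINS [Var 0, Var 1, Var 2, Var 3, Var 4, Var 5, Var 6, Rest (Var 7)]))
     Empty"

definition volatile_filter_body :: expr where
  "volatile_filter_body = Cond (Var 6)
     (Cond (Cond (Call VOLATILE [Var 0, Var 1, Var 2, Var 3, Var 4, First (Var 6)])
              (Var 5)
              (Cond (Var 5) Empty Yes))
       (Join (First (Var 6))
         (Call VOLATILE_FILTER [Var 0, Var 1, Var 2, Var 3, Var 4, Var 5, Rest (Var 6)]))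
       (Call VOLATILE_FILTER [Var 0, Var 1, Var 2, Var 3, Var 4, Var 5, Rest (Var 6)]))
     Empty"

definition agree_some_body :: expr where
  "agree_some_body = Cond (Var 3)
     (Cond (Call AGREE_ALL [Var 0, Var 1, Var 2, First (Var 3), Var 4])
       Yes
       (Call AGREE_SOME [Var 0, Var 1, Var 2, Rest (Var 3), Var 4]))
     Empty"

definition reps_body :: expr where
  "reps_body = Cond (Var 2)
     (Cond (Call AGREE_SOME [Var 0, Var 1, First (Var 2), Rest (Var 2), Var 3])
       (Call REPS [Var 0, Var 1, Rest (Var 2), Var 3])
       (Join (First (Var 2)) (Call REPS [Var 0, Var 1, Rest (Var 2), Var 3])))
     Empty"

definition search_body :: expr where
  "search_body = Cond (Var 4)
     (Cond (Call SEARCH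
              [Var 0, Var 1, Var 2, Var 3, Rest (Var 4), Join (First (Var 4)) (Var 5), Var 6])
       Yes
       (Cond (Var 6)
         (Call SEARCH [Var 0, Var 1, Var 2, Var 3, Rest (Var 4), Var 5, Rest (Var 6)])
         Empty))
     (Call LEQ [Join Empty (Call REPS [Var 0, Var 1, Var 3, Var 5]), Var 2])"

definition tame_body :: expr where
  "tame_body = Call TAME_SEARCH [Var 0, Var 1, Var 2, Var 4,
     Call VOLATILE_FILTER [Var 0, Var 1, Var 2, Var 4, Var 3, Yes, Var 3],
     Call VOLATILE_FILTER [Var 0, Var 1, Var 2, Var 4, Var 3, Empty, Var 3],
     Join Empty (Var 2)]"

definition tame_search_body :: expr where
  "tame_search_body = Cond (Call LEQ [Var 4, Call MUL [Var 6, Call MUL [Var 6, Var 6]]])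
     (Call SEARCH [Var 0, Var 1, Var 2, Var 3, Var 4, Var 5, Var 2])
     Empty"

definition consn_body :: expr where
  "consn_body = Cond (Var 1) (Join (Var 0) (Var 1)) Empty"

definition merge_adjacent_body :: expr where
  "merge_adjacent_body = Cond (Rest (Var 4))
     (Call MERGE_ADJACENT_TEST [Var 0, Var 1, Var 2, Var 3, Var 4,
        Call APPEND [First (Var 4), First (Rest (Var 4))]])
     Empty"

definition merge_adjacent_test_body :: expr where
  "merge_adjacent_test_body = Cond (Call TAME [Var 0, Var 1, Var 2, Var 3, Var 5])
     (Join (Var 5) (Rest (Rest (Var 4))))
     (Call CONSN [First (Var 4),
        Call MERGE_ADJACENT [Var 0, Var 1, Var 2, Var 3, Rest (Var 4)]])"

definition absorb_body :: expr where
  "absorb_body = Cond (Var 6)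
     (Cond (Call TWINS
              [Var 0, Var 1, Var 2, Var 3, Var 4, First (Var 5), First (First (Var 6)), Var 3])
       (Join (Call APPEND [Var 5, First (Var 6)]) (Rest (Var 6)))
       (Call CONSN [First (Var 6),
          Call ABSORB [Var 0, Var 1, Var 2, Var 3, Var 4, Var 5, Rest (Var 6)]]))
     Empty"

definition merge_parts_body :: expr where
  "merge_parts_body = Cond (Var 5)
     (Call MERGE_PARTS_TEST [Var 0, Var 1, Var 2, Var 3, Var 4, Var 5,
        Call ABSORB [Var 0, Var 1, Var 2, Var 3, Var 4, First (Var 5), Rest (Var 5)]])
     Empty"

definition merge_parts_test_body :: expr where
  "merge_parts_test_body = Cond (Var 6) (Var 6)
     (Call CONSN [First (Var 5),
        Call MERGE_PARTS [Var 0, Var 1, Var 2, Var 3, Var 4, Rest (Var 5)]])"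

definition pair_up_body :: expr where
  "pair_up_body = Cond (Rest (Rest (Rest (Var 0))))
     (Join (Call APPEND [First (Var 0), First (Rest (Var 0))])
       (Call PAIR_UP [Rest (Rest (Var 0))]))
     (Join (Call APPEND [First (Var 0),
              Call APPEND [First (Rest (Var 0)), First (Rest (Rest (Var 0)))]])
       Empty)"

definition emit_body :: expr where
  "emit_body = Cond (First (Var 1))
     (Join (First (Var 1)) (Join (Var 0) (Rest (Var 1))))
     (Var 1)"

definition singles_body :: expr where
  "singles_body = Cond (Var 0)
     (Join (Join (Var 1) Empty) (Call SINGLES [Rest (Var 0), Join Empty (Var 1)]))
     Empty"

definition loop_body :: expr where
  "loop_body = Call LOOP_ROWS [Var 0, Var 1, Var 2, Var 3, Var 4, Var 5,
     Call MERGE_PARTS [Yes, Var 0, Var 1, Var 4, Var 5, Var 2]]"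

definition loop_rows_body :: expr where
  "loop_rows_body = Cond (Var 6)
     (Call EMIT [Join (Var 2) (Var 3), Call LOOP [Var 0, Var 1, Var 6, Var 3, Var 4, Var 5]])
     (Call LOOP_COLS [Var 0, Var 1, Var 2, Var 3, Var 4, Var 5,
        Call MERGE_PARTS [Empty, Var 0, Var 1, Var 5, Var 4, Var 3]])"

definition loop_cols_body :: expr where
  "loop_cols_body = Cond (Var 6)
     (Call EMIT [Join (Var 2) (Var 3), Call LOOP [Var 0, Var 1, Var 2, Var 6, Var 4, Var 5]])
     (Call LOOP_DIV_ROWS [Var 0, Var 1, Var 2, Var 3, Var 4, Var 5,
        Call MERGE_ADJACENT [Yes, Var 0, Var 1, Var 5, Var 4]])"

definition loop_div_rows_body :: expr where
  "loop_div_rows_body = Cond (Var 6)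
     (Call LOOP [Var 0, Var 1, Var 2, Var 3, Var 6, Var 5])
     (Call LOOP_DIV_COLS [Var 0, Var 1, Var 2, Var 3, Var 4, Var 5,
        Call MERGE_ADJACENT [Empty, Var 0, Var 1, Var 4, Var 5]])"

definition loop_div_cols_body :: expr where
  "loop_div_cols_body = Cond (Var 6)
     (Call LOOP [Var 0, Var 1, Var 2, Var 3, Var 4, Var 6])
     (Cond (Rest (Var 4))
       (Join Empty (Join (Call PAIR_UP [Var 4]) (Call PAIR_UP [Var 5])))
       (Join Yes (Join (Join (Var 2) (Var 3)) Empty)))"

definition six :: expr where
  "six = Join Empty (Join Empty (Join Empty (Join Empty (Join Empty (Join Empty Empty)))))"

definition main_body :: expr where
  "main_body = Call LOOP [Var 0, Call MUL [six, Call MUL [Var 1, Join Empty (Var 1)]],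
     Call SINGLES [Var 0, Empty], Call SINGLES [First (Var 0), Empty],
     Call SINGLES [Var 0, Empty], Call SINGLES [First (Var 0), Empty]]"

definition twin_prog :: program where
  "twin_prog =
    [main_body, append_body, mul_body, leq_body, eq_body, nth_body, entry_body, agree_body,
     agree_all_body, diffs_body, close_diff_body, volatile_row_body, volatile_rows_body,
     volatile_body, entangled_body, compatible_body, member_body, twins_body,
     volatile_filter_body, agree_some_body, reps_body, search_body, tame_body,
     tame_search_body, consn_body, merge_adjacent_body, merge_adjacent_test_body, absorb_body,
     merge_parts_body, merge_parts_test_body, pair_up_body, emit_body, singles_body, loop_body,
     loop_rows_body, loop_cols_body, loop_div_rows_body, loop_div_cols_body]"

text \<open>One rewrite rule then says that a function exists and what its body is.\<close>

definition body_of :: "nat \<Rightarrow> expr option" where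
  "body_of f = (if f < length twin_prog then Some (twin_prog ! f) else None)"

lemma body_of_simps:
  "body_of MAIN = Some main_body"
  "body_of APPEND = Some append_body"
  "body_of MUL = Some mul_body"
  "body_of LEQ = Some leq_body"
  "body_of EQ = Some eq_body"
  "body_of NTH = Some nth_body"
  "body_of ENTRY = Some entry_body"
  "body_of AGREE = Some agree_body"
  "body_of AGREE_ALL = Some agree_all_body"
  "body_of DIFFS = Some diffs_body"
  "body_of CLOSE_DIFF = Some close_diff_body"
  "body_of VOLATILE_ROW = Some volatile_row_body"
  "body_of VOLATILE_ROWS = Some volatile_rows_body"
  "body_of VOLATILE = Some volatile_body"
  "body_of ENTANGLED = Some entangled_body"
  "body_of COMPATIBLE = Some compatible_body"
  "body_of MEMBER = Some member_body"
  "body_of TWINS = Some twins_body"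
  "body_of VOLATILE_FILTER = Some volatile_filter_body"
  "body_of AGREE_SOME = Some agree_some_body"
  "body_of REPS = Some reps_body"
  "body_of SEARCH = Some search_body"
  "body_of TAME = Some tame_body"
  "body_of TAME_SEARCH = Some tame_search_body"
  "body_of CONSN = Some consn_body"
  "body_of MERGE_ADJACENT = Some merge_adjacent_body"
  "body_of MERGE_ADJACENT_TEST = Some merge_adjacent_test_body"
  "body_of ABSORB = Some absorb_body"
  "body_of MERGE_PARTS = Some merge_parts_body"
  "body_of MERGE_PARTS_TEST = Some merge_parts_test_body"
  "body_of PAIR_UP = Some pair_up_body"
  "body_of EMIT = Some emit_body"
  "body_of SINGLES = Some singles_body"
  "body_of LOOP = Some loop_body"
  "body_of LOOP_ROWS = Some loop_rows_body"
  "body_of LOOP_COLS = Some loop_cols_body"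
  "body_of LOOP_DIV_ROWS = Some loop_div_rows_body"
  "body_of LOOP_DIV_COLS = Some loop_div_cols_body"
  by (simp_all add: body_of_def twin_prog_def index_defs)

subsection \<open>Symbolic execution\<close>

text \<open>
  Weakest preconditions: \<open>Q\<close> holds for the value and the time. They can be computed by rewriting
  along the structure of an expression. A call is left in the form \<open>wp_fn\<close>, to which a previously
  proved fact about the called function (\<open>runs\<close>) is applied. So the proofs for the single
  functions are symbolic executions of their bodies.
\<close>

definition wp :: "sexp list \<Rightarrow> expr \<Rightarrow> (sexp \<Rightarrow> nat \<Rightarrow> bool) \<Rightarrow> bool" where
  "wp env e Q \<longleftrightarrow> (\<exists>v t. eval twin_prog env e v t \<and> Q v t)"

definition wps :: "sexp list \<Rightarrow> expr list \<Rightarrow> (sexp list \<Rightarrow> nat \<Rightarrow> bool) \<Rightarrow> bool" where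
  "wps env es Q \<longleftrightarrow> (\<exists>vs t. evals twin_prog env es vs t \<and> Q vs t)"

definition wp_fn :: "nat \<Rightarrow> sexp list \<Rightarrow> (sexp \<Rightarrow> nat \<Rightarrow> bool) \<Rightarrow> bool" where
  "wp_fn f vs Q \<longleftrightarrow> f < length twin_prog \<and> wp vs (twin_prog ! f) Q"

definition runs :: "nat \<Rightarrow> sexp list \<Rightarrow> sexp \<Rightarrow> nat \<Rightarrow> bool" where
  "runs f vs v b \<longleftrightarrow> wp_fn f vs (\<lambda>w t. w = v \<and> t \<le> b)"

inductive_cases evalE:
  "eval p env (Var i) v t" "eval p env Empty v t" "eval p env (Join a b) v t"
  "eval p env (First a) v t" "eval p env (Rest a) v t" "eval p env (Cond c a b) v t"
  "eval p env (Call f es) v t"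

inductive_cases evalsE: "evals p env [] vs t" "evals p env (e # es) vs t"

lemma wp_Cond:
  "wp env (Cond c a b) Q \<longleftrightarrow> wp env c (\<lambda>v t.
     if v = Null then wp env b (\<lambda>w s. Q w (t + s + 1)) else wp env a (\<lambda>w s. Q w (t + s + 1)))"
  (is "?l \<longleftrightarrow> ?r")
proof
  assume ?l
  then obtain v t where e: "eval twin_prog env (Cond c a b) v t" and Q: "Q v t" by (auto
    simp: wp_def)
  from e show ?r
  proof cases
    case (eval_Cond_then v1 t1 s)
    have "wp env a (\<lambda>w s. Q w (t1 + s + 1))"
      unfolding wp_def using eval_Cond_then Q by (intro exI[of _ v] exI[of _ s]) simp
    then show ?thesis
      unfolding wp_def[of env c] using eval_Cond_then by (intro exI[of _ v1] exI[of _ t1]) simp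
  next
    case (eval_Cond_else t1 s)
    have "wp env b (\<lambda>w s. Q w (t1 + s + 1))"
      unfolding wp_def using eval_Cond_else Q by (intro exI[of _ v] exI[of _ s]) simp
    then show ?thesis
      unfolding wp_def[of env c] using eval_Cond_else by (intro exI[of _ Null] exI[of _ t1]) simp
  qed
next
  assume ?r
  then obtain v t where c: "eval twin_prog env c v t"
    and br: "if v = Null then wp env b (\<lambda>w s. Q w (t + s + 1)) else wp env a (\<lambda>w s. Q w
      (t + s + 1))"
    by (auto simp: wp_def[of env c])
  show ?l
  proof (cases "v = Null")
    case True
    then obtain w s where "eval twin_prog env b w s" "Q w (t + s + 1)" using br by (auto
      simp: wp_def)
    then show ?thesis unfolding wp_def using eval_Cond_else c True by blast
  next
    case False
    then obtain w s where "eval twin_prog env a w s" "Q w (t + s + 1)" using br by (auto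
      simp: wp_def)
    then show ?thesis unfolding wp_def using eval_Cond_then c False by blast
  qed
qed

lemma wp_Call:
  "wp env (Call f es) Q \<longleftrightarrow> wps env es (\<lambda>vs t. wp_fn f vs (\<lambda>w s. Q w (t + s + 1)))"
  (is "?l \<longleftrightarrow> ?r")
proof
  assume ?l
  then obtain v t where e: "eval twin_prog env (Call f es) v t" and Q: "Q v t" by (auto
    simp: wp_def)
  from e show ?r
  proof cases
    case (eval_Call vs t1 s)
    have "wp_fn f vs (\<lambda>w s. Q w (t1 + s + 1))"
      unfolding wp_def wp_fn_def using eval_Call Q
        by (intro conjI exI[of _ v] exI[of _ s]) simp_all
    then show ?thesis
      unfolding wps_def using eval_Call by (intro exI[of _ vs] exI[of _ t1]) simp
  qed
next
  assume ?r
  then obtain vs t w s where "evals twin_prog env es vs t" "f < length twin_prog"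
      "eval twin_prog vs (twin_prog ! f) w s" "Q w (t + s + 1)"
    by (auto simp: wps_def wp_fn_def wp_def)
  then show ?l unfolding wp_def using eval_Call by blast
qed

lemma wp_simps:
  "wp env (Var i) Q \<longleftrightarrow> i < length env \<and> Q (env ! i) 1"
  "wp env Empty Q \<longleftrightarrow> Q Null 1"
  "wp env (Join a b) Q \<longleftrightarrow> wp env a (\<lambda>v t. wp env b (\<lambda>w s. Q (Cell v w) (t + s + 1)))"
  "wp env (First a) Q \<longleftrightarrow> wp env a (\<lambda>v t. Q (left v) (t + 1))"
  "wp env (Rest a) Q \<longleftrightarrow> wp env a (\<lambda>v t. Q (right v) (t + 1))"
  unfolding wp_def by (fastforce elim: evalE intro: eval_evals.intros)+

lemma wps_simps:
  "wps env [] Q \<longleftrightarrow> Q [] 0"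
  "wps env (e # es) Q \<longleftrightarrow> wp env e (\<lambda>v t. wps env es (\<lambda>vs s. Q (v # vs) (t + s)))"
  unfolding wp_def wps_def by (fastforce elim: evalsE intro: eval_evals.intros)+

lemma use_run:
  assumes "runs f vs v b" "\<And>s. s \<le> b \<Longrightarrow> Q v s"
  shows "wp_fn f vs Q"
  using assms unfolding runs_def wp_fn_def wp_def by blast

lemma runsI:
  assumes "case body_of f of Some e \<Rightarrow> wp vs e (\<lambda>w t. w = v \<and> t \<le> b) | None \<Rightarrow> False"
  shows "runs f vs v b"
  using assms by (simp add: runs_def wp_fn_def body_of_def split: if_splits)

lemma runs_mono: "runs f vs v b \<Longrightarrow> b \<le> b' \<Longrightarrow> runs f vs v b'"
  unfolding runs_def wp_fn_def wp_def by (meson le_trans)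

lemmas exec = wp_simps wp_Cond wp_Call wps_simps body_of_simps

definition enc_bool :: "bool \<Rightarrow> sexp" where
  "enc_bool b = (if b then Cell Null Null else Null)"

lemma enc_bool_simps [simp]:
  "enc_bool True = Cell Null Null" "enc_bool False = Null" "enc_bool b = Null \<longleftrightarrow> \<not> b"
  "Null = enc_bool b \<longleftrightarrow> \<not> b" "enc_bool b = enc_bool c \<longleftrightarrow> b = c"
  "enc_bool b = Cell Null Null \<longleftrightarrow> b" "Cell Null Null = enc_bool b \<longleftrightarrow> b"
  by (auto simp: enc_bool_def)

lemma enc_list_simps [simp]:
  "enc_list e [] = Null" "enc_list e (x # xs) = Cell (e x) (enc_list e xs)"
  "enc_list e xs = Null \<longleftrightarrow> xs = []"
  by (simp_all add: enc_list_def) (cases xs; simp)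

lemma enc_nat_Null [simp]: "enc_nat i = Null \<longleftrightarrow> i = 0"
  by (cases i) auto

lemma run_append:
  "runs APPEND [enc_list e xs, enc_list e ys] (enc_list e (xs @ ys)) (length xs * 20 + 20)"
proof (induction xs)
  case Nil
  show ?case by (rule runsI) (simp_all add: exec append_body_def)
next
  case (Cons x xs)
  show ?case by (rule runsI) (auto simp: exec append_body_def intro!: use_run[OF Cons])
qed

lemma run_append_nat:
  "runs APPEND [enc_nat i, enc_nat j] (enc_nat (i + j)) (i * 20 + 20)"
proof (induction i)
  case 0
  show ?case by (rule runsI) (simp_all add: exec append_body_def)
next
  case (Suc i)
  show ?case by (rule runsI) (auto simp: exec append_body_def intro!: use_run[OF Suc])
qed

lemma run_mul:
  "runs MUL [enc_nat i, enc_nat j] (enc_nat (i * j)) (i * (j * 20 + 40) + 20)"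
proof (induction i)
  case 0
  show ?case by (rule runsI) (simp_all add: exec mul_body_def)
next
  case (Suc i)
  show ?case
    by (rule runsI) (auto simp: exec mul_body_def
      intro!: use_run[OF Suc] use_run[OF run_append_nat])
qed

lemma run_leq:
  "runs LEQ [enc_list e xs, enc_nat j] (enc_bool (length xs \<le> j)) (length xs * 20 + 20)"
proof (induction xs arbitrary: j)
  case Nil
  show ?case by (rule runsI) (simp_all add: exec leq_body_def)
next
  case (Cons x xs)
  show ?case
    by (cases j; rule runsI) (auto simp: exec leq_body_def intro!: use_run[OF Cons])
qed

lemma run_eq:
  "runs EQ [enc_nat i, enc_nat j] (enc_bool (i = j)) (i * 20 + 20)"
proof (induction i arbitrary: j)
  case 0
  show ?case by (rule runsI) (simp_all add: exec eq_body_def)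
next
  case (Suc i)
  show ?case
    by (cases j; rule runsI) (auto simp: exec eq_body_def intro!: use_run[OF Suc])
qed

lemma run_nth:
  "i < length xs \<Longrightarrow> runs NTH [enc_list e xs, enc_nat i] (e (xs ! i)) (i * 20 + 20)"
proof (induction i arbitrary: xs)
  case 0
  then show ?case by (cases xs; intro runsI) (simp_all add: exec nth_body_def)
next
  case (Suc i)
  then obtain x ys where xs: "xs = x # ys" "i < length ys" by (cases xs) auto
  show ?case
    unfolding xs(1) by (rule runsI) (auto simp: exec nth_body_def
      intro!: use_run[OF Suc.IH] xs(2))
qed

subsection \<open>Comparing rows and recognising twins\<close>

text \<open>
  The number \<open>N\<close> bounds all sizes. As \<open>N \<ge> 1000\<close>, additional factors \<open>N\<close> absorb all constants, so
  every running time can be stated as a power of \<open>N\<close>, apart from one exponential factor \<open>K\<close>.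
\<close>

locale lisp_input =
  fixes n m a N :: nat and M :: "nat \<Rightarrow> nat \<Rightarrow> nat"
  assumes entries: "entries_below M n m a"
    and big: "n \<le> N" "m \<le> N" "a \<le> N" "1000 \<le> N"
begin

definition mat :: "bool \<Rightarrow> nat \<Rightarrow> nat \<Rightarrow> nat" where
  "mat f = (if f then M else flip M)"

definition rows :: "bool \<Rightarrow> nat" where
  "rows f = (if f then n else m)"

abbreviation "input \<equiv> enc_matrix n m M"

lemma rows_le: "rows f \<le> N"
  using big by (simp add: rows_def)

lemma pow_le: "i \<le> j \<Longrightarrow> N ^ i \<le> N ^ j"
  using big by (intro power_increasing) auto

text \<open>
  Bounds for the time of a sequence of calls and of a loop. The summands 500 and 100 are for the
  operations outside of the calls.
\<close>

lemma sum_le_K: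
  assumes "x \<le> K * N ^ k" "y \<le> K * N ^ k" "z \<le> K * N ^ k" "K \<ge> 1"
  shows "x + y + z + 500 \<le> K * N ^ Suc k"
proof -
  have "1 * 1 \<le> K * N ^ k" using big assms(4) by (intro mult_mono) auto
  then have "x + y + z + 500 \<le> 1000 * (K * N ^ k)" using assms by linarith
  also have "\<dots> \<le> N * (K * N ^ k)" using big(4) by (intro mult_right_mono) auto
  finally show ?thesis by (simp add: mult_ac)
qed

lemma loop_le_K:
  assumes "l \<le> N" "b \<le> 5 * (K * N ^ k)" "K \<ge> 1" "j = k + 2"
  shows "l * (b + 100) + 100 \<le> K * N ^ j"
proof -
  define X where "X = K * N ^ k"
  have "1 * 1 \<le> K * N ^ k" using big assms(3) by (intro mult_mono) auto
  then have 1: "1 \<le> X" by (simp add: X_def)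
  have "l * (b + 100) + 100 \<le> N * (105 * X) + 100 * X"
    using assms(1,2) 1 unfolding X_def[symmetric] by (intro add_mono mult_mono) auto
  also have "\<dots> \<le> N * (105 * X) + N * (100 * X)" using big(4) by simp
  also have "\<dots> = 205 * (N * X)" by simp
  also have "\<dots> \<le> N * (N * X)" using big(4) by (intro mult_right_mono) auto
  finally show ?thesis using assms(4) by (simp add: X_def mult_ac)
qed

lemma pow_le_K: "i \<le> j \<Longrightarrow> K \<ge> 1 \<Longrightarrow> N ^ i \<le> K * N ^ j"
  using mult_mono[of 1 K "N ^ i" "N ^ j"] pow_le[of i j] by simp

lemma run_entry:
  assumes "i < rows f" "j < rows (\<not> f)"
  shows "runs ENTRY [enc_bool f, input, enc_nat i, enc_nat j] (enc_nat (mat f i j)) (N ^ 2)"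
proof -
  have b: "N * 40 + 100 \<le> N ^ 2"
  proof -
    have "N * 40 + 100 \<le> N * 1000" using big(4) by simp
    also have "\<dots> \<le> N * N" using big(4) by (intro mult_left_mono) auto
    finally show ?thesis by (simp add: power2_eq_square)
  qed
  have ij: "i \<le> N" "j \<le> N" using assms rows_le[of f] rows_le[of "\<not> f"] by auto
  have "runs NTH [input, enc_nat x] (enc_list enc_nat (map (M x) [0..<m])) (x * 20 + 20)" if
    "x < n" for x
    using run_nth[of x "map (\<lambda>i. map (M i) [0..<m]) [0..<n]" "enc_list enc_nat"] that
    by (simp add: enc_matrix_def)
  moreover have "runs NTH [enc_list enc_nat (map (M x) [0..<m]), enc_nat y] (enc_nat (M x y))
    (y * 20 + 20)"
    if "y < m" for x y
    using run_nth[of y "map (M x) [0..<m]" enc_nat] that by simp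
  ultimately show ?thesis
    using assms b ij by (cases f; intro runsI)
      (auto simp: exec entry_body_def mat_def rows_def flip_def intro!: use_run)
qed

lemma mat_less: "i < rows f \<Longrightarrow> j < rows (\<not> f) \<Longrightarrow> mat f i j < N"
  using entries big(3) by (cases f) (fastforce simp: mat_def rows_def entries_below_def flip_def)+

lemma run_agree_loop:
  assumes "r < rows f" "s < rows f" "set T \<subseteq> {..<rows (\<not> f)}"
  shows "runs AGREE [enc_bool f, input, enc_nat r, enc_nat s, enc_list enc_nat T]
    (enc_bool (agree (mat f) r s (set T))) (length T * ((2 * N ^ 2 + N * 20) + 100) + 100)"
  using assms(3)
proof (induction T)
  case Nil
  show ?case by (rule runsI) (simp_all add: exec agree_body_def agree_def)
next
  case (Cons c T)
  have c: "c < rows (\<not> f)" using Cons.prems by simp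
  note * = mat_less[OF assms(1) c]
  show ?case
    using Cons.prems assms * by (intro runsI)
      (auto simp: exec agree_body_def agree_def
        intro!: use_run[OF Cons.IH] use_run[OF run_eq] use_run[OF run_entry])
qed

definition fits :: "bool \<Rightarrow> nat list \<Rightarrow> bool" where
  "fits f S \<longleftrightarrow> set S \<subseteq> {..<rows f} \<and> length S \<le> N"

definition fits_all :: "bool \<Rightarrow> parts \<Rightarrow> bool" where
  "fits_all f Ds \<longleftrightarrow> length Ds \<le> N \<and> (\<forall>S\<in>set Ds. fits f S)"

abbreviation enc_set :: "nat list \<Rightarrow> sexp" where "enc_set \<equiv> enc_list enc_nat"
abbreviation enc_parts :: "parts \<Rightarrow> sexp" where "enc_parts \<equiv> enc_list (enc_list enc_nat)"

lemma fits_all_Cons [simp]: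
  "fits_all f (S # Ds) \<longleftrightarrow> fits f S \<and> fits_all f Ds \<and> length Ds < N"
  by (auto simp: fits_all_def)

lemma fits_subset: "fits_all f Ds \<Longrightarrow> S \<in> set Ds \<Longrightarrow> fits f S"
  by (simp add: fits_all_def)

lemma loop_le: "l \<le> N \<Longrightarrow> b \<le> 5 * N ^ k \<Longrightarrow> k + 2 = j \<Longrightarrow> l * (b + 100) + 100 \<le> N ^ j"
  using loop_le_K[of l b 1 k j] by simp

lemma sum_le:
  "x \<le> N ^ k \<Longrightarrow> y \<le> N ^ k \<Longrightarrow> z \<le> N ^ k \<Longrightarrow> j = Suc k \<Longrightarrow> x + y + z + 500 \<le> N ^ j"
  using sum_le_K[of x 1 k y z] by simp

lemma N_le: "j \<ge> 1 \<Longrightarrow> N \<le> N ^ j"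
  using pow_le[of 1 j] by simp

lemma N_le2: "j \<ge> 2 \<Longrightarrow> N * 20 + 100 \<le> N ^ j"
proof -
  assume "j \<ge> 2"
  have "N * 20 + 100 \<le> N * 1000" using big(4) by simp
  also have "\<dots> \<le> N ^ 2" unfolding power2_eq_square using big(4) by (intro mult_left_mono) auto
  also have "\<dots> \<le> N ^ j" using \<open>j \<ge> 2\<close> by (rule pow_le)
  finally show ?thesis .
qed

lemma run_agree:
  assumes "r < rows f" "s < rows f" "fits (\<not> f) T"
  shows "runs AGREE [enc_bool f, input, enc_nat r, enc_nat s, enc_set T]
    (enc_bool (agree (mat f) r s (set T))) (N ^ 4)"
proof (rule runs_mono[OF run_agree_loop])
  show "length T * (2 * N\<^sup>2 + N * 20 + 100) + 100 \<le> N ^ 4"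
    using assms(3) N_le2[of 2] by (intro loop_le[where k = 2]) (auto simp: fits_def)
qed (use assms in \<open>auto simp: fits_def\<close>)

lemma run_agree_all:
  assumes "r < rows f" "s < rows f" "fits_all (\<not> f) Z"
  shows "runs AGREE_ALL [enc_bool f, input, enc_nat r, enc_nat s, enc_parts Z]
    (enc_bool (agree (mat f) r s (\<Union>(family Z)))) (N ^ 6)"
    (is "runs ?f ?vs ?v _")
proof -
  have "runs ?f ?vs ?v (length Z * (N ^ 4 + 100) + 100)"
    using assms(3)
  proof (induction Z)
    case Nil
    show ?case by (rule runsI) (simp_all add: exec agree_all_body_def agree_def)
  next
    case (Cons T Z)
    have *: "agree X r s (\<Union>(family (T # Z))) \<longleftrightarrow> agree X r s (set T) \<and> agree X r s (\<Union>(family Z))"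
      for X :: "nat \<Rightarrow> nat \<Rightarrow> nat" by (auto simp: agree_def)
    show ?case unfolding *
      using Cons.prems assms(1,2) by (intro runsI)
        (auto simp: exec agree_all_body_def intro!: use_run[OF Cons.IH] use_run[OF run_agree])
  qed
  then show ?thesis
    by (rule runs_mono) (use assms(3) in \<open>intro loop_le[where k = 4], auto simp: fits_all_def\<close>)
qed

lemma run_diffs:
  assumes "r < rows f" "s < rows f" "fits_all (\<not> f) E"
  shows "runs DIFFS [enc_bool f, input, enc_nat r, enc_nat s, enc_parts E]
    (enc_parts (filter (\<lambda>T. \<not> agree (mat f) r s (set T)) E)) (N ^ 6)"
    (is "runs ?f ?vs ?v _")
proof -
  have "runs ?f ?vs ?v (length E * (N ^ 4 + 100) + 100)"
    using assms(3)
  proof (induction E)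
    case Nil
    show ?case by (rule runsI) (simp_all add: exec diffs_body_def)
  next
    case (Cons T E)
    show ?case
      using Cons.prems assms(1,2) by (intro runsI)
        (auto simp: exec diffs_body_def intro!: use_run[OF Cons.IH] use_run[OF run_agree])
  qed
  then show ?thesis
    by (rule runs_mono) (use assms(3) in \<open>intro loop_le[where k = 4], auto simp: fits_all_def\<close>)
qed

lemma card_family_filter:
  assumes "distinct (map set E)"
  shows "card {T \<in> family E. h T} = length (filter (\<lambda>T. h (set T)) E)"
proof -
  have "{T \<in> family E. h T} = set (map set (filter (\<lambda>T. h (set T)) E))"
    by (auto simp: family_def)
  moreover have "distinct (map set (filter (\<lambda>T. h (set T)) E))"
    using assms by (simp add: distinct_map_filter)
  ultimately show ?thesis by (metis distinct_card length_map)
qed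

lemma run_close_diff:
  assumes "r < rows f" "s < rows f" "fits_all (\<not> f) E" "fits (\<not> f) T" "distinct (map set E)"
  shows "runs CLOSE_DIFF [enc_bool f, input, enc_nat q, enc_nat r, enc_nat s, enc_parts E,
    enc_set T]
    (enc_bool (close (mat f) q (family E) r s \<and> \<not> agree (mat f) r s (set T))) (N ^ 7)"
proof -
  have len: "length (filter (\<lambda>T. \<not> agree (mat f) r s (set T)) E) \<le> N"
    using assms(3) le_trans[OF length_filter_le] by (auto simp: fits_all_def)
  have b: "N ^ 6 + (N * 20 + 20) + N ^ 4 + 500 \<le> N ^ 7"
    using N_le2[of 6] pow_le[of 4 6] by (intro sum_le[where k = 6]) auto
  show ?thesis
    unfolding close_def card_family_filter[OF assms(5)]
    using assms len b by (intro runsI) (auto simp: exec close_diff_body_def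
        intro!: use_run[OF run_diffs] use_run[OF run_leq] use_run[OF run_agree])
qed

lemma run_volatile_row:
  assumes "r < rows f" "fits f S" "fits_all (\<not> f) E" "fits (\<not> f) T" "distinct (map set E)"
  shows "runs VOLATILE_ROW
    [enc_bool f, input, enc_nat q, enc_nat r, enc_set S, enc_parts E, enc_set T]
    (enc_bool (\<exists>s\<in>set S. close (mat f) q (family E) r s \<and> \<not> agree (mat f) r s (set T))) (N ^ 9)"
    (is "runs ?f ?vs ?v _")
proof -
  have "set S \<subseteq> {..<rows f}" using assms(2) by (simp add: fits_def)
  then have "runs ?f ?vs ?v (length S * (N ^ 7 + 100) + 100)"
  proof (induction S)
    case Nil
    show ?case by (rule runsI) (simp_all add: exec volatile_row_body_def)
  next
    case (Cons s S)
    show ?case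
      using Cons.prems assms by (intro runsI) (auto simp: exec volatile_row_body_def
          intro!: use_run[OF Cons.IH] use_run[OF run_close_diff])
  qed
  then show ?thesis
    by (rule runs_mono) (use assms(2) in \<open>intro loop_le[where k = 7], auto simp: fits_def\<close>)
qed

lemma run_volatile_rows:
  assumes "fits f R" "fits f S" "fits_all (\<not> f) E" "fits (\<not> f) T" "distinct (map set E)"
  shows "runs VOLATILE_ROWS
    [enc_bool f, input, enc_nat q, enc_set R, enc_set S, enc_parts E, enc_set T]
    (enc_bool (\<exists>r\<in>set R. \<exists>s\<in>set S. close (mat f) q (family E) r s \<and> \<not> agree (mat f) r s (set T)))
    (N ^ 11)"
    (is "runs ?f ?vs ?v _")
proof -
  have "set R \<subseteq> {..<rows f}" using assms(1) by (simp add: fits_def)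
  then have "runs ?f ?vs ?v (length R * (N ^ 9 + 100) + 100)"
  proof (induction R)
    case Nil
    show ?case by (rule runsI) (simp_all add: exec volatile_rows_body_def)
  next
    case (Cons r R)
    show ?case
      using Cons.prems assms by (intro runsI) (auto simp: exec volatile_rows_body_def
          intro!: use_run[OF Cons.IH] use_run[OF run_volatile_row])
  qed
  then show ?thesis
    by (rule runs_mono) (use assms(1) in \<open>intro loop_le[where k = 9], auto simp: fits_def\<close>)
qed

lemma run_volatile:
  assumes "fits f S" "fits_all (\<not> f) E" "T \<in> set E" "distinct (map set E)"
  shows "runs VOLATILE [enc_bool f, input, enc_nat q, enc_set S, enc_parts E, enc_set T]
    (enc_bool (set T \<in> volatile (mat f) q (family E) (set S))) (N ^ 12)"
proof -
  have T: "fits (\<not> f) T" using assms(2,3) by (rule fits_subset)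
  have b: "N ^ 11 + 0 + 0 + 500 \<le> N ^ 12" by (intro sum_le[where k = 11]) auto
  obtain U E' where E: "E = U # E'" using assms(3) by (cases E) auto
  have "card (family E) = length E" using card_family_filter[OF assms(4), of "\<lambda>_. True"] by simp
  then have "set T \<in> volatile (mat f) q (family E) (set S) \<longleftrightarrow> E' = [] \<or>
      (\<exists>r\<in>set S. \<exists>s\<in>set S. close (mat f) q (family E) r s \<and> \<not> agree (mat f) r s (set T))"
    using in_familyI[OF assms(3)] by (auto simp: volatile_def E)
  then show ?thesis
    using run_volatile_rows[OF assms(1,1,2) T assms(4), of q] b unfolding E
    by (intro runsI) (auto simp: exec volatile_body_def intro!: use_run)
qed

lemma mat_flip: "mat (\<not> f) = flip (mat f)"
  by (auto simp: mat_def)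

lemma run_entangled:
  assumes "fits_all f D" "fits_all (\<not> f) E" "S \<in> set D" "T \<in> set E"
    and "distinct (map set D)" "distinct (map set E)"
  shows "runs ENTANGLED
    [enc_bool f, input, enc_nat q, enc_parts D, enc_parts E, enc_set S, enc_set T]
    (enc_bool (entangled (mat f) q (family D) (family E) (set S) (set T))) (N ^ 13)"
proof -
  have S: "fits f S" and T: "fits (\<not> f) T" using assms fits_subset by blast+
  have b: "N ^ 12 + N ^ 12 + 0 + 500 \<le> N ^ 13" by (intro sum_le[where k = 12]) auto
  note r1 = run_volatile[OF S assms(2,4,6), of q]
  have r2: "runs VOLATILE [enc_bool (\<not> f), input, enc_nat q, enc_set T, enc_parts D, enc_set S]
      (enc_bool (set S \<in> volatile (flip (mat f)) q (family D) (set T))) (N ^ 12)"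
    using run_volatile[OF T _ assms(3,5), of q] assms(1) by (simp add: mat_flip)
  show ?thesis
    unfolding entangled_def mat_flip[symmetric] using b r1 r2[folded mat_flip]
    by (cases f; intro runsI) (auto simp: exec entangled_body_def intro!: use_run)
qed

end

subsection \<open>Testing tameness\<close>

fun reps :: "(nat \<Rightarrow> nat \<Rightarrow> nat) \<Rightarrow> nat set \<Rightarrow> nat list \<Rightarrow> nat list" where
  "reps M J [] = []"
| "reps M J (r # rs) = (if \<exists>s\<in>set rs. agree M r s J then reps M J rs else r # reps M J rs)"

lemma length_reps: "length (reps M J rs) = distinct_rows M (set rs) J"
proof (induction rs)
  case (Cons r rs)
  have "restrict (M r) J \<in> (\<lambda>r. restrict (M r) J) ` set rs \<longleftrightarrow> (\<exists>s\<in>set rs. agree M r s J)"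
    by (auto simp: image_iff restrict_eq_iff agree_def)
  then show ?case using Cons by (auto simp: distinct_rows_def insert_absorb card_insert_if)
qed (simp add: distinct_rows_def)

context lisp_input
begin

lemma run_compatible:
  assumes D: "fits_all f D" "fits_all (\<not> f) E" "S \<in> set D"
    "distinct (map set D)" "distinct (map set E)" and rs: "r < rows f" "s < rows f"
    and "set Ts \<subseteq> set E" "length Ts \<le> N"
  shows "runs COMPATIBLE [enc_bool f, input, enc_nat q, enc_parts D, enc_parts E, enc_set S,
      enc_nat r, enc_nat s, enc_parts Ts]
    (enc_bool (\<forall>T\<in>set Ts. \<not> entangled (mat f) q (family D) (family E) (set S) (set T) \<longrightarrow>
      agree (mat f) r s (set T))) (N ^ 15)"
    (is "runs ?f ?vs ?v _")
proof -
  have "runs ?f ?vs ?v (length Ts * ((N ^ 13 + N ^ 4) + 100) + 100)"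
    using assms(8)
  proof (induction Ts)
    case Nil
    show ?case by (rule runsI) (simp_all add: exec compatible_body_def)
  next
    case (Cons T Ts)
    have T: "T \<in> set E" "fits (\<not> f) T" using Cons.prems fits_subset[OF D(2)] by auto
    show ?case
      using Cons.prems D rs T by (intro runsI) (auto simp: exec compatible_body_def
          intro!: use_run[OF Cons.IH] use_run[OF run_entangled] use_run[OF run_agree])
  qed
  then show ?thesis
    by (rule runs_mono) (use assms(9) pow_le[of 4 13] in \<open>intro loop_le[where k = 13], auto\<close>)
qed

lemma run_member:
  assumes "length S \<le> N" "x < N"
  shows "runs MEMBER [enc_nat x, enc_set S] (enc_bool (x \<in> set S)) (N ^ 4)"
    (is "runs ?f ?vs ?v _")
proof -
  have "runs ?f ?vs ?v (length S * ((x * 20 + 20) + 100) + 100)"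
  proof (induction S)
    case Nil
    show ?case by (rule runsI) (simp_all add: exec member_body_def)
  next
    case (Cons y S)
    show ?case
      by (rule runsI) (auto simp: exec member_body_def
        intro!: use_run[OF Cons.IH] use_run[OF run_eq])
  qed
  then show ?thesis
    by (rule runs_mono) (use assms N_le2[of 2] in \<open>intro loop_le[where k = 2], auto\<close>)
qed

lemma run_twins_loop:
  assumes D: "fits_all f D" "fits_all (\<not> f) E" "distinct (map set D)" "distinct (map set E)"
    and rs: "r < rows f" "s < rows f" and "set Ds \<subseteq> set D"
  shows "runs TWINS [enc_bool f, input, enc_nat q, enc_parts D, enc_parts E, enc_nat r, enc_nat s,
    enc_parts Ds]
    (enc_bool (\<exists>S\<in>set Ds. r \<in> set S \<and> s \<in> set S \<and>
      (\<forall>T\<in>set E. \<not> entangled (mat f) q (family D) (family E) (set S) (set T) \<longrightarrow> agree (mat f) r s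
        (set T))))
    (length Ds * ((N ^ 4 + N ^ 4 + N ^ 15) + 100) + 100)"
  using assms(7)
proof (induction Ds)
  case Nil
  show ?case by (rule runsI) (simp_all add: exec twins_body_def)
next
  case (Cons S Ds)
  have S: "S \<in> set D" "length S \<le> N" using Cons.prems fits_subset[OF D(1)] by (auto
    simp: fits_def)
  have x: "r < N" "s < N" "length E \<le> N" using rs rows_le[of f] D(2) by (auto simp: fits_all_def)
  show ?case
    using Cons.prems D rs S x by (intro runsI) (auto simp: exec twins_body_def
        intro!: use_run[OF Cons.IH] use_run[OF run_member] use_run[OF run_compatible])
qed

lemma run_twins:
  assumes D: "fits_all f D" "fits_all (\<not> f) E" "distinct (map set D)" "distinct (map set E)"
    and rs: "r < rows f" "s < rows f"
  shows "runs TWINS [enc_bool f, input, enc_nat q, enc_parts D, enc_parts E, enc_nat r, enc_nat s,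
    enc_parts D]
    (enc_bool (twins (mat f) q (family D) (family E) r s)) (N ^ 17)"
proof -
  have "twins (mat f) q (family D) (family E) r s \<longleftrightarrow> (\<exists>S\<in>set D. r \<in> set S \<and> s \<in> set S \<and>
      (\<forall>T\<in>set E. \<not> entangled (mat f) q (family D) (family E) (set S) (set T) \<longrightarrow> agree (mat f) r s
        (set T)))"
    by (auto simp: twins_def family_def)
  moreover have "length D * ((N ^ 4 + N ^ 4 + N ^ 15) + 100) + 100 \<le> N ^ 17"
    using D(1) pow_le[of 4 15] by (intro loop_le[where k = 15]) (auto simp: fits_all_def)
  ultimately show ?thesis
    using runs_mono[OF run_twins_loop[OF assms subset_refl, of q]] by simp
qed

lemma run_volatile_filter:
  assumes "fits f S" "fits_all (\<not> f) E" "distinct (map set E)"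
  shows "runs VOLATILE_FILTER
    [enc_bool f, input, enc_nat q, enc_set S, enc_parts E, enc_bool b, enc_parts E]
    (enc_parts (volatile_filter b (mat f) q E S)) (N ^ 14)"
proof -
  let ?P = "\<lambda>T. (set T \<in> volatile (mat f) q (family E) (set S)) = b"
  have "runs VOLATILE_FILTER
    [enc_bool f, input, enc_nat q, enc_set S, enc_parts E, enc_bool b, enc_parts Es]
    (enc_parts (filter ?P Es)) (length Es * (N ^ 12 + 100) + 100)" if "set Es \<subseteq> set E" for Es
    using that
  proof (induction Es)
    case Nil
    show ?case by (rule runsI) (simp_all add: exec volatile_filter_body_def)
  next
    case (Cons T Es)
    then show ?case
      using run_volatile[OF assms(1,2) _ assms(3), of T q]
      by (cases b; intro runsI) (auto simp: exec volatile_filter_body_def intro!: use_run)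
  qed
  from this[OF subset_refl] show ?thesis
    unfolding volatile_filter_def
    by (rule runs_mono) (use assms(2) in \<open>intro loop_le[where k = 12], auto simp: fits_all_def\<close>)
qed

lemma run_agree_some:
  assumes "r < rows f" "set Rs \<subseteq> {..<rows f}" "length Rs \<le> N" "fits_all (\<not> f) Z"
  shows "runs AGREE_SOME [enc_bool f, input, enc_nat r, enc_set Rs, enc_parts Z]
    (enc_bool (\<exists>s\<in>set Rs. agree (mat f) r s (\<Union>(family Z)))) (N ^ 8)"
    (is "runs ?f ?vs ?v _")
proof -
  have "runs ?f ?vs ?v (length Rs * (N ^ 6 + 100) + 100)"
    using assms(2)
  proof (induction Rs)
    case Nil
    show ?case by (rule runsI) (simp_all add: exec agree_some_body_def)
  next
    case (Cons s Rs)
    then show ?case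
      using assms(1,4) by (intro runsI) (auto simp: exec agree_some_body_def
          intro!: use_run[OF Cons.IH] use_run[OF run_agree_all])
  qed
  then show ?thesis by (rule runs_mono) (use assms(3) in \<open>intro loop_le[where k = 6], auto\<close>)
qed

lemma run_reps:
  assumes "fits f Rs" "fits_all (\<not> f) Z"
  shows "runs REPS [enc_bool f, input, enc_set Rs, enc_parts Z]
    (enc_set (reps (mat f) (\<Union>(family Z)) Rs)) (N ^ 10)"
    (is "runs ?f ?vs ?v _")
proof -
  have "set Rs \<subseteq> {..<rows f}" "length Rs \<le> N" using assms(1) by (auto simp: fits_def)
  then have "runs ?f ?vs ?v (length Rs * (N ^ 8 + 100) + 100)"
  proof (induction Rs)
    case Nil
    show ?case by (rule runsI) (simp_all add: exec reps_body_def)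
  next
    case (Cons s Rs)
    then show ?case
      using assms(2) by (intro runsI) (auto simp: exec reps_body_def
          intro!: use_run[OF Cons.IH] use_run[OF run_agree_some])
  qed
  then show ?thesis
    by (rule runs_mono) (use assms(1) in \<open>intro loop_le[where k = 8], auto simp: fits_def\<close>)
qed

text \<open>
  The factor 3, rather than 2 for the two recursive calls, pays for the remaining operations.
\<close>

lemma run_search:
  assumes "fits f S" "fits_all (\<not> f) B" "fits_all (\<not> f) Z" "length B + length Z \<le> N"
  shows "runs SEARCH [enc_bool f, input, enc_nat q, enc_set S, enc_parts B, enc_parts Z,
    enc_nat b]
    (enc_bool (search (mat f) q S B Z b)) (3 ^ length B * N ^ 11)"
  using assms(2-4)
proof (induction B arbitrary: Z b)
  case Nil
  let ?r = "reps (mat f) (\<Union>(family Z)) S"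
  have "length ?r \<le> length S"
    unfolding length_reps distinct_rows_def
    by (rule le_trans[OF card_image_le[OF List.finite_set] card_length])
  then have len: "length ?r \<le> N" using assms(1) by (simp add: fits_def)
  have leq: "runs LEQ [Cell Null (enc_set ?r), enc_nat q] (enc_bool (length ?r < q))
    (40 + length ?r * 20)"
    using run_leq[of enc_nat "0 # ?r" q] by (simp add: Suc_le_eq)
  have b: "N ^ 10 + (N * 20 + 40) + 0 + 500 \<le> N ^ 11"
    using N_le2[of 10] by (intro sum_le[where k = 10]) auto
  show ?case
    using len b Nil.prems assms(1) leq unfolding search.simps length_reps[symmetric]
    by (intro runsI) (auto simp: exec search_body_def
      intro!: use_run[OF run_reps] use_run[OF leq])
next
  case (Cons T B)
  have pos: "1000 \<le> 3 ^ length B * N ^ 11"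
  proof -
    have "1000 * 1 \<le> N ^ 11 * 3 ^ length B"
      using big(4) N_le[of 11] by (intro mult_mono) auto
    then show ?thesis by (simp add: mult.commute)
  qed
  have "fits_all (\<not> f) (T # Z)" "length B + length (T # Z) \<le> N" "fits_all (\<not> f) B"
    using Cons.prems by auto
  note IH1 = Cons.IH[OF this(3,1,2), of b]
  have IH2: "runs SEARCH [enc_bool f, input, enc_nat q, enc_set S, enc_parts B, enc_parts Z,
    enc_nat c]
    (enc_bool (search (mat f) q S B Z c)) (3 ^ length B * N ^ 11)" for c
    using Cons.prems by (intro Cons.IH) auto
  show ?case
    using pos IH1 IH2[of "b - 1"] by (cases b; intro runsI)
      (auto simp: exec search_body_def intro!: use_run)
qed

lemma run_tame:
  assumes "fits f S" "fits_all (\<not> f) E" "distinct (map set E)" and q: "(q + 1) ^ 3 \<le> N"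
  shows "runs TAME [enc_bool f, input, enc_nat q, enc_parts E, enc_set S]
    (enc_bool (tame_test (mat f) q E S)) (3 ^ ((q + 1) ^ 3) * N ^ 15)"
proof -
  let ?B = "volatile_filter True (mat f) q E S" and ?Z = "volatile_filter False (mat f) q E S"
  define K where "K = (3 :: nat) ^ ((q + 1) ^ 3)"
  have K: "K \<ge> 1" by (simp add: K_def)
  have BZ: "fits_all (\<not> f) ?B" "fits_all (\<not> f) ?Z"
    using assms(2) le_trans[OF length_filter_le]
    by (auto simp: fits_all_def volatile_filter_def)
  have len: "length ?B + length ?Z \<le> N"
    using assms(2) sum_length_filter_compl[of
      "\<lambda>T. set T \<in> volatile (mat f) q (family E) (set S)" E]
    by (simp add: fits_all_def volatile_filter_def)
  have qN: "Suc q \<le> N" "Suc q * Suc q \<le> N"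
  proof -
    have "(q + 1) ^ 1 \<le> (q + 1) ^ 3" "(q + 1) ^ 2 \<le> (q + 1) ^ 3"
      by (intro power_increasing; simp)+
    then show "Suc q \<le> N" "Suc q * Suc q \<le> N" using q by (simp_all add: power2_eq_square)
  qed
  have gen: "x * 20 + y * 40 + 20 \<le> N * 60 + 20" if "x \<le> N" "y \<le> N" for x y
    using that by simp
  have m1: "runs MUL [Cell Null (enc_nat q), Cell Null (enc_nat q)] (enc_nat (Suc q * Suc q))
    (N * 60 + 20)"
  proof (rule runs_mono)
    show "runs MUL [Cell Null (enc_nat q), Cell Null (enc_nat q)] (enc_nat (Suc q * Suc q))
        (Suc q * (Suc q * 20 + 40) + 20)" using run_mul[of "Suc q" "Suc q"] by simp
    have "Suc q * (Suc q * 20 + 40) + 20 = (Suc q * Suc q) * 20 + Suc q * 40 + 20" by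
      (simp add: algebra_simps)
    also have "\<dots> \<le> N * 60 + 20" by (rule gen[OF qN(2,1)])
    finally show "Suc q * (Suc q * 20 + 40) + 20 \<le> N * 60 + 20" .
  qed
  have m2: "runs MUL [Cell Null (enc_nat q), enc_nat (Suc q * Suc q)] (enc_nat ((q + 1) ^ 3))
    (N * 60 + 20)"
  proof (rule runs_mono)
    have "Suc q * (Suc q * Suc q) = (q + 1) ^ 3" by (simp add: power3_eq_cube)
    then show "runs MUL [Cell Null (enc_nat q), enc_nat (Suc q * Suc q)] (enc_nat ((q + 1) ^ 3))
        (Suc q * (Suc q * Suc q * 20 + 40) + 20)"
      using run_mul[of "Suc q" "Suc q * Suc q"] by (simp only: enc_nat.simps)
    have "Suc q * (Suc q * Suc q * 20 + 40) + 20 = (q + 1) ^ 3 * 20 + Suc q * 40 + 20"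
      by (simp add: power3_eq_cube algebra_simps)
    also have "\<dots> \<le> N * 60 + 20" by (rule gen[OF q qN(1)])
    finally show "Suc q * (Suc q * Suc q * 20 + 40) + 20 \<le> N * 60 + 20" .
  qed
  have search: "runs SEARCH [enc_bool f, input, enc_nat q, enc_set S, enc_parts ?B, enc_parts ?Z,
    enc_nat q]
    (enc_bool (search (mat f) q S ?B ?Z q)) (K * N ^ 11)" if "length ?B \<le> (q + 1) ^ 3"
  proof (rule runs_mono[OF run_search[OF assms(1) BZ len]])
    have "(3 :: nat) ^ length ?B \<le> K" unfolding K_def using that by (intro power_increasing) auto
    then show "3 ^ length ?B * N ^ 11 \<le> K * N ^ 11" by simp
  qed
  have lenB: "length ?B \<le> N" using BZ(1) by (simp add: fits_all_def)
  have b1: "(N * 60 + 20) + (N * 60 + 20) + (N * 20 + 20 + K * N ^ 11) + 500 \<le> K * N ^ 13"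
  proof -
    have "N * 20 + 100 \<le> N ^ 2" by (rule N_le2) simp
    moreover have "5 * N ^ 2 \<le> N ^ 3"
      using big(4) mult_right_mono[of 5 N "N ^ 2"] by (simp add: power3_eq_cube power2_eq_square)
    ultimately have "N * 60 + 20 \<le> N ^ 3" "N * 20 + 20 \<le> N ^ 3" by linarith+
    then have "N * 60 + 20 \<le> K * N ^ 12" "N * 20 + 20 \<le> N ^ 3"
      using pow_le_K[of 3 12 K] K by linarith+
    moreover have "N * 20 + 20 + K * N ^ 11 + 0 + 500 \<le> K * N ^ Suc 11"
      using \<open>N * 20 + 20 \<le> N ^ 3\<close> pow_le_K[of 3 11 K] K by (intro sum_le_K) auto
    ultimately show ?thesis using sum_le_K[of "N * 60 + 20" K 12 "N * 60 + 20"
      "N * 20 + 20 + K * N ^ 11"] K by simp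
  qed
  have leq: "runs LEQ [enc_parts ?B, enc_nat ((q + 1) ^ 3)] (enc_bool (length ?B \<le> (q + 1) ^ 3))
    (N * 20 + 20)"
    by (rule runs_mono[OF run_leq]) (use lenB in simp)
  have ts: "runs TAME_SEARCH [enc_bool f, input, enc_nat q, enc_set S, enc_parts ?B, enc_parts ?Z,
    Cell Null (enc_nat q)]
      (enc_bool (tame_test (mat f) q E S)) (K * N ^ 13)"
  proof (cases "length ?B \<le> (q + 1) ^ 3")
    case True
    show ?thesis
      by (rule runsI) (use b1 True in \<open>auto simp: exec tame_search_body_def tame_test_def simp
        del: power_Suc mult_Suc
          intro!: use_run[OF m1] use_run[OF m2] use_run[OF leq] use_run[OF search]\<close>)
  next
    case False
    show ?thesis
      by (rule runsI) (use b1 False in \<open>auto simp: exec tame_search_body_def tame_test_def simp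
        del: power_Suc mult_Suc
          intro!: use_run[OF m1] use_run[OF m2] use_run[OF leq]\<close>)
  qed
  have b2: "N ^ 14 + N ^ 14 + K * N ^ 13 + 500 \<le> K * N ^ 15"
    using sum_le_K[of "N ^ 14" K 14 "N ^ 14"
      "K * N ^ 13"] pow_le_K[of 14 14 K] pow_le[of 13 14] K by simp
  note filter = run_volatile_filter[OF assms(1-3), of q]
  show ?thesis
    unfolding K_def[symmetric] using b2 filter[of True] filter[of False] ts
    by (intro runsI) (auto simp: exec tame_body_def intro!: use_run)
qed

end

subsection \<open>The main loop\<close>

lemma run_consn: "runs CONSN [e x, enc_list e ys] (enc_list e (consn x ys)) 20"
  by (rule runsI) (auto simp: exec consn_body_def consn_def)

lemma run_emit: "runs EMIT [enc_parts_pair P, enc_answer ans] (enc_answer (emit P ans)) 30"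
  by (cases ans; rule runsI) (auto simp: exec emit_body_def)

lemma run_singles:
  "runs SINGLES [enc_list e xs, enc_nat i]
    (enc_list (enc_list enc_nat) (map (\<lambda>j. [j]) [i..<i + length xs])) (length xs * 20 + 20)"
proof (induction xs arbitrary: i)
  case Nil
  show ?case by (rule runsI) (simp_all add: exec singles_body_def)
next
  case (Cons x xs)
  have "[i..<i + length (x # xs)] = i # [Suc i..<i + length (x # xs)]"
    by (rule upt_conv_Cons) simp
  then show ?case
    using Cons[of "Suc i"] by (intro runsI) (auto simp: exec singles_body_def intro!: use_run)
qed

lemma parts_list_nonempty:
  assumes "parts_list n Ps" "n \<ge> 1"
  shows "Ps \<noteq> []"
proof
  assume "Ps = []"
  moreover have "0 \<in> set (concat Ps)" using assms by (simp add: parts_list_def del: set_concat)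
  ultimately show False by simp
qed

context lisp_input
begin

lemma run_absorb:
  assumes D: "fits_all f D" "fits_all (\<not> f) E" "distinct (map set D)" "distinct (map set E)"
    and x: "x \<noteq> []" "fits f x" and ys: "fits_all f ys" "[] \<notin> set ys"
  shows "runs ABSORB
    [enc_bool f, input, enc_nat q, enc_parts D, enc_parts E, enc_set x, enc_parts ys]
    (enc_parts (absorb (twins (mat f) q (family D) (family E)) x ys)) (N ^ 19)"
    (is "runs ?f ?vs ?v _")
proof -
  let ?tw = "twins (mat f) q (family D) (family E)"
  obtain x0 xs where x0: "x = x0 # xs" "x0 < rows f" using x by (cases x) (auto simp: fits_def)
  have len: "length x \<le> N" using x(2) by (simp add: fits_def)
  have "runs ?f ?vs ?v (length ys * ((N ^ 17 + N * 20) + 100) + 100)"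
    using ys
  proof (induction ys)
    case Nil
    show ?case by (rule runsI) (simp_all add: exec absorb_body_def)
  next
    case (Cons y ys)
    then obtain y0 ys0 where y: "y = y0 # ys0" "y0 < rows f" by (cases y) (auto simp: fits_def)
    note tw = run_twins[OF D x0(2) y(2), of q]
    show ?case
    proof (cases "?tw x0 y0")
      case True
      show ?thesis
        using len Cons.prems True tw x0(1) y(1) run_append[of enc_nat x y]
        by (intro runsI) (auto simp: exec absorb_body_def intro!: use_run[OF tw] use_run)
    next
      case False
      have "runs CONSN [enc_set y, enc_parts (absorb ?tw x ys)] (enc_parts (consn y
        (absorb ?tw x ys))) 20"
        by (rule run_consn)
      then show ?thesis
        using Cons False tw x0(1) y(1)
        by (intro runsI) (auto simp: exec absorb_body_def intro!: use_run[OF tw] use_run)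
    qed
  qed
  then show ?thesis
    by (rule runs_mono) (use ys(1) N_le2[of 17] in \<open>intro loop_le[where k = 17], auto simp:
      fits_all_def\<close>)
qed

lemma run_merge_parts:
  assumes D: "fits_all f D" "fits_all (\<not> f) E" "distinct (map set D)" "distinct (map set E)"
    and P: "fits_all f P" "[] \<notin> set P"
  shows "runs MERGE_PARTS [enc_bool f, input, enc_nat q, enc_parts D, enc_parts E, enc_parts P]
    (enc_parts (merge_parts (twins (mat f) q (family D) (family E)) P)) (N ^ 21)"
    (is "runs ?f ?vs ?v _")
proof -
  let ?tw = "twins (mat f) q (family D) (family E)"
  have "runs ?f ?vs ?v (length P * (N ^ 19 + 100) + 100)"
    using P
  proof (induction P)
    case Nil
    show ?case by (rule runsI) (simp_all add: exec merge_parts_body_def)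
  next
    case (Cons x P)
    then have IH: "runs MERGE_PARTS [enc_bool f, input, enc_nat q, enc_parts D, enc_parts E,
      enc_parts P]
        (enc_parts (merge_parts ?tw P)) (length P * (N ^ 19 + 100) + 100)" by simp
    have ab: "runs ABSORB [enc_bool f, input, enc_nat q, enc_parts D, enc_parts E, enc_set x,
      enc_parts P]
        (enc_parts (absorb ?tw x P)) (N ^ 19)"
      using Cons.prems by (intro run_absorb D) auto
    have cons: "runs CONSN [enc_set x, enc_parts (merge_parts ?tw P)]
        (enc_parts (consn x (merge_parts ?tw P))) 20" by (rule run_consn)
    have "runs MERGE_PARTS_TEST [enc_bool f, input, enc_nat q, enc_parts D, enc_parts E,
          enc_parts (x # P), enc_parts (absorb ?tw x P)]
        (enc_parts (merge_parts ?tw (x # P))) (length P * (N ^ 19 + 100) + 150)"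
      using IH cons by (intro runsI) (auto simp: exec merge_parts_test_body_def intro!: use_run)
    then show ?case
      using ab by (intro runsI)
        (auto simp: exec merge_parts_body_def simp del: merge_parts.simps intro!: use_run)
  qed
  then show ?thesis
    by (rule runs_mono) (use P(1) in \<open>intro loop_le[where k = 19], auto simp: fits_all_def\<close>)
qed

lemma run_merge_adjacent:
  assumes D: "set (concat D) \<subseteq> {..<rows f}" "length (concat D) \<le> N" "length D \<le> N"
    and E: "fits_all (\<not> f) E" "distinct (map set E)" and q: "(q + 1) ^ 3 \<le> N"
  shows "runs MERGE_ADJACENT [enc_bool f, input, enc_nat q, enc_parts E, enc_parts D]
    (enc_parts (merge_adjacent (tame_test (mat f) q E) D)) (3 ^ ((q + 1) ^ 3) * N ^ 17)"
proof -
  define K where "K = (3 :: nat) ^ ((q + 1) ^ 3)"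
  define b where "b = K * N ^ 15 + N * 20"
  let ?t = "tame_test (mat f) q E"
  have step: "runs MERGE_ADJACENT [enc_bool f, input, enc_nat q, enc_parts E, enc_parts
    (x # y # zs)]
      (enc_parts (merge_adjacent ?t (x # y # zs))) (Suc l * (b + 100) + 100)"
    if IH: "runs MERGE_ADJACENT [enc_bool f, input, enc_nat q, enc_parts E, enc_parts (y # zs)]
        (enc_parts (merge_adjacent ?t (y # zs))) (l * (b + 100) + 100)"
      and xy: "set (x @ y) \<subseteq> {..<rows f}" "length (x @ y) \<le> N" for x y zs l
  proof -
    have "fits f (x @ y)" using xy by (simp add: fits_def)
    from run_tame[OF this E q] have
      tame: "runs TAME [enc_bool f, input, enc_nat q, enc_parts E, enc_set (x @ y)]
        (enc_bool (?t (x @ y))) (K * N ^ 15)" by (simp only: K_def)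
    have cons: "runs CONSN [enc_set x, enc_parts (merge_adjacent ?t (y # zs))]
        (enc_parts (consn x (merge_adjacent ?t (y # zs)))) 20" by (rule run_consn)
    have "runs MERGE_ADJACENT_TEST
        [enc_bool f, input, enc_nat q, enc_parts E, enc_parts (x # y # zs), enc_set (x @ y)]
        (enc_parts (merge_adjacent ?t (x # y # zs))) (K * N ^ 15 + l * (b + 100) + 160)"
      using IH cons tame by (intro runsI)
        (auto simp: exec merge_adjacent_test_body_def simp del: append.simps intro!: use_run)
    then show ?thesis
      using run_append[of enc_nat x y] xy(2) by (intro runsI)
        (auto simp: exec merge_adjacent_body_def b_def simp del: merge_adjacent.simps
          intro!: use_run)
  qed
  have "runs MERGE_ADJACENT [enc_bool f, input, enc_nat q, enc_parts E, enc_parts D]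
    (enc_parts (merge_adjacent ?t D)) (length D * (b + 100) + 100)"
    using D(1,2)
  proof (induction D rule: induct_list012)
    case 1
    show ?case by (rule runsI) (simp_all add: exec merge_adjacent_body_def)
  next
    case (2 x)
    show ?case by (rule runsI) (simp_all add: exec merge_adjacent_body_def)
  next
    case (3 x y zs)
    have "runs MERGE_ADJACENT [enc_bool f, input, enc_nat q, enc_parts E, enc_parts (y # zs)]
        (enc_parts (merge_adjacent ?t (y # zs))) (length (y # zs) * (b + 100) + 100)"
      using 3 by simp
    from step[OF this, of x] show ?case using 3(3,4) by simp
  qed
  then show ?thesis
    unfolding K_def[symmetric]
  proof (rule runs_mono)
    have K: "K \<ge> 1" by (simp add: K_def)
    have "N * 20 + 100 \<le> K * N ^ 15"
      using le_trans[OF N_le2[of 15] pow_le_K[of 15 15 K]] K by simp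
    then show "length D * (b + 100) + 100 \<le> K * N ^ 17"
      using D(3) K unfolding b_def by (intro loop_le_K[where k = 15]) auto
  qed
qed

lemma run_pair_up:
  assumes "length (concat D) \<le> N" "length D \<le> N"
  shows "runs PAIR_UP [enc_parts D] (enc_parts (pair_up D)) (N ^ 4)"
    (is "runs ?f ?vs ?v _")
proof -
  have last: "runs PAIR_UP [enc_parts D] (enc_parts [x @ y @ z])
      (N * 40 + 100)" if D: "right (right (right (enc_parts D))) = Null"
      "left (enc_parts D) = enc_set x" "left (right (enc_parts D)) = enc_set y"
      "left (right (right (enc_parts D))) = enc_set z" "length (x @ y @ z) \<le> N" for D x y z
    using D run_append[of enc_nat y z] run_append[of enc_nat x "y @ z"]
    by (intro runsI) (auto simp: exec pair_up_body_def intro!: use_run)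
  have "runs ?f ?vs ?v (length D * (N * 40 + 100) + (N * 40 + 100))"
    using assms(1)
  proof (induction D rule: pair_up.induct)
    case (1 x y z w zs)
    then have IH: "runs PAIR_UP [enc_parts (z # w # zs)] (enc_parts (pair_up (z # w # zs)))
        (length (z # w # zs) * (N * 40 + 100) + (N * 40 + 100))" by simp
    have len: "length x \<le> N" using 1(2) by simp
    show ?case
      using run_append[of enc_nat x y] IH len by (intro runsI)
        (auto simp: exec pair_up_body_def intro!: use_run)
  next
    case "2_1"
    show ?case using last[of "[]" "[]" "[]" "[]"] by simp
  next
    case ("2_2" x)
    then show ?case using runs_mono[OF last[of "[x]" x "[]" "[]"]] by simp
  next
    case ("2_3" x y)
    then show ?case using runs_mono[OF last[of "[x, y]" x y "[]"]] by simp
  next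
    case ("2_4" x y z)
    then show ?case using runs_mono[OF last[of "[x, y, z]" x y z]] by simp
  qed
  moreover have "length D * (N * 40 + 100) + (N * 40 + 100) \<le> N ^ 4"
  proof -
    have "N * 20 + 100 \<le> N ^ 2" by (rule N_le2) simp
    then have "length D * (N * 40 + 100) + (N * 40 + 100) \<le> N * (2 * N ^ 2) + 2 * N ^ 2"
      using assms(2) by (intro add_mono mult_mono) auto
    also have "\<dots> \<le> N * (2 * N ^ 2) + N * (2 * N ^ 2)" using big(4) by simp
    also have "\<dots> = 4 * (N * N ^ 2)" by simp
    also have "\<dots> \<le> N * (N * N ^ 2)" using big(4) by (intro mult_right_mono) auto
    finally show ?thesis by (simp add: power4_eq_xxxx power2_eq_square)
  qed
  ultimately show ?thesis by (rule runs_mono)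
qed

lemma parts_list_fits:
  assumes "parts_list (rows f) Ds"
  shows "fits_all f Ds" "distinct (map set Ds)" "[] \<notin> set Ds" "set (concat Ds) \<subseteq> {..<rows f}"
    "length (concat Ds) \<le> N" "length Ds \<le> N"
proof -
  show l: "length Ds \<le> N" using parts_list_length[OF assms] rows_le[of f] by simp
  show "fits_all f Ds"
    using l parts_list_elem[OF assms] rows_le[of f] unfolding fits_all_def fits_def
      by (meson le_trans)
  show "distinct (map set Ds)" using parts_list_partition(2)[OF assms] .
  show "[] \<notin> set Ds" "set (concat Ds) \<subseteq> {..<rows f}" using assms by (auto simp: parts_list_def)
  have "length (concat Ds) = card (set (concat Ds))"
    using assms distinct_card[of "concat Ds"] by (simp add: parts_list_def del: set_concat)
  also have "\<dots> = rows f" using assms by (simp add: parts_list_def del: set_concat)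
  finally show "length (concat Ds) \<le> N" using rows_le[of f] by simp
qed

text \<open>
  Every iteration merges parts or intervals on one side, or stops. In a state in which neither is
  possible, either both sides have several intervals, and their pairs form a rich division, or
  both sides have a single one, and the sequence has reached its end. There is no mixed case,
  because everything is tame against a single interval.
\<close>

lemma run_loop:
  assumes ok: "state_ok M q (twin_bound a q) n m PR PC DR DC"
    and q: "(q + 1) ^ 3 \<le> N" "q \<ge> 2" "3 * k \<le> q" and a: "a \<ge> 1" and nm: "n \<ge> 1" "m \<ge> 1"
    and T: "T = 3 ^ ((q + 1) ^ 3) * N ^ 22"
    and p: "p = 2 * twin_bound a q - 1" and e: "e = (q ^ 3 + q + 1) * (2 * twin_bound a q)"
  shows "\<exists>ans. good_answer M n m k p e PR PC ans \<and>
    runs LOOP [input, enc_nat q, enc_parts PR, enc_parts PC, enc_parts DR, enc_parts DC]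
      (enc_answer ans)
      ((length PR + length PC + length DR + length DC + 1) * T)"
  using ok
proof (induction "length PR + length PC + length DR + length DC" arbitrary: PR PC DR DC rule:
  less_induct)
  case less
  define l where "l = length PR + length PC + length DR + length DC"
  let ?good = "good_answer M n m k p e"
  let ?loop = "\<lambda>PR PC DR DC. [input, enc_nat q, enc_parts PR, enc_parts PC, enc_parts DR,
    enc_parts DC]"
  define L where "L = ?loop PR PC DR DC"
  note ok = less.prems
  have okf: "state_ok (flip M) q (twin_bound a q) m n PC PR DC DR" using ok by
    (simp add: state_ok_flip)
  note ent = entries
  have entf: "entries_below (flip M) m n a" using ent by (simp add: entries_below_flip)
  have pl: "parts_list n PR" "parts_list m PC" "parts_list n DR" "parts_list m DC"
    using ok division_parts_list by (auto simp: state_ok_def)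
  have plr: "parts_list (rows True) PR" "parts_list (rows False) PC"
    "parts_list (rows True) DR" "parts_list (rows False) DC"
    using pl by (simp_all add: rows_def)
  note fPR = parts_list_fits[OF plr(1)] and fPC = parts_list_fits[OF plr(2)]
    and fDR = parts_list_fits[OF plr(3)] and fDC = parts_list_fits[OF plr(4)]
  have bounded: "bounded_pair M n m p e (family PR, family PC)"
    unfolding p e by (rule state_bounded[OF ok])
  have IH: "\<exists>ans. ?good PR' PC' ans \<and> runs LOOP (?loop PR' PC' DR' DC') (enc_answer ans) (l * T)"
    if ok': "state_ok M q (twin_bound a q) n m PR' PC' DR' DC'"
      and len: "length PR' + length PC' + length DR' + length DC' + 1 = l" for PR' PC' DR' DC'
  proof -
    have "length PR' + length PC' + length DR' + length DC' < length PR + length PC + length DR +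
      length DC"
      using len by (simp add: l_def)
    from less.hyps[OF this ok'] show ?thesis unfolding len .
  qed
  define PR' where "PR' = merge_parts (twins M q (family DR) (family DC)) PR"
  define PC' where "PC' = merge_parts (twins (flip M) q (family DC) (family DR)) PC"
  define DR' where "DR' = merge_adjacent (tame_test M q DC) DR"
  define DC' where "DC' = merge_adjacent (tame_test (flip M) q DR) DC"
  define K where "K = (3 :: nat) ^ ((q + 1) ^ 3)"
  have r1: "runs MERGE_PARTS [Cell Null Null, input, enc_nat q, enc_parts DR, enc_parts DC,
    enc_parts PR]
      (enc_parts PR') (N ^ 21)"
    using run_merge_parts[of True DR DC PR q] fPR fDR fDC by (simp add: mat_def PR'_def)
  have r2: "runs MERGE_PARTS [Null, input, enc_nat q, enc_parts DC, enc_parts DR, enc_parts PC]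
      (enc_parts PC') (N ^ 21)"
    using run_merge_parts[of False DC DR PC q] fPC fDR fDC by (simp add: mat_def PC'_def)
  have r3: "runs MERGE_ADJACENT [Cell Null Null, input, enc_nat q, enc_parts DC, enc_parts DR]
      (enc_parts DR') (K * N ^ 17)"
    using run_merge_adjacent[of DR True DC q] fDR fDC q(1) by (simp add: mat_def DR'_def K_def)
  have r4: "runs MERGE_ADJACENT [Null, input, enc_nat q, enc_parts DR, enc_parts DC]
      (enc_parts DC') (K * N ^ 17)"
    using run_merge_adjacent[of DC False DR q] fDR fDC q(1) by (simp add: mat_def DC'_def K_def)
  have r5: "runs PAIR_UP [enc_parts DR] (enc_parts (pair_up DR)) (N ^ 4)"
      "runs PAIR_UP [enc_parts DC] (enc_parts (pair_up DC)) (N ^ 4)"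
    using run_pair_up fDR fDC by auto
  have time: "N ^ 21 + N ^ 21 + (K * N ^ 17 + K * N ^ 17) + N ^ 4 + N ^ 4 + 300 \<le> T"
  proof -
    have K: "K \<ge> 1" by (simp add: K_def)
    have N4: "N ^ 4 \<le> K * N ^ 17" by (rule pow_le_K[OF _ K]) simp
    have "4 * (K * N ^ 17) \<le> N * (K * N ^ 17)" using big(4) by (intro mult_right_mono) auto
    also have "\<dots> = K * N ^ 18" by (simp add: numeral_eq_Suc mult_ac)
    also have "\<dots> \<le> K * N ^ 21" using pow_le[of 18 21] by (intro mult_left_mono) auto
    finally have "K * N ^ 17 + K * N ^ 17 + N ^ 4 + N ^ 4 \<le> K * N ^ 21" using N4 by linarith
    then have "N ^ 21 + N ^ 21 + (K * N ^ 17 + K * N ^ 17 + N ^ 4 + N ^ 4) + 500 \<le> K * N ^ Suc 21"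
      using pow_le_K[of 21 21 K] K by (intro sum_le_K) auto
    then show ?thesis unfolding T K_def[symmetric] by simp
  qed
  have loop: "runs LOOP L v (b + N ^ 21 + 50)" if "runs LOOP_ROWS (L @ [enc_parts PR']) v b"
    for v b
    using that r1 by (intro runsI) (auto simp: exec loop_body_def L_def intro!: use_run)
  have rows: "runs LOOP L v (b + 2 * N ^ 21 + 100)"
    if "PR' = []" "runs LOOP_COLS (L @ [enc_parts PC']) v b" for v b
  proof -
    have "runs LOOP_ROWS (L @ [enc_parts PR']) v (b + N ^ 21 + 50)"
      using that r2 by (intro runsI) (auto simp: exec loop_rows_body_def L_def intro!: use_run)
    from loop[OF this] show ?thesis by (simp add: algebra_simps)
  qed
  have cols: "runs LOOP L v (b + 2 * N ^ 21 + K * N ^ 17 + 150)"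
    if "PR' = []" "PC' = []" "runs LOOP_DIV_ROWS (L @ [enc_parts DR']) v b" for v b
  proof -
    have "runs LOOP_COLS (L @ [enc_parts PC']) v (b + K * N ^ 17 + 50)"
      using that r3 by (intro runsI) (auto simp: exec loop_cols_body_def L_def intro!: use_run)
    from rows[OF that(1) this] show ?thesis by (simp add: algebra_simps)
  qed
  have div_rows: "runs LOOP L v (b + 2 * N ^ 21 + 2 * (K * N ^ 17) + 200)"
    if "PR' = []" "PC' = []" "DR' = []" "runs LOOP_DIV_COLS (L @ [enc_parts DC']) v b" for v b
  proof -
    have "runs LOOP_DIV_ROWS (L @ [enc_parts DR']) v (b + K * N ^ 17 + 50)"
      using that r4 by (intro runsI) (auto simp: exec loop_div_rows_body_def L_def
        intro!: use_run)
    from cols[OF that(1,2) this] show ?thesis by (simp add: algebra_simps)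
  qed
  have emit: "runs EMIT [Cell (enc_parts PR) (enc_parts PC), enc_answer ans] (enc_answer (emit
    (PR, PC) ans)) 30"
    for ans using run_emit[of "(PR, PC)" ans] by (simp add: enc_parts_pair_def)
  have finish: ?case if "?good PR PC ans" "runs LOOP L (enc_answer ans) b" "b \<le> l * T + T"
    for ans b
  proof -
    have eq: "l * T + T = (length PR + length PC + length DR + length DC + 1) * T" by
      (simp add: l_def)
    show ?thesis using that(1) runs_mono[OF that(2,3), unfolded eq] unfolding L_def by blast
  qed
  have ex: "merge_parts (twins M q (family DR) (family DC)) PR = []" if "PR' = []"
    using that by (simp add: PR'_def)
  have ex': "merge_parts (twins (flip M) q (family DC) (family DR)) PC = []" if "PC' = []"
    using that by (simp add: PC'_def)
  consider "PR' \<noteq> []" | "PR' = []" "PC' \<noteq> []" | "PR' = []" "PC' = []" "DR' \<noteq> []"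
    | "PR' = []" "PC' = []" "DR' = []" "DC' \<noteq> []" | "PR' = []" "PC' = []" "DR' = []" "DC' = []"
    by blast
  then show ?case
  proof cases
    case 1
    note st = merge_parts_step[OF ok PR'_def 1]
    obtain ans where ans: "?good PR' PC ans"
      "runs LOOP (?loop PR' PC DR DC) (enc_answer ans) (l * T)"
      using IH[OF st(1)] st(2) by (auto simp: l_def)
    have good: "?good PR PC (emit (PR, PC) ans)"
      using good_answer_emit[OF ans(1) _ bounded] st 1 by (simp add: contraction_step_def)
    have run: "runs LOOP_ROWS (L @ [enc_parts PR']) (enc_answer (emit (PR, PC) ans)) (l * T + 60)"
      using ans(2) emit[of ans] 1 by (intro runsI) (auto
        simp: exec loop_rows_body_def L_def intro!: use_run)
    show ?thesis by (rule finish[OF good loop[OF run]]) (use time in simp)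
  next
    case 2
    note st = merge_parts_step[OF okf PC'_def 2(2)]
    have "state_ok M q (twin_bound a q) n m PR PC' DR DC" using st(1) by (simp add: state_ok_flip)
    from IH[OF this] obtain ans where
        ans: "?good PR PC' ans" "runs LOOP (?loop PR PC' DR DC) (enc_answer ans) (l * T)"
      using st(2) by (auto simp: l_def)
    have "PR \<noteq> []" using parts_list_nonempty[OF pl(1) nm(1)] .
    then have good: "?good PR PC (emit (PR, PC) ans)"
      using good_answer_emit[OF ans(1) _ bounded] st by (simp add: contraction_step_def)
    have run: "runs LOOP_COLS (L @ [enc_parts PC']) (enc_answer (emit (PR, PC) ans)) (l * T + 60)"
      using ans(2) emit[of ans] 2 by (intro runsI) (auto
        simp: exec loop_cols_body_def L_def intro!: use_run)
    show ?thesis by (rule finish[OF good rows[OF 2(1) run]]) (use time in simp)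
  next
    case 3
    note st = merge_adjacent_step[OF ok ent a ex[OF 3(1)] DR'_def 3(3)]
    obtain ans where ans: "?good PR PC ans"
      "runs LOOP (?loop PR PC DR' DC) (enc_answer ans) (l * T)"
      using IH[OF st(1)] st(2) by (auto simp: l_def)
    have run: "runs LOOP_DIV_ROWS (L @ [enc_parts DR']) (enc_answer ans) (l * T + 30)"
      using ans(2) 3 by (intro runsI) (auto simp: exec loop_div_rows_body_def L_def
        intro!: use_run)
    show ?thesis by (rule finish[OF ans(1) cols[OF 3(1,2) run]]) (use time in simp)
  next
    case 4
    note st = merge_adjacent_step[OF okf entf a ex'[OF 4(2)] DC'_def 4(4)]
    have "state_ok M q (twin_bound a q) n m PR PC DR DC'" using st(1) by (simp add: state_ok_flip)
    from IH[OF this] obtain ans where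
        ans: "?good PR PC ans" "runs LOOP (?loop PR PC DR DC') (enc_answer ans) (l * T)"
      using st(2) by (auto simp: l_def)
    have run: "runs LOOP_DIV_COLS (L @ [enc_parts DC']) (enc_answer ans) (l * T + 30)"
      using ans(2) 4 by (intro runsI) (auto simp: exec loop_div_cols_body_def L_def
        intro!: use_run)
    show ?thesis by (rule finish[OF ans(1) div_rows[OF 4(1-3) run]]) (use time in simp)
  next
    case 5
    have exd: "merge_adjacent (tame_test M q DC) DR = []"
      "merge_adjacent (tame_test (flip M) q DR) DC = []"
      using 5 by (simp_all add: DR'_def DC'_def)
    have ne: "DR \<noteq> []" "DC \<noteq> []" using parts_list_nonempty pl(3,4) nm by blast+
    have single: "length DR \<le> 1 \<longleftrightarrow> length DC \<le> 1"
      using stuck_single[OF ok _ q(2) nm(1) exd(2)] stuck_single[OF okf _ q(2) nm(2)] exd(1) by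
        auto
    have "\<exists>ans. ?good PR PC ans \<and>
      runs LOOP_DIV_COLS (L @ [enc_parts DC']) (enc_answer ans) (N ^ 4 + N ^ 4 + 40)"
    proof (cases "length DR \<le> 1")
      case False
      then have len: "length DR \<ge> 2" "length DC \<ge> 2" using single by auto
      let ?ans = "Division (pair_up DR, pair_up DC)"
      have "?good PR PC ?ans"
        using stuck_rich_division[OF ok len q(3) exd] by (simp add: good_answer_def)
      moreover obtain x y zs where "DR = x # y # zs" using len(1) by (cases DR; cases
        "tl DR") auto
      then have "runs LOOP_DIV_COLS (L @ [enc_parts DC']) (enc_answer ?ans) (N ^ 4 + N ^ 4 + 40)"
        using r5 5 by (intro runsI)
          (auto simp: exec loop_div_cols_body_def enc_parts_pair_def L_def
            simp del: pair_up.simps intro!: use_run)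
      ultimately show ?thesis by blast
    next
      case True
      then have len: "length DR = 1" "length DC = 1" using single ne by (auto simp: le_Suc_eq)
      let ?ans = "Sequence [(PR, PC)]"
      have "?good PR PC ?ans"
        using finished_single[OF ok len nm(1) ex] finished_single[OF okf len(2,1) nm(2) ex'] 5
          bounded
        by (intro good_answer_final) auto
      moreover obtain x where "DR = [x]" using len(1) by (auto simp: length_Suc_conv)
      then have "runs LOOP_DIV_COLS (L @ [enc_parts DC']) (enc_answer ?ans) (N ^ 4 + N ^ 4 + 40)"
        using 5 by (intro runsI) (auto simp: exec loop_div_cols_body_def enc_parts_pair_def L_def)
      ultimately show ?thesis by blast
    qed
    then obtain ans where ans: "?good PR PC ans"
      "runs LOOP_DIV_COLS (L @ [enc_parts DC']) (enc_answer ans) (N ^ 4 + N ^ 4 + 40)" by blast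
    show ?thesis by (rule finish[OF ans(1) div_rows[OF 5(1-3) ans(2)]]) (use time in simp)
  qed
qed

lemma run_main:
  assumes q: "q = 6 * (k * (k + 1))" "(q + 1) ^ 3 \<le> N" and k: "k \<ge> 1" and a: "a \<ge> 1"
    and nm: "n \<ge> 1" "m \<ge> 1"
  shows "\<exists>ans. good_answer M n m (2 * k * (k + 1)) (2 * twin_bound a q - 1)
      ((q ^ 3 + q + 1) * (2 * twin_bound a q)) (map (\<lambda>i. [i]) [0..<n]) (map (\<lambda>i. [i])
        [0..<m]) ans \<and>
    runs MAIN [input, enc_nat k] (enc_answer ans) (3 ^ ((q + 1) ^ 3) * N ^ 24)"
proof -
  let ?R = "map (\<lambda>i. [i]) [0..<n]" and ?C = "map (\<lambda>i. [i]) [0..<m]"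
  define K where "K = (3 :: nat) ^ ((q + 1) ^ 3)"
  define T where "T = K * N ^ 22"
  define kk where "kk = k * (k + 1)"
  have "k * 1 \<le> k * (k + 1)" "1 * (1 + 1) \<le> k * (k + 1)" using k by (intro mult_mono; simp)+
  then have kk: "k \<le> kk" "2 \<le> kk" by (simp_all add: kk_def)
  have qk: "q = 6 * kk" using q(1) by (simp add: kk_def)
  have q2: "q \<ge> 2" using qk kk by linarith
  have q3: "3 * (2 * k * (k + 1)) \<le> q" using q(1) by (simp add: algebra_simps)
  have "(q + 1) ^ 1 \<le> (q + 1) ^ 3" by (intro power_increasing) auto
  then have qN: "q \<le> N" using q(2) by simp
  have "twin_bound a q \<ge> 1" using a q2 by (simp add: twin_bound_def)
  from run_loop[OF initial_state_ok[OF q2 this] q(2) q2 q3 a nm T_def[unfolded K_def] refl refl]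
  obtain ans where ans: "good_answer M n m (2 * k * (k + 1)) (2 * twin_bound a q - 1)
      ((q ^ 3 + q + 1) * (2 * twin_bound a q)) ?R ?C ans"
    and "runs LOOP [input, enc_nat q, enc_parts ?R, enc_parts ?C, enc_parts ?R, enc_parts ?C]
      (enc_answer ans)
      ((length ?R + length ?C + length ?R + length ?C + 1) * T)" by blast
  then have loop: "runs LOOP [input, enc_nat q, enc_parts ?R, enc_parts ?C, enc_parts ?R,
    enc_parts ?C]
      (enc_answer ans) ((n + m + n + m + 1) * T)" by simp
  have s1: "runs SINGLES [input, Null] (enc_parts ?R) (N * 20 + 20)"
    unfolding enc_matrix_def
    using run_singles[of "enc_list enc_nat" "map (\<lambda>i. map (M i) [0..<m]) [0..<n]" 0] big(1)
    by (auto elim!: runs_mono)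
  have left: "left input = enc_list enc_nat (map (M 0) [0..<m])"
    using nm(1) unfolding enc_matrix_def by (simp add: upt_rec[of 0 n])
  have s2: "runs SINGLES [left input, Null] (enc_parts ?C) (N * 20 + 20)"
    unfolding left using run_singles[of enc_nat "map (M 0) [0..<m]" 0] big(2)
    by (auto elim!: runs_mono)
  have m1: "runs MUL [enc_nat k, Cell Null (enc_nat k)] (enc_nat (k * (k + 1))) (N * 60 + 20)"
  proof (rule runs_mono)
    show "runs MUL [enc_nat k, Cell Null (enc_nat k)] (enc_nat (k * (k + 1))) (k *
      (Suc k * 20 + 40) + 20)"
      using run_mul[of k "Suc k"] by simp
    have "k * (Suc k * 20 + 40) + 20 = kk * 20 + k * 40 + 20" by (simp add: kk_def algebra_simps)
    also have "\<dots> \<le> N * 60 + 20" using kk qk qN by linarith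
    finally show "k * (Suc k * 20 + 40) + 20 \<le> N * 60 + 20" .
  qed
  have m2: "runs MUL [enc_nat 6, enc_nat (k * (k + 1))] (enc_nat q) (N * 20 + 300)"
  proof (rule runs_mono)
    show "runs MUL [enc_nat 6, enc_nat (k * (k + 1))] (enc_nat q) (6 * (k *
      (k + 1) * 20 + 40) + 20)"
      unfolding q(1) by (rule run_mul)
    show "6 * (k * (k + 1) * 20 + 40) + 20 \<le> N * 20 + 300"
      unfolding kk_def[symmetric] using qk qN by simp
  qed
  have six: "enc_nat 6 = Cell Null (Cell Null (Cell Null (Cell Null (Cell Null
    (Cell Null Null)))))"
    by (simp add: numeral_eq_Suc)
  have time: "(n + m + n + m + 1) * T + (N * 80 + 80) + (N * 60 + 20) + (N * 20 + 300) + 100 \<le>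
    K * N ^ 24"
  proof -
    have K: "K \<ge> 1" by (simp add: K_def)
    have "N \<le> N ^ 22" by (rule N_le) simp
    also have "\<dots> \<le> T" unfolding T_def using pow_le_K[of 22 22 K] K by simp
    finally have NT: "N \<le> T" .
    then have "(n + m + n + m + 1) * T + (N * 80 + 80) + (N * 60 + 20) + (N * 20 + 300) + 100
        \<le> (5 * N) * T + 700 * T"
      using big by (intro order_trans[OF _ add_mono[OF mult_right_mono[of "n + m + n + m + 1"
        "5 * N" T] order_refl]]) auto
    also have "\<dots> \<le> (5 * N) * T + N * T" using big(4) by simp
    also have "\<dots> = 6 * (N * T)" by simp
    also have "\<dots> \<le> N * (N * T)" using big(4) by (intro mult_right_mono) auto
    also have "\<dots> = K * N ^ 24" by (simp add: T_def numeral_eq_Suc mult_ac)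
    finally show ?thesis .
  qed
  have "runs MAIN [input, enc_nat k] (enc_answer ans) (K * N ^ 24)"
    using time loop s1 s2 m1 m2[unfolded six]
    by (intro runsI) (auto simp: exec main_body_def six_def intro!: use_run)
  then show ?thesis using ans unfolding K_def by blast
qed

end

section \<open>Quality of the answer and running time\<close>

lemma pe_sequence_mono:
  assumes "pe_sequence R C M p e Ps" "p \<le> p'" "e \<le> e'"
  shows "pe_sequence R C M p' e' Ps"
  using assms unfolding pe_sequence_def overlapping_def by (fastforce intro: le_trans)

lemma tww_le: "pe_sequence R C M p e Ps \<Longrightarrow> tww R C M \<le> p + e"
  unfolding tww_def by (rule Least_le) blast

text \<open>
  For \<open>a = 1\<close>, the general bound on the errors exceeds every power of \<open>a\<close>, but the matrix is
  constant.
\<close>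

lemma constant_pe_sequence:
  assumes "pe_sequence R C M p e Ps" "\<And>r c. r \<in> R \<Longrightarrow> c \<in> C \<Longrightarrow> M r c = x"
  shows "pe_sequence R C M p 0 Ps"
  unfolding pe_sequence_def
proof (intro conjI)
  show cs: "contraction_sequence R C Ps" using assms(1) by (simp add: pe_sequence_def)
  show "\<forall>(P, Q)\<in>set Ps. overlapping R p P \<and> overlapping C p Q \<and>
      (\<forall>X\<in>P. error_value M Q X \<le> 0) \<and> (\<forall>Y\<in>Q. error_value (flip M) P Y \<le> 0)"
  proof clarify
    fix P Q assume PQ: "(P, Q) \<in> set Ps"
    then obtain i where "i < length Ps" "Ps ! i = (P, Q)" by (auto simp: in_set_conv_nth)
    then have part: "partition_on R P" "partition_on C Q"
      using contraction_sequence_partitions[OF cs, of i] by auto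
    have const: "constant_on_zone M X Y" "constant_on_zone (flip M) Y X" if "X \<in> P" "Y \<in> Q"
      for X Y
    proof -
      have "X \<subseteq> R" "Y \<subseteq> C" using part that by (auto simp: partition_on_def)
      then show "constant_on_zone M X Y" "constant_on_zone (flip M) Y X"
        unfolding constant_on_zone_def flip_def using assms(2) by blast+
    qed
    have "error_value M Q X = 0" if "X \<in> P" for X
    proof -
      have "{Y \<in> Q. \<not> constant_on_zone M X Y} = {}" using const that by blast
      then show ?thesis unfolding error_value_def by (simp only: card.empty)
    qed
    moreover have "error_value (flip M) P Y = 0" if "Y \<in> Q" for Y
    proof -
      have "{X \<in> P. \<not> constant_on_zone (flip M) Y X} = {}" using const that by blast
      then show ?thesis unfolding error_value_def by (simp only: card.empty)
    qed
    moreover have "overlapping R p P" "overlapping C p Q"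
      using assms(1) PQ by (auto simp: pe_sequence_def)
    ultimately show "overlapping R p P \<and> overlapping C p Q \<and>
      (\<forall>X\<in>P. error_value M Q X \<le> 0) \<and> (\<forall>Y\<in>Q. error_value (flip M) P Y \<le> 0)" by simp
  qed
qed

lemma good_answer_pe_sequence:
  assumes "good_answer M n m k p e (map (\<lambda>i. [i]) [0..<n]) (map (\<lambda>i. [i]) [0..<m]) (Sequence Ds)"
  shows "pe_sequence {..<n} {..<m} M p e (map family_pair Ds)"
proof -
  have fam: "family (map (\<lambda>i. [i]) [0..<n]) = singletons {..<n}" for n
    by (auto simp: family_def singletons_def)
  show ?thesis
    using assms unfolding good_answer_def contracts_fully_def pe_sequence_def
      contraction_sequence_def bounded_pair_def fam by auto
qed

text \<open>
  Three times \<open>2 k (k + 1)\<close>, because \<open>pair_up\<close> joins up to three intervals.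
\<close>

definition alg_q :: "nat \<Rightarrow> nat" where "alg_q k = 6 * (k * (k + 1))"

definition alg_g :: "nat \<Rightarrow> nat" where "alg_g k = alg_q k * alg_q k + 4 * alg_q k + 1"

text \<open>
  The dominating factor is \<open>(a ^ q) ^ q\<close>. The others are bounded by powers of \<open>a ^ q\<close>, because of
  \<open>q + 1 \<le> 2 ^ q \<le> a ^ q\<close>, except for the factor 2, which is at most \<open>a\<close>.
\<close>

lemma sequence_bounds:
  assumes "a \<ge> 2" "q \<ge> 2"
  shows "2 * twin_bound a q - 1 \<le> a ^ (q * q + 4 * q + 1)"
    "(q ^ 3 + q + 1) * (2 * twin_bound a q) \<le> a ^ (q * q + 4 * q + 1)"
proof -
  have "q + 1 \<le> 2 ^ q" using less_exp[of q] by (simp add: Suc_le_eq)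
  also have "(2 :: nat) ^ q \<le> a ^ q" using assms(1) by (rule power_mono) simp
  finally have q: "q + 1 \<le> a ^ q" .
  have "q ^ 3 + q + 1 \<le> (q + 1) ^ 3" by (simp add: power3_eq_cube algebra_simps)
  also have "\<dots> \<le> (a ^ q) ^ 3" using q by (rule power_mono) simp
  finally have 3: "q ^ 3 + q + 1 \<le> (a ^ q) ^ 3" .
  have "twin_bound a q = q * (a ^ q) ^ q" using assms(1) by (simp add: twin_bound_def)
  also have "\<dots> \<le> a ^ q * (a ^ q) ^ q" using q by (intro mult_right_mono) auto
  finally have t: "twin_bound a q \<le> a ^ q * (a ^ q) ^ q" .
  have "(q ^ 3 + q + 1) * (2 * twin_bound a q) \<le> (a ^ q) ^ 3 * (a * (a ^ q * (a ^ q) ^ q))"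
    using 3 t assms(1) by (intro mult_mono) auto
  also have "\<dots> = a ^ (q * q + 4 * q + 1)"
    by (simp flip: power_mult power_add power_Suc add: algebra_simps)
  finally show e: "(q ^ 3 + q + 1) * (2 * twin_bound a q) \<le> a ^ (q * q + 4 * q + 1)" .
  have "2 * twin_bound a q - 1 \<le> (q ^ 3 + q + 1) * (2 * twin_bound a q)" by simp
  then show "2 * twin_bound a q - 1 \<le> a ^ (q * q + 4 * q + 1)" using e by (rule le_trans)
qed

lemma alg_q_le: "k \<ge> 1 \<Longrightarrow> alg_q k \<le> 12 * k ^ 2"
proof -
  assume "k \<ge> 1"
  then have "k * 1 \<le> k * k" by (intro mult_left_mono) auto
  then show ?thesis by (simp add: alg_q_def power2_eq_square algebra_simps)
qed

lemma alg_g_bigo: "(\<lambda>k. real (alg_g k + c)) \<in> O(\<lambda>k. real k ^ 4)"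
proof (rule bigoI)
  show "eventually (\<lambda>k. norm (real (alg_g k + c)) \<le> real (193 + c) * norm (real k ^ 4)) at_top"
    using eventually_ge_at_top[of "1 :: nat"]
  proof eventually_elim
    case (elim k)
    have "alg_q k * alg_q k \<le> (12 * k ^ 2) * (12 * k ^ 2)" using alg_q_le[OF elim]
      by (intro mult_mono) auto
    then have 1: "alg_q k * alg_q k \<le> 144 * k ^ 4" by (simp add: numeral_eq_Suc algebra_simps)
    have "k ^ 2 \<le> k ^ 4" using elim by (intro power_increasing) auto
    then have 2: "4 * alg_q k \<le> 48 * k ^ 4" using alg_q_le[OF elim] by linarith
    have "1 \<le> k ^ 4" using elim by simp
    then have "c * 1 \<le> c * k ^ 4" by (rule mult_left_mono) simp
    then have "alg_g k + c \<le> (193 + c) * k ^ 4"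
      using 1 2 \<open>1 \<le> k ^ 4\<close> unfolding alg_g_def add_mult_distrib by linarith
    then have "real (alg_g k + c) \<le> real ((193 + c) * k ^ 4)" by (simp only: of_nat_le_iff)
    then show ?case by simp
  qed
qed

text \<open>
  The outer exponential leaves ample room: the part of the running time that does not depend on
  \<open>n + m\<close> is at most 2 to a power that is polynomial in \<open>k\<close>, and a polynomial of degree 6 is at
  most \<open>2 ^ (6 * k + c)\<close> for some constant \<open>c\<close>. So \<open>alg_f\<close> can even be linear in \<open>k\<close>. The number
  2197 is \<open>13 ^ 3\<close>, from \<open>alg_q k + 1 \<le> 13 * k\<^sup>2\<close>.
\<close>

definition alg_c :: "nat \<Rightarrow> nat" where "alg_c a = 26 * 2197 + 24 * a + 24024"

definition alg_f :: "nat \<Rightarrow> nat \<Rightarrow> real" where "alg_f a k = real (6 * k + alg_c a)"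

lemma alg_f_bigo: "alg_f a \<in> O(\<lambda>k. real k ^ 2 * log 2 (real k))"
proof (rule bigoI)
  show "eventually (\<lambda>k. norm (alg_f a k) \<le> (6 + real (alg_c a)) * norm (real k ^ 2 * log 2
    (real k))) at_top"
    using eventually_ge_at_top[of "2 :: nat"]
  proof eventually_elim
    case (elim k)
    have "log 2 2 \<le> log 2 (real k)" using elim by (subst log_le_cancel_iff) auto
    then have l: "1 \<le> log 2 (real k)" by simp
    have "real k * 1 \<le> real k * real k" using elim by (intro mult_left_mono) auto
    then have "real k * 1 \<le> real k ^ 2 * log 2 (real k)"
      unfolding power2_eq_square using l elim by (intro mult_mono) auto
    then have k: "real k \<le> real k ^ 2 * log 2 (real k)" by simp
    have "real (alg_c a) * 1 \<le> real (alg_c a) * real k" using elim by (intro mult_left_mono) auto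
    then have "alg_f a k \<le> (6 + real (alg_c a)) * real k" by (simp add: alg_f_def algebra_simps)
    also have "\<dots> \<le> (6 + real (alg_c a)) * (real k ^ 2 * log 2 (real k))"
      using k by (intro mult_left_mono) auto
    finally show ?case using l by (simp add: alg_f_def abs_mult)
  qed
qed

lemma time_bound:
  assumes k: "k \<ge> 1" and s: "s \<ge> 1" and W: "W = (alg_q k + 1) ^ 3" and N: "N = s + a + W + 1000"
    and t: "t \<le> 3 ^ W * N ^ 24"
  shows "real t \<le> 2 powr (2 powr alg_f a k) * real s ^ 24"
proof -
  define X where "X = a + W + 1001"
  (* The exponent of 4 ^ W * (2 ^ X) ^ 24 as a power of 2. *)
  define G where "G = 26 * W + 24 * a + 24024"
  have "1 * (a + W + 1000) \<le> s * (a + W + 1000)" using s by (intro mult_right_mono) auto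
  then have NX: "N \<le> s * X" unfolding N X_def by (simp add: algebra_simps)
  have XP: "X \<le> 2 ^ X" using less_exp[of X] by simp
  have "t \<le> 4 ^ W * (s * 2 ^ X) ^ 24"
    using NX XP by (intro order_trans[OF t] mult_mono power_mono) (auto intro: order_trans)
  also have "\<dots> = 2 ^ (2 * W) * 2 ^ (X * 24) * s ^ 24"
    by (simp add: power_mult_distrib power_mult)
  also have "\<dots> = 2 ^ G * s ^ 24"
    by (simp flip: power_add add: G_def X_def algebra_simps)
  finally have tG: "t \<le> 2 ^ G * s ^ 24" .
  have "alg_q k + 1 \<le> 13 * k ^ 2"
  proof -
    have "1 \<le> k ^ 2" using k by simp
    then show ?thesis using alg_q_le[OF k] by linarith
  qed
  then have "W \<le> (13 * k ^ 2) ^ 3" unfolding W by (rule power_mono) simp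
  also have "\<dots> = 2197 * k ^ 6" by (simp add: power_mult_distrib flip: power_mult)
  also have "k ^ 6 \<le> (2 ^ k) ^ 6" using less_exp[of k] by (intro power_mono) auto
  finally have WP: "W \<le> 2197 * 2 ^ (6 * k)" by (simp add: mult.commute flip: power_mult)
  have "1 \<le> (2 :: nat) ^ (6 * k)" by simp
  then have "G \<le> alg_c a * 2 ^ (6 * k)"
  proof -
    have "(24 * a + 24024) * 1 \<le> (24 * a + 24024) * 2 ^ (6 * k)" by (rule mult_left_mono) simp_all
    then show ?thesis using WP unfolding G_def alg_c_def add_mult_distrib by linarith
  qed
  also have "\<dots> \<le> 2 ^ alg_c a * 2 ^ (6 * k)" using less_exp[of "alg_c a"]
    by (intro mult_right_mono) auto
  also have "\<dots> = 2 ^ (6 * k + alg_c a)" by (simp add: power_add)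
  finally have "real G \<le> 2 ^ (6 * k + alg_c a)"
    by (metis of_nat_le_iff of_nat_numeral of_nat_power)
  also have "\<dots> = 2 powr alg_f a k" unfolding alg_f_def by (subst powr_realpow) auto
  finally have "2 powr real G \<le> 2 powr (2 powr alg_f a k)" by (intro powr_mono) auto
  then have G: "2 ^ G \<le> 2 powr (2 powr alg_f a k)" by (simp add: powr_realpow)
  have "real t \<le> real (2 ^ G * s ^ 24)" using tG by (simp only: of_nat_le_iff)
  also have "\<dots> = 2 ^ G * real s ^ 24" by simp
  also have "\<dots> \<le> 2 powr (2 powr alg_f a k) * real s ^ 24" using G by (intro mult_right_mono) auto
  finally show ?thesis .
qed

theorem theorem2:
  shows "(\<forall>(R :: 'r::linorder set) (C :: 'c::linorder set) (M :: 'r \<Rightarrow> 'c \<Rightarrow> 'a) (k :: nat) D.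
            finite R \<and> R \<noteq> {} \<and> finite C \<and> C \<noteq> {} \<and> k \<ge> 1 \<and>
            rich_division R C M (2 * k * (k + 1)) D \<longrightarrow> tww R C M > k)
       \<and> (\<exists>(prog :: program) (d :: nat) (g :: nat \<Rightarrow> nat) (h :: nat \<Rightarrow> nat).
            (\<lambda>k. real (g k)) \<in> O(\<lambda>k. real k ^ 4) \<and>
            (\<lambda>k. real (h k)) \<in> O(\<lambda>k. real k ^ 4) \<and>
            (\<forall>a :: nat. \<exists>f :: nat \<Rightarrow> real.
               f \<in> O(\<lambda>k. real k ^ 2 * log 2 (real k)) \<and>
               (\<forall>(n :: nat) (m :: nat) (M :: nat \<Rightarrow> nat \<Rightarrow> nat) (k :: nat).
                  n \<ge> 1 \<and> m \<ge> 1 \<and> k \<ge> 1 \<and> (\<forall>i<n. \<forall>j<m. M i j < a) \<longrightarrow>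
                  (\<exists>ans t.
                     run prog [enc_matrix n m M, enc_nat k] (enc_answer ans) t \<and>
                     real t \<le> 2 powr (2 powr f k) * real (n + m) ^ d \<and>
                     (case ans of
                        Division D \<Rightarrow>
                          rich_division {..<n} {..<m} M (2 * k * (k + 1)) (family_pair D) \<and>
                          tww {..<n} {..<m} M > k
                      | Sequence Ds \<Rightarrow>
                          pe_sequence {..<n} {..<m} M (a ^ g k) (a ^ g k) (map family_pair Ds) \<and>
                          tww {..<n} {..<m} M \<le> a ^ h k)))))"
proof -
  let ?quality = "\<lambda>a n m M k ans. case ans of
         Division D \<Rightarrow> rich_division {..<n} {..<m} M (2 * k * (k + 1)) (family_pair D) \<and>
           tww {..<n} {..<m} M > k
       | Sequence Ds \<Rightarrow>
           pe_sequence {..<n} {..<m} M (a ^ alg_g k) (a ^ alg_g k) (map family_pair Ds) \<and>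
           tww {..<n} {..<m} M \<le> a ^ (alg_g k + 1)"
  have main: "\<exists>ans t. run twin_prog [enc_matrix n m M, enc_nat k] (enc_answer ans) t \<and>
      real t \<le> 2 powr (2 powr alg_f a k) * real (n + m) ^ 24 \<and> ?quality a n m M k ans"
    if nm: "n \<ge> 1" "m \<ge> 1" and k: "k \<ge> 1" and ent: "\<forall>i<n. \<forall>j<m. M i j < a"
    for a n m k and M :: "nat \<Rightarrow> nat \<Rightarrow> nat"
  proof -
    define q where "q = alg_q k"
    define W where "W = (alg_q k + 1) ^ 3"
    define N where "N = (n + m) + a + W + 1000"
    have "M 0 0 < a" using ent nm by simp
    then have a: "a \<ge> 1" by simp
    interpret lisp_input n m a N M
      using ent by unfold_locales (auto simp: N_def entries_below_def)
    obtain ans where good: "good_answer M n m (2 * k * (k + 1)) (2 * twin_bound a q - 1)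
        ((q ^ 3 + q + 1) * (2 * twin_bound a q)) (map (\<lambda>i. [i]) [0..<n]) (map (\<lambda>i. [i])
          [0..<m]) ans"
      and runs: "runs MAIN [enc_matrix n m M, enc_nat k] (enc_answer ans) (3 ^ W * N ^ 24)"
      using run_main[OF _ _ k a nm, of q] by (auto simp: q_def W_def N_def alg_q_def)
    obtain t where t: "run twin_prog [enc_matrix n m M, enc_nat k] (enc_answer ans) t"
      "t \<le> 3 ^ W * N ^ 24"
      using runs unfolding runs_def wp_fn_def wp_def run_def MAIN_def by auto
    have time: "real t \<le> 2 powr (2 powr alg_f a k) * real (n + m) ^ 24"
      using nm by (intro time_bound[OF k _ W_def N_def t(2)]) simp
    have "1 * 1 \<le> k * (k + 1)" using k by (intro mult_mono) auto
    then have q2: "q \<ge> 2" by (simp add: q_def alg_q_def)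
    have "?quality a n m M k ans"
    proof (cases ans)
      case (Division D)
      then have "rich_division {..<n} {..<m} M (2 * k * (k + 1)) (family_pair D)"
        using good by (simp add: good_answer_def)
      moreover from this have "tww {..<n} {..<m} M > k"
        using nm k by (intro rich_division_tww) (auto simp: lessThan_empty_iff)
      ultimately show ?thesis using Division by simp
    next
      case (Sequence Ds)
      let ?Ps = "map family_pair Ds"
      note seq = good_answer_pe_sequence[OF good[unfolded Sequence]]
      have "pe_sequence {..<n} {..<m} M (a ^ alg_g k) (a ^ alg_g k) ?Ps \<and>
        tww {..<n} {..<m} M \<le> a ^ (alg_g k + 1)"
      proof (cases "a = 1")
        case True
        have "pe_sequence {..<n} {..<m} M 1 0 ?Ps"
          using constant_pe_sequence[OF seq, of 0] ent True by (simp add: twin_bound_def)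
        from tww_le[OF this] pe_sequence_mono[OF this, of 1 1] show ?thesis using True by simp
      next
        case False
        then have "a \<ge> 2" using a by simp
        from sequence_bounds[OF this q2]
        have s: "pe_sequence {..<n} {..<m} M (a ^ alg_g k) (a ^ alg_g k) ?Ps"
          unfolding alg_g_def q_def by (intro pe_sequence_mono[OF seq[unfolded q_def]])
        have "tww {..<n} {..<m} M \<le> a ^ alg_g k + a ^ alg_g k" by (rule tww_le[OF s])
        also have "\<dots> \<le> a * a ^ alg_g k" using mult_le_mono1[OF \<open>a \<ge> 2\<close>, of
          "a ^ alg_g k"] by linarith
        finally show ?thesis using s by simp
      qed
      then show ?thesis using Sequence by simp
    qed
    then show ?thesis using t(1) time by blast
  qed
  show ?thesis
  proof (rule conjI, goal_cases)
    case 1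
    show ?case using rich_division_tww by blast
  next
    case 2
    show ?case
    proof (rule exI[of _ twin_prog], rule exI[of _ 24], rule exI[of _ alg_g],
        rule exI[of _ "\<lambda>k. alg_g k + 1"], intro conjI allI)
      show "(\<lambda>k. real (alg_g k)) \<in> O(\<lambda>k. real k ^ 4)" using alg_g_bigo[of 0] by simp
      show "(\<lambda>k. real (alg_g k + 1)) \<in> O(\<lambda>k. real k ^ 4)" by (rule alg_g_bigo)
      fix a
      show "\<exists>f. f \<in> O(\<lambda>k. real k ^ 2 * log 2 (real k)) \<and> (\<forall>n m M k.
          n \<ge> 1 \<and> m \<ge> 1 \<and> k \<ge> 1 \<and> (\<forall>i<n. \<forall>j<m. M i j < a) \<longrightarrow>
          (\<exists>ans t. run twin_prog [enc_matrix n m M, enc_nat k] (enc_answer ans) t \<and>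
             real t \<le> 2 powr (2 powr f k) * real (n + m) ^ 24 \<and> ?quality a n m M k ans))"
      proof (rule exI[of _ "alg_f a"], intro conjI allI impI; (elim conjE)?)
        show "alg_f a \<in> O(\<lambda>k. real k ^ 2 * log 2 (real k))" by (rule alg_f_bigo)
      qed (rule main)
    qed
  qed
qed

end
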